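(* Each $(\boldsymbol\omega,\mathbf{A})\in\mathcal{P}_5$ has exactly $N-2$ eigenvalues, each $(\boldsymbol\omega,\mathbf{A})\in\mathcal{P}_{1,3}\setminus\mathcal{P}_5$ has exactly $N-1$ eigenvalues, and each $(\boldsymbol\omega,\mathbf{A})\in(\Omega_N^{\mathbb{R},+}\times\mathcal{O}_{1,3}^{\mathbb{C}})\setminus\mathcal{P}_{1,3}$ has exactly $N$ eigenvalues $\lambda_n=\lambda_n(\boldsymbol\omega,\mathbf{A})$, $0\le n\le N-1$, which satisfy the following, where $p=(\boldsymbol\omega,\mathbf{A})$ and $p_0=(\boldsymbol\omega_0,\mathbf{A}_0)$: (i) the $\lambda_n$ are continuous in $(\Omega_N^{\mathbb{R},+}\times\mathcal{O}_{1,3}^{\mathbb{C}})\setminus\mathcal{P}_{1,3}$; (ii) the $\lambda_n$, $0\le n\le N-1$, are not continuous at each point of $\mathcal{P}_{1,3}$ and have the following asymptotic behaviors. Near any given $p_0\in\mathcal{P}_{1,3r}$: $$\lim_{\mathcal{P}_{1,3}^-\cup\mathcal{P}_{1,3r}\ni p\to p_0}\lambda_n(p)=\lambda_n(p_0),\ 0\le n\le N-2,\quad \lim_{\mathcal{P}_{1,3}^-\ni p\to p_0}\lambda_{N-1}(p)=+\infty,$$ $$\lim_{\mathcal{P}_{1,3r}^+\ni p\to p_0}\lambda_0(p)=-\infty,\quad \lim_{\mathcal{P}_{1,3r}^+\ni p\to p_0}\lambda_n(p)=\lambda_{n-1}(p_0),\ 1\le n\le N-1.$$ Near any given $p_0\in\mathcal{P}_{1,3l}$: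 $$\lim_{\mathcal{P}_{1,3}^-\ni p\to p_0}\lambda_0(p)=-\infty,\quad \lim_{\mathcal{P}_{1,3}^-\ni p\to p_0}\lambda_n(p)=\lambda_{n-1}(p_0),\ 1\le n\le N-1,$$ $$\lim_{\mathcal{P}_{1,3l}^+\cup\mathcal{P}_{1,3l}\ni p\to p_0}\lambda_n(p)=\lambda_n(p_0),\ 0\le n\le N-2,\quad \lim_{\mathcal{P}_{1,3l}^+\ni p\to p_0}\lambda_{N-1}(p)=+\infty.$$ Near any given $p_0\in\mathcal{P}_5$: $$\lim_{\mathcal{P}_{1,3r}^+\cup\mathcal{P}_{1,3r}\cup\mathcal{P}_{1,3}^-\ni p\to p_0}\lambda_0(p)=-\infty,\quad \lim_{\mathcal{P}_{1,3r}^+\ni p\to p_0}\lambda_1(p)=-\infty,$$ $$\lim_{\mathcal{P}_{1,3l}^+\cup\mathcal{P}_{1,3l}\cup\mathcal{P}_5\ni p\to p_0}\lambda_n(p)=\lambda_n(p_0),\ 0\le n\le N-3,$$ $$\lim_{\mathcal{P}_{1,3r}\cup\mathcal{P}_{1,3}^-\ni p\to p_0}\lambda_n(p)=\lambda_{n-1}(p_0),\ 1\le n\le N-2,$$ $$\lim_{\mathcal{P}_{1,3r}^+\ni p\to p_0}\lambda_n(p)=\lambda_{n-2}(p_0),\ 2\le n\le N-1,$$ $$\lim_{\mathcal{P}_{1,3l}^+\cup\mathcal{P}_{1,3l}\ni p\to p_0}\lambda_{N-2}(p)=+\infty,\quad \lim_{\mathcal{P}_{1,3l}^+\cup\mathcal{P}_{1,3}^-\ni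 p\to p_0}\lambda_{N-1}(p)=+\infty.$$ Consequently, $\lambda_n$ restricted in $\mathcal{P}_{1,3}^-\cup\mathcal{P}_{1,3r}$ and in $\mathcal{P}_{1,3l}^+\cup\mathcal{P}_{1,3l}\cup\mathcal{P}_5$ is continuous for each $0\le n\le N-3$, and $\lambda_{N-2}$ restricted in $\mathcal{P}_{1,3}^-\cup\mathcal{P}_{1,3r}$ and in $\mathcal{P}_{1,3l}^+\cup\mathcal{P}_{1,3l}$ is continuous.
   Context: Fix an integer $N\ge 2$. A self-adjoint discrete Sturm–Liouville problem is a pair $(\boldsymbol\omega,\mathbf{A})$. Here $\boldsymbol\omega=(1/f,q,w)$ with real sequences $f=\{f_n\}_{n=0}^N$, $q=\{q_n\}_{n=1}^N$, $w=\{w_n\}_{n=1}^N$, $f_n\ne0$, $w_n>0$, encodes the equation $-\nabla(f_n\Delta y_n)+q_ny_n=\lambda w_ny_n$, $1\le n\le N$, for $y=(y_0,\dots,y_{N+1})$, with $\Delta y_n=y_{n+1}-y_n$, $\nabla y_n=y_n-y_{n-1}$; the set $\Omega_N^{\mathbb{R},+}$ of all such $(1/f,q,w)$ has the topology of a subset of $\mathbb{R}^{3N+1}$. $\mathbf{A}=[A\,|\,B]$ encodes the boundary condition $A\begin{pmatrix}y_0\\ f_0\Delta y_0\end{pmatrix}+B\begin{pmatrix}y_N\\ f_N\Delta y_N\end{pmatrix}=0$, where $A,B$ are complex $2\times2$ matrices with $\mathrm{rank}(A,B)=2$ and $AJA^*=BJB^*$, $J=\begin{pmatrix}0&1\\-1&0\end{pmatrix}$;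 $[A\,|\,B]$ is the class of the $2\times4$ matrix $(A,B)$ modulo left multiplication by $GL(2,\mathbb{C})$, and $\mathcal{B}^{\mathbb{C}}$ is the set of all such classes, topologized as a subspace of the quotient of the rank-2 complex $2\times4$ matrices by $GL(2,\mathbb{C})$. $\Omega_N^{\mathbb{R},+}\times\mathcal{B}^{\mathbb{C}}$ has the product topology. An eigenvalue of $(\boldsymbol\omega,\mathbf{A})$ is a $\lambda$ for which a nonzero $y$ solves the equation and the boundary condition. Eigenvalues are real and finite in number; they are counted with multiplicity (the dimension of the solution space) and listed as $\lambda_0\le\lambda_1\le\cdots$; $\lambda_n$ is defined at a problem only if it has more than $n$ eigenvalues, and $\lambda_n$ is regarded as not continuous at a point where it is not defined. Assertions over empty ranges of $n$ are vacuous. $\mathcal{O}_{1,3}^{\mathbb{C}}=\left\{\left[\begin{array}{cccc}1&a_{12}&0&\bar z\\0&z&-1&b_{22}\end{array}\right]:a_{12},b_{22}\in\mathbb{R},\ z\in\mathbb{C}\right\}$, an open subset of $\mathcal{B}^{\mathbb{C}}$. For $(\boldsymbol\omega,\mathbf{A})\in\Omega_N^{\mathbb{R},+}\times\mathcal{O}_{1,3}^{\mathbb{C}}$ put $d=(a_{12}-1/f_0)b_{22}-|z|^2$. $\mathcal{P}_5$ is the set of $(\boldsymbol\omega,\mathbf{A})\in\Omega_N^{\mathbb{R},+}\times\mathcal{B}^{\mathbb{C}}$ with $\mathbf{A}=\left[\begin{array}{cccc}1&1/f_0&0&0\\0&0&1&0\end{array}\right]$. As subsets of $\Omega_N^{\mathbb{R},+}\times\mathcal{O}_{1,3}^{\mathbb{C}}$: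 $\mathcal{P}_{1,3}=\{d=0\}$; $\mathcal{P}_{1,3}^-=\{d<0\}$; $\mathcal{P}_{1,3r}=\{d=0,\ a_{12}-1/f_0\ge0,\ b_{22}\ge0\}\setminus\mathcal{P}_5$; $\mathcal{P}_{1,3l}=\{d=0,\ a_{12}-1/f_0\le0,\ b_{22}\le0\}\setminus\mathcal{P}_5$; $\mathcal{P}_{1,3r}^+=\{d>0,\ a_{12}-1/f_0\ge0,\ b_{22}\ge0\}$; $\mathcal{P}_{1,3l}^+=\{d>0,\ a_{12}-1/f_0\le0,\ b_{22}\le0\}$.
   Formalization: Discontinuity of λ_n at p_0 in P_{1,3} is asserted except when 0<n, λ_n(p_0) is defined and λ_{n-1}(p_0)=λ_n(p_0); at such multiple eigenvalues λ_n can be continuous (e.g. N=3, f=w=1, q=(0,-2,-1), a12=2, b22=1, z=1, n=1). *)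

theory Defs
  imports "HOL-Analysis.Analysis" "HOL-Library.Function_Algebras"
begin

section \<open>The space of equations\<close>

text \<open>
  An equation is a triple \<open>(r, q, w)\<close> with \<open>r = 1/f\<close>. The index ranges \<open>{0..N}\<close>, \<open>{1..N}\<close>,
  \<open>{1..N}\<close> give the topology of \<open>\<real>\<^sup>N\<^sup>+\<^sup>1 \<times> \<real>\<^sup>N \<times> \<real>\<^sup>N\<close>; sequences are \<^const>\<open>undefined\<close> off their range.
\<close>

type_synonym equation = "(nat \<Rightarrow> real) \<times> (nat \<Rightarrow> real) \<times> (nat \<Rightarrow> real)"

definition Omega :: "nat \<Rightarrow> equation set" where
  "Omega N = {(r, q, w). r \<in> extensional {0..N} \<and> q \<in> extensional {1..N} \<and> w \<in> extensional {1..N} \<and>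
     (\<forall>n\<in>{0..N}. r n \<noteq> 0) \<and> (\<forall>n\<in>{1..N}. w n > 0)}"

definition Omega_top :: "nat \<Rightarrow> equation topology" where
  "Omega_top N = subtopology
     (prod_topology (product_topology (\<lambda>_. euclideanreal) {0..N})
       (prod_topology (product_topology (\<lambda>_. euclideanreal) {1..N})
         (product_topology (\<lambda>_. euclideanreal) {1..N})))
     (Omega N)"


section \<open>The space of self-adjoint boundary conditions\<close>

definition left_half :: "complex^4^2 \<Rightarrow> complex^2^2" where
  "left_half M = (\<chi> i. vector [M $ i $ 1, M $ i $ 2])"

definition right_half :: "complex^4^2 \<Rightarrow> complex^2^2" where
  "right_half M = (\<chi> i. vector [M $ i $ 3, M $ i $ 4])"

definition adjoint_matrix :: "complex^2^2 \<Rightarrow> complex^2^2" where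
  "adjoint_matrix A = (\<chi> i j. cnj (A $ j $ i))"

definition J :: "complex^2^2" where
  "J = vector [vector [0, 1], vector [-1, 0]]"

definition rank2_matrices :: "(complex^4^2) set" where
  "rank2_matrices = {M. rank M = 2}"

definition gl_class :: "complex^4^2 \<Rightarrow> (complex^4^2) set" where
  "gl_class M = {T ** M | T. invertible T}"

definition quotient_topology :: "'a topology \<Rightarrow> ('a \<Rightarrow> 'b) \<Rightarrow> 'b topology" where
  "quotient_topology X p =
     topology (\<lambda>U. U \<subseteq> p ` topspace X \<and> openin X {x \<in> topspace X. p x \<in> U})"

lemma openin_quotient_topology:
  "openin (quotient_topology X p) U \<longleftrightarrow>
     U \<subseteq> p ` topspace X \<and> openin X {x \<in> topspace X. p x \<in> U}"
proof -
  have "istopology (\<lambda>U. U \<subseteq> p ` topspace X \<and> openin X {x \<in> topspace X. p x \<in> U})"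
    unfolding istopology_def
  proof (intro conjI allI impI)
    fix S T
    assume S: "S \<subseteq> p ` topspace X \<and> openin X {x \<in> topspace X. p x \<in> S}"
      and T: "T \<subseteq> p ` topspace X \<and> openin X {x \<in> topspace X. p x \<in> T}"
    show "S \<inter> T \<subseteq> p ` topspace X"
      using S by blast
    have "{x \<in> topspace X. p x \<in> S \<inter> T} =
        {x \<in> topspace X. p x \<in> S} \<inter> {x \<in> topspace X. p x \<in> T}"
      by blast
    then show "openin X {x \<in> topspace X. p x \<in> S \<inter> T}"
      using S T by auto
  next
    fix K
    assume K: "\<forall>U\<in>K. U \<subseteq> p ` topspace X \<and> openin X {x \<in> topspace X. p x \<in> U}"
    then show "\<Union>K \<subseteq> p ` topspace X"
      by blast
    have "{x \<in> topspace X. p x \<in> \<Union>K} = (\<Union>U\<in>K. {x \<in> topspace X. p x \<in> U})"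
      by blast
    then show "openin X {x \<in> topspace X. p x \<in> \<Union>K}"
      using K by auto
  qed
  then show ?thesis
    unfolding quotient_topology_def by (simp add: topology_inverse')
qed

lemma topspace_quotient_topology: "topspace (quotient_topology X p) = p ` topspace X"
proof -
  have "{x \<in> topspace X. p x \<in> p ` topspace X} = topspace X"
    by blast
  then have "openin (quotient_topology X p) (p ` topspace X)"
    by (simp add: openin_quotient_topology)
  then show ?thesis
    by (metis openin_quotient_topology openin_subset openin_topspace subset_antisym)
qed

lemma quotient_map_quotient_topology: "quotient_map X (quotient_topology X p) p"
  by (auto simp: quotient_map_def topspace_quotient_topology openin_quotient_topology)

definition BC :: "(complex^4^2) set set" where
  "BC = {gl_class M | M. M \<in> rank2_matrices \<and>
     left_half M ** J ** adjoint_matrix (left_half M) =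
     right_half M ** J ** adjoint_matrix (right_half M)}"

definition BC_top :: "(complex^4^2) set topology" where
  "BC_top = subtopology (quotient_topology (top_of_set rank2_matrices) gl_class) BC"

type_synonym problem = "equation \<times> (complex^4^2) set"

definition problem_top :: "nat \<Rightarrow> problem topology" where
  "problem_top N = prod_topology (Omega_top N) BC_top"


section \<open>Eigenvalues\<close>

text \<open>
  A vector \<open>(y\<^sub>0, \<dots>, y\<^bsub>N+1\<^esub>)\<close> is a sequence vanishing beyond \<open>N + 1\<close>. The boundary condition does
  not depend on the representative \<open>M\<close> of the class.
\<close>

fun solutions :: "nat \<Rightarrow> problem \<Rightarrow> complex \<Rightarrow> (nat \<Rightarrow> complex) set" where
  "solutions N ((r, q, w), \<A>) \<mu> = {y.
     (\<forall>n>N + 1. y n = 0) \<and>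
     (let D = (\<lambda>n. of_real (1 / r n) * (y (n + 1) - y n)) in
       (\<forall>n\<in>{1..N}. - (D n - D (n - 1)) + of_real (q n) * y n = \<mu> * of_real (w n) * y n) \<and>
       (\<forall>M\<in>\<A>. left_half M *v vector [y 0, D 0] + right_half M *v vector [y N, D N] = 0))}"

definition eigenvalues :: "nat \<Rightarrow> problem \<Rightarrow> complex set" where
  "eigenvalues N p = {\<mu>. \<exists>y\<in>solutions N p \<mu>. y \<noteq> 0}"

definition cscale :: "complex \<Rightarrow> (nat \<Rightarrow> complex) \<Rightarrow> nat \<Rightarrow> complex" where
  "cscale c y = (\<lambda>n. c * y n)"

lemma vector_space_cscale: "vector_space cscale"
  by unfold_locales (auto simp: cscale_def fun_eq_iff algebra_simps)

definition mult :: "nat \<Rightarrow> problem \<Rightarrow> complex \<Rightarrow> nat" where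
  "mult N p \<mu> = vector_space.dim cscale (solutions N p \<mu>)"

definition num_eigenvalues :: "nat \<Rightarrow> problem \<Rightarrow> nat" where
  "num_eigenvalues N p = (\<Sum>\<mu>\<in>eigenvalues N p. mult N p \<mu>)"

text \<open>Finiteness is required explicitly since a sum over an infinite set is \<open>0\<close>; reality
  makes the increasing listing below a listing of all eigenvalues.\<close>

definition has_exactly_eigenvalues :: "nat \<Rightarrow> problem \<Rightarrow> nat \<Rightarrow> bool" where
  "has_exactly_eigenvalues N p k \<longleftrightarrow>
     finite (eigenvalues N p) \<and> eigenvalues N p \<subseteq> \<real> \<and> num_eigenvalues N p = k"

definition eigenvalue_list :: "nat \<Rightarrow> problem \<Rightarrow> real list" where
  "eigenvalue_list N p = concat (map (\<lambda>x. replicate (mult N p (of_real x)) x)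
     (sorted_list_of_set {x. of_real x \<in> eigenvalues N p}))"

text \<open>\<open>lam N n p\<close> is meaningful only if \<open>n < num_eigenvalues N p\<close>.\<close>

definition lam :: "nat \<Rightarrow> nat \<Rightarrow> problem \<Rightarrow> real" where
  "lam N n p = eigenvalue_list N p ! n"

definition lam_continuous_at :: "nat \<Rightarrow> nat \<Rightarrow> problem \<Rightarrow> bool" where
  "lam_continuous_at N n p \<longleftrightarrow>
     n < num_eigenvalues N p \<and> topcontinuous_at (problem_top N) euclideanreal (lam N n) p"

definition lam_continuous_on :: "nat \<Rightarrow> nat \<Rightarrow> problem set \<Rightarrow> bool" where
  "lam_continuous_on N n S \<longleftrightarrow>
     (\<forall>p\<in>S. n < num_eigenvalues N p) \<and>
     continuous_map (subtopology (problem_top N) S) euclideanreal (lam N n)"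

text \<open>The filter \<open>S \<ni> p \<rightarrow> p\<^sub>0\<close>, with \<open>p \<noteq> p\<^sub>0\<close>.\<close>

abbreviation approach :: "nat \<Rightarrow> problem set \<Rightarrow> problem \<Rightarrow> problem filter" where
  "approach N S p\<^sub>0 \<equiv> atin_within (problem_top N) p\<^sub>0 S"


section \<open>The regions of the chart\<close>

definition chart_class :: "real \<Rightarrow> real \<Rightarrow> complex \<Rightarrow> (complex^4^2) set" where
  "chart_class a12 b22 z = gl_class (vector
     [vector [1, of_real a12, 0, cnj z],
      vector [0, z, -1, of_real b22]])"

text \<open>
  \<open>region N Q\<close> is the set of problems over the chart whose quantities
  \<open>\<alpha> = a\<^sub>1\<^sub>2 - 1/f\<^sub>0\<close>, \<open>b = b\<^sub>2\<^sub>2\<close> and \<open>d = \<alpha> b - |z|\<^sup>2\<close> satisfy \<open>Q \<alpha> b d\<close>. The entries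
  \<open>a\<^sub>1\<^sub>2, b\<^sub>2\<^sub>2, z\<close> are determined by the class, as the columns 1 and 3 are normalised.
\<close>

definition region :: "nat \<Rightarrow> (real \<Rightarrow> real \<Rightarrow> real \<Rightarrow> bool) \<Rightarrow> problem set" where
  "region N Q = {((r, q, w), chart_class a12 b22 z) | r q w a12 b22 z.
     (r, q, w) \<in> Omega N \<and> Q (a12 - r 0) b22 ((a12 - r 0) * b22 - (cmod z)\<^sup>2)}"

definition P5 :: "nat \<Rightarrow> problem set" where
  "P5 N = {((r, q, w), gl_class (vector
       [vector [1, of_real (r 0), 0, 0],
        vector [0, 0, 1, 0]])) | r q w. (r, q, w) \<in> Omega N}"

definition chart :: "nat \<Rightarrow> problem set" where
  "chart N = region N (\<lambda>_ _ _. True)"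

definition P13 :: "nat \<Rightarrow> problem set" where
  "P13 N = region N (\<lambda>\<alpha> b d. d = 0)"

definition P13_minus :: "nat \<Rightarrow> problem set" where
  "P13_minus N = region N (\<lambda>\<alpha> b d. d < 0)"

definition P13r :: "nat \<Rightarrow> problem set" where
  "P13r N = region N (\<lambda>\<alpha> b d. d = 0 \<and> \<alpha> \<ge> 0 \<and> b \<ge> 0) - P5 N"

definition P13l :: "nat \<Rightarrow> problem set" where
  "P13l N = region N (\<lambda>\<alpha> b d. d = 0 \<and> \<alpha> \<le> 0 \<and> b \<le> 0) - P5 N"

definition P13r_plus :: "nat \<Rightarrow> problem set" where
  "P13r_plus N = region N (\<lambda>\<alpha> b d. d > 0 \<and> \<alpha> \<ge> 0 \<and> b \<ge> 0)"

definition P13l_plus :: "nat \<Rightarrow> problem set" where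
  "P13l_plus N = region N (\<lambda>\<alpha> b d. d > 0 \<and> \<alpha> \<le> 0 \<and> b \<le> 0)"

end

theory Submission
  imports Defs
begin

text \<open>
  In the unknowns \<open>(f\<^sub>0\<Delta>y\<^sub>0, y\<^sub>1, \<dots>, y\<^sub>N, f\<^sub>N\<Delta>y\<^sub>N)\<close> a problem over the chart is a Hermitian pencil \<open>G - \<lambda> W\<close>
  on \<open>\<complex>\<close>-tuples of length \<open>N + 2\<close>: \<open>W \<ge> 0\<close> vanishes exactly on the two end components, and there \<open>G\<close>
  is the form \<open>K\<close> with diagonal entries \<open>\<alpha>\<close>, \<open>b\<close> and determinant \<open>d\<close>. Let \<open>\<pi>\<close> and \<open>\<nu>\<close> be the numbers of
  positive and negative squares of \<open>K\<close>. As \<open>\<lambda>\<close> increases, the number of negative squares of \<open>G - \<lambda> W\<close>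
  jumps exactly at the eigenvalues, by their multiplicity, from \<open>2 - \<pi>\<close> at \<open>-\<infinity>\<close> to \<open>N + \<nu>\<close> at \<open>\<infinity>\<close>.
  Hence there are \<open>N + \<pi> + \<nu> - 2\<close> eigenvalues. Off the spectrum of \<open>p\<^sub>0\<close> the number of negative squares
  is locally constant in \<open>p\<close>, so near \<open>p\<^sub>0\<close> the number of eigenvalues below a fixed \<open>\<lambda>\<close> changes by
  \<open>\<pi>(p) - \<pi>(p\<^sub>0)\<close>: this many eigenvalues have gone to \<open>-\<infinity>\<close>, and all the limits follow.
\<close>


section \<open>Hermitian forms and their inertia\<close>

text \<open>The obstacle is that \<open>W\<close> is degenerate: the pencil is not an ordinary
  Hermitian eigenvalue problem, and the number of eigenvalues varies from point to point. Hence no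
  eigenvalue is followed individually; only squares are counted. The main analytic input is that the
  number of negative squares cannot drop in a limit. Applied to a form and to its negative, it
  yields equality wherever Sylvester's law leaves no spare dimension. The value 2 - \<pi> at
  -\<infinity> counts the null directions of K as negative. Such a direction c has a partner E c
  with which G pairs it nontrivially, while W vanishes against c; the two span a hyperbolic plane,
  with one negative and one positive square whatever \<lambda> is. The same pairing rules out a null
  vector common to all \<lambda>. Near a degenerate point the index of an eigenvalue shifts by the
  number of eigenvalues lost to -\<infinity>. At a double eigenvalue the shifted and unshifted
  limits may coincide, which is why discontinuity is claimed only away from such
  coincidences.\<close>

locale complex_space = vector_space scale
  for scale :: "complex \<Rightarrow> 'v::ab_group_add \<Rightarrow> 'v" (infixr "\<odot>" 75)
begin

definition hermitian :: "('v \<Rightarrow> 'v \<Rightarrow> complex) \<Rightarrow> bool" where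
  "hermitian h \<longleftrightarrow> (\<forall>x y z. h (x + y) z = h x z + h y z) \<and> (\<forall>c x y. h (c \<odot> x) y = c * h x y) \<and>
     (\<forall>x y. h y x = cnj (h x y))"

definition negative_on :: "('v \<Rightarrow> 'v \<Rightarrow> complex) \<Rightarrow> 'v set \<Rightarrow> bool" where
  "negative_on h S \<longleftrightarrow> (\<forall>x\<in>S. x \<noteq> 0 \<longrightarrow> Re (h x x) < 0)"

definition finite_dim :: "'v set \<Rightarrow> bool" where
  "finite_dim V \<longleftrightarrow> (\<exists>B. finite B \<and> V = span B)"

definition radical :: "('v \<Rightarrow> 'v \<Rightarrow> complex) \<Rightarrow> 'v set \<Rightarrow> 'v set" where
  "radical h V = {x \<in> V. \<forall>y\<in>V. h x y = 0}"

text \<open>The negative index of inertia as the largest dimension of a negative subspace. This form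
  needs no chosen basis, so two different forms can be compared directly. \<open>Max\<close> is
  meaningful when \<open>V\<close> is finite dimensional; the positive index is the negative index
  of the negated form.\<close>

definition neg_index :: "('v \<Rightarrow> 'v \<Rightarrow> complex) \<Rightarrow> 'v set \<Rightarrow> nat" where
  "neg_index h V = Max (card ` {S. finite S \<and> independent S \<and> S \<subseteq> V \<and> negative_on h (span S)})"

definition diag_basis :: "('v \<Rightarrow> 'v \<Rightarrow> complex) \<Rightarrow> 'v set \<Rightarrow> 'v set \<Rightarrow> bool" where
  "diag_basis h V B \<longleftrightarrow> finite B \<and> independent B \<and> span B = V \<and>
     (\<forall>b\<in>B. \<forall>c\<in>B. b \<noteq> c \<longrightarrow> h b c = 0) \<and> (\<forall>b\<in>B. h b b \<in> {-1, 0, 1})"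

lemma diag_basisD:
  assumes "diag_basis h V B"
  shows "finite B" "independent B" "span B = V" "B \<subseteq> V"
    "\<And>b c. b \<in> B \<Longrightarrow> c \<in> B \<Longrightarrow> b \<noteq> c \<Longrightarrow> h b c = 0" "\<And>b. b \<in> B \<Longrightarrow> h b b \<in> {-1, 0, 1}"
  using assms span_superset[of B] unfolding diag_basis_def by blast+

section \<open>Algebra of Hermitian forms\<close>

lemma hermitian_add_left: "hermitian h \<Longrightarrow> h (x + y) z = h x z + h y z"
  and hermitian_scale_left: "hermitian h \<Longrightarrow> h (c \<odot> x) y = c * h x y"
  and hermitian_cnj: "hermitian h \<Longrightarrow> h y x = cnj (h x y)"
  unfolding hermitian_def by blast+

lemma hermitianI:
  assumes "\<And>x y z. h (x + y) z = h x z + h y z" "\<And>c x y. h (c \<odot> x) y = c * h x y"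
    and "\<And>x y. h y x = cnj (h x y)"
  shows "hermitian h"
  unfolding hermitian_def using assms by blast

lemma hermitian_add_right: "hermitian h \<Longrightarrow> h z (x + y) = h z x + h z y"
  by (metis hermitian_add_left hermitian_cnj complex_cnj_add)

lemma hermitian_scale_right: "hermitian h \<Longrightarrow> h y (c \<odot> x) = cnj c * h y x"
  by (metis hermitian_scale_left hermitian_cnj complex_cnj_mult)

lemma hermitian_zero_left: "hermitian h \<Longrightarrow> h 0 y = 0"
  by (metis hermitian_scale_left mult_zero_left scale_zero_left)

lemma hermitian_zero_right: "hermitian h \<Longrightarrow> h y 0 = 0"
  by (metis hermitian_zero_left hermitian_cnj complex_cnj_zero)

lemma hermitian_minus_left: "hermitian h \<Longrightarrow> h (- x) y = - h x y"
  by (metis add.left_inverse add_eq_0_iff2 hermitian_add_left hermitian_zero_left)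

lemma hermitian_minus_right: "hermitian h \<Longrightarrow> h y (- x) = - h y x"
  by (metis hermitian_minus_left hermitian_cnj complex_cnj_minus)

lemma hermitian_diff_left: "hermitian h \<Longrightarrow> h (x - y) z = h x z - h y z"
  by (metis ab_group_add_class.ab_diff_conv_add_uminus hermitian_add_left hermitian_minus_left)

lemma hermitian_diff_right: "hermitian h \<Longrightarrow> h z (x - y) = h z x - h z y"
  by (metis ab_group_add_class.ab_diff_conv_add_uminus hermitian_add_right hermitian_minus_right)

lemmas hermitian_simps = hermitian_add_left hermitian_add_right hermitian_scale_left
  hermitian_scale_right hermitian_zero_left hermitian_zero_right hermitian_minus_left
  hermitian_minus_right hermitian_diff_left hermitian_diff_right

lemma hermitian_sum_left: "hermitian h \<Longrightarrow> h (\<Sum>i\<in>I. f i) y = (\<Sum>i\<in>I. h (f i) y)"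
  by (induction I rule: infinite_finite_induct) (auto simp: hermitian_simps)

lemma hermitian_sum_right: "hermitian h \<Longrightarrow> h y (\<Sum>i\<in>I. f i) = (\<Sum>i\<in>I. h y (f i))"
  by (induction I rule: infinite_finite_induct) (auto simp: hermitian_simps)

lemma hermitian_real: "hermitian h \<Longrightarrow> h x x = of_real (Re (h x x))"
  by (metis Reals_cnj_iff hermitian_cnj of_real_Re)

lemma hermitian_uminus: "hermitian h \<Longrightarrow> hermitian (\<lambda>x y. - h x y)"
  by (rule hermitianI) (simp_all add: hermitian_simps hermitian_cnj[of h, symmetric])

lemma hermitian_combine:
  "hermitian h \<Longrightarrow> hermitian k \<Longrightarrow> hermitian (\<lambda>x y. of_real s * h x y + of_real t * k x y)"
  by (rule hermitianI)
    (simp_all add: hermitian_simps hermitian_cnj[of h, symmetric] hermitian_cnj[of k, symmetric] algebra_simps)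

section \<open>Finite-dimensional subspaces\<close>

lemma finite_dim_subspace: "finite_dim V \<Longrightarrow> subspace V"
  by (auto simp: finite_dim_def)

lemma finite_dim_independent:
  assumes "finite_dim V" "independent S" "S \<subseteq> V"
  shows "finite S \<and> card S \<le> dim V"
proof -
  obtain B where B: "finite B" "V = span B" using assms(1) by (auto simp: finite_dim_def)
  obtain C where C: "C \<subseteq> V" "independent C" "V \<subseteq> span C" "card C = dim V"
    using basis_exists[of V] by blast
  have "finite C" using independent_span_bound[OF B(1) C(2)] C(1) B(2) by auto
  then show ?thesis using independent_span_bound[of C S] assms(2,3) C by auto
qed

lemma finite_dim_subset_basis:
  assumes "finite_dim V" "subspace S" "S \<subseteq> V"
  obtains B where "finite B" "independent B" "span B = S" "card B = dim S"
proof -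
  obtain C where C: "C \<subseteq> S" "independent C" "S \<subseteq> span C" "card C = dim S"
    using basis_exists[of S] by blast
  have "finite C" using finite_dim_independent[OF assms(1) C(2)] C(1) assms(3) by auto
  moreover have "span C = S" using C assms(2) by (simp add: span_subspace)
  ultimately show ?thesis using that C by blast
qed

lemma finite_dim_subset:
  "finite_dim V \<Longrightarrow> subspace S \<Longrightarrow> S \<subseteq> V \<Longrightarrow> finite_dim S"
  by (metis finite_dim_subset_basis finite_dim_def)

lemma subspace_radical: "hermitian h \<Longrightarrow> subspace V \<Longrightarrow> subspace (radical h V)"
  by (auto simp: radical_def subspace_def hermitian_simps)

section \<open>Diagonalisation of Hermitian forms\<close>

text \<open>The vector x + y gives \<open>h y x = - h x y\<close>, and x + i y gives
  \<open>h y x = h x y\<close>.\<close>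

lemma hermitian_polarization:
  assumes h: "hermitian h" and V: "subspace V" and z: "\<And>x. x \<in> V \<Longrightarrow> h x x = 0"
    and x: "x \<in> V" and y: "y \<in> V"
  shows "h x y = 0"
proof -
  have "h (x + y) (x + y) = 0" using V x y z by (simp add: subspace_add)
  then have 1: "h x y + h y x = 0" using z x y h by (simp add: hermitian_simps algebra_simps)
  have "h (x + \<i> \<odot> y) (x + \<i> \<odot> y) = 0" using V x y z by (simp add: subspace_add subspace_scale)
  then have "\<i> * h y x - \<i> * h x y = 0" using z x y h by (simp add: hermitian_simps algebra_simps)
  then have "h y x = h x y" by simp
  then show ?thesis using 1 by simp
qed

text \<open>Induction on the dimension: a vector with nonzero square is normalised and split off
  from its orthogonal complement. If there is none, polarization makes the form vanish and any basis
  serves.\<close>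

lemma diag_basis_exists:
  assumes h: "hermitian h" and V: "finite_dim V"
  shows "\<exists>B. diag_basis h V B"
  using V
proof (induction "dim V" arbitrary: V rule: less_induct)
  case less
  note V = less.prems
  note sV = finite_dim_subspace[OF V]
  show ?case
  proof (cases "\<forall>x\<in>V. h x x = 0")
    case True
    then have z: "h x y = 0" if "x \<in> V" "y \<in> V" for x y
      using hermitian_polarization[OF h sV] that by blast
    obtain B where B: "finite B" "independent B" "span B = V"
      using finite_dim_subset_basis[OF V sV] by blast
    then have "B \<subseteq> V" using span_superset by blast
    then have "diag_basis h V B" using B z by (auto simp: diag_basis_def subset_iff)
    then show ?thesis by blast
  next
    case False
    then obtain x where x: "x \<in> V" "h x x \<noteq> 0" by blast
    define a where "a = Re (h x x)"
    have hx: "h x x = of_real a" "a \<noteq> 0"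
      using hermitian_real[OF h, of x] x(2) by (auto simp: a_def)
    define e where "e = of_real (1 / sqrt \<bar>a\<bar>) \<odot> x"
    have eV: "e \<in> V" using x sV by (simp add: e_def subspace_scale)
    have "h e e = of_real (1 / sqrt \<bar>a\<bar>) * of_real (1 / sqrt \<bar>a\<bar>) * of_real a"
      using h by (simp add: e_def hermitian_simps hx)
    also have "\<dots> = of_real (a / \<bar>a\<bar>)"
      using real_sqrt_mult_self[of "\<bar>a\<bar>"] by (simp flip: of_real_mult)
    also have "\<dots> \<in> {-1, 1}" using hx(2) by (auto simp: abs_if)
    finally have ee: "h e e \<in> {-1, 1}" .
    define S where "S = {y \<in> V. h y e = 0}"
    have sS: "subspace S" using sV h by (auto simp: S_def subspace_def hermitian_simps)
    have SV: "S \<subseteq> V" by (auto simp: S_def)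
    have fS: "finite_dim S" using finite_dim_subset V sS SV by blast
    have eS: "e \<notin> S" using ee by (auto simp: S_def)
    have "dim S < dim V"
    proof -
      obtain C where C: "finite C" "independent C" "span C = S" "card C = dim S"
        using finite_dim_subset_basis[OF V sS SV] by blast
      have "independent (insert e C)" using C eS by (simp add: independent_insertI)
      moreover have "insert e C \<subseteq> V" using C eV SV span_superset by blast
      ultimately have "card (insert e C) \<le> dim V" using finite_dim_independent[OF V] by blast
      moreover have "e \<notin> C" using eS C span_superset by blast
      ultimately show ?thesis using C by simp
    qed
    then obtain B where B: "diag_basis h S B" using less.hyps[OF _ fS] by blast
    have BS: "B \<subseteq> S" "span B = S" "finite B" "independent B"
      using diag_basisD[OF B] by blast+
    have orth: "h b e = 0" "h e b = 0" if "b \<in> B" for b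
      using that BS(1) hermitian_cnj[OF h, of e b] by (auto simp: S_def)
    have "span (insert e B) = V"
    proof
      show "span (insert e B) \<subseteq> V"
        using eV BS(1) SV sV by (intro span_minimal) auto
      show "V \<subseteq> span (insert e B)"
      proof
        fix y assume y: "y \<in> V"
        \<comment> \<open>Gram-Schmidt: this difference is the component of \<open>y\<close>
          orthogonal to \<open>e\<close>.\<close>
        have "y - (h y e / h e e) \<odot> e \<in> S"
          using y eV sV ee h by (auto simp: S_def hermitian_simps subspace_diff subspace_scale)
        then show "y \<in> span (insert e B)" using BS(2) by (auto simp: span_insert)
      qed
    qed
    moreover have "independent (insert e B)" using BS eS by (simp add: independent_insertI)
    ultimately have "diag_basis h V (insert e B)"
      using B ee orth by (auto simp: diag_basis_def)
    then show ?thesis by blast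
  qed
qed

lemma hermitian_sum_diag:
  assumes h: "hermitian h" and "finite A" and orth: "\<And>b c. b \<in> A \<Longrightarrow> c \<in> A \<Longrightarrow> b \<noteq> c \<Longrightarrow> h b c = 0"
  shows "h (\<Sum>b\<in>A. f b \<odot> b) (\<Sum>b\<in>A. f b \<odot> b) = (\<Sum>b\<in>A. of_real ((cmod (f b))\<^sup>2) * h b b)"
proof -
  have "h (\<Sum>b\<in>A. f b \<odot> b) (\<Sum>b\<in>A. f b \<odot> b) = (\<Sum>b\<in>A. \<Sum>c\<in>A. f b * cnj (f c) * h b c)"
    using h by (simp add: hermitian_sum_left hermitian_sum_right hermitian_simps sum_distrib_left mult.assoc)
  also have "\<dots> = (\<Sum>b\<in>A. \<Sum>c\<in>A. if b = c then f b * cnj (f b) * h b b else 0)"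
    using orth by (intro sum.cong refl) auto
  also have "\<dots> = (\<Sum>b\<in>A. of_real ((cmod (f b))\<^sup>2) * h b b)"
    using \<open>finite A\<close> by (simp add: complex_norm_square flip: of_real_power)
  finally show ?thesis .
qed

lemma span_finite_sum:
  assumes "finite A" "x \<in> span A"
  obtains f where "x = (\<Sum>b\<in>A. f b \<odot> b)"
  using assms span_finite[of A] by auto

section \<open>The negative index and Sylvester's law of inertia\<close>

lemma neg_index_bdd:
  assumes "finite_dim V"
  shows "finite (card ` {S. finite S \<and> independent S \<and> S \<subseteq> V \<and> negative_on h (span S)})"
proof (rule finite_subset)
  show "card ` {S. finite S \<and> independent S \<and> S \<subseteq> V \<and> negative_on h (span S)} \<subseteq> {..dim V}"
    using finite_dim_independent[OF assms] by auto
qed simp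

lemma neg_index_ge:
  assumes "finite_dim V" "independent S" "S \<subseteq> V" "negative_on h (span S)"
  shows "card S \<le> neg_index h V"
  unfolding neg_index_def
  by (rule Max_ge[OF neg_index_bdd[OF assms(1)]])
    (use assms finite_dim_independent[OF assms(1-3)] in auto)

lemma neg_index_attained:
  assumes "finite_dim V"
  obtains S where "finite S" "independent S" "S \<subseteq> V" "negative_on h (span S)" "card S = neg_index h V"
proof -
  have "{} \<in> {S. finite S \<and> independent S \<and> S \<subseteq> V \<and> negative_on h (span S)}"
    using independent_empty by (simp add: negative_on_def)
  then have "neg_index h V \<in> card ` {S. finite S \<and> independent S \<and> S \<subseteq> V \<and> negative_on h (span S)}"
    unfolding neg_index_def by (intro Max_in[OF neg_index_bdd[OF assms]]) blast
  then show ?thesis using that by auto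
qed

lemma independent_Un_disjoint_spans:
  assumes fin: "finite S" "finite T" and ind: "independent S" "independent T"
    and zero: "span S \<inter> span T \<subseteq> {0}"
  shows "independent (S \<union> T) \<and> S \<inter> T = {}"
proof -
  have disj: "S \<inter> T = {}"
    using zero ind(1) dependent_zero[of S] span_base[of _ S] span_base[of _ T] by fast
  have "f v = 0" if f: "(\<Sum>x\<in>S \<union> T. f x \<odot> x) = 0" and v: "v \<in> S \<union> T" for f v
  proof -
    have s: "(\<Sum>x\<in>S. f x \<odot> x) + (\<Sum>x\<in>T. f x \<odot> x) = 0"
      using f fin disj by (simp add: sum.union_disjoint)
    have "(\<Sum>x\<in>S. f x \<odot> x) \<in> span S" "(\<Sum>x\<in>T. f x \<odot> x) \<in> span T"
      by (rule span_sum, rule span_scale, erule span_base)+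
    moreover have "(\<Sum>x\<in>S. f x \<odot> x) = - (\<Sum>x\<in>T. f x \<odot> x)"
      using s by (simp add: eq_neg_iff_add_eq_0)
    ultimately have "(\<Sum>x\<in>S. f x \<odot> x) = 0" "(\<Sum>x\<in>T. f x \<odot> x) = 0"
      using zero span_neg[of "\<Sum>x\<in>T. f x \<odot> x" T] s by auto
    then show ?thesis
      using v independentD[OF ind(1) fin(1) order_refl, of f v] independentD[OF ind(2) fin(2) order_refl, of f v] by blast
  qed
  then have "independent (S \<union> T)"
    using fin by (intro independent_if_scalars_zero) auto
  then show ?thesis using disj by blast
qed

text \<open>A negative subspace meets a nonnegative one only in 0, so their dimensions add up to at
  most that of \<open>V\<close>. All upper bounds on the index come from here.\<close>

lemma neg_index_le:
  assumes V: "finite_dim V" and T: "finite T" "independent T" "T \<subseteq> V"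
    and nonneg: "\<And>x. x \<in> span T \<Longrightarrow> 0 \<le> Re (h x x)"
  shows "neg_index h V + card T \<le> dim V"
proof -
  obtain S where S: "finite S" "independent S" "S \<subseteq> V" "negative_on h (span S)" "card S = neg_index h V"
    using neg_index_attained[OF V] by metis
  have "span S \<inter> span T \<subseteq> {0}"
    using S(4) nonneg by (force simp: negative_on_def)
  from independent_Un_disjoint_spans[OF S(1) T(1) S(2) T(2) this]
  have "independent (S \<union> T)" "S \<inter> T = {}" by auto
  moreover have "S \<union> T \<subseteq> V" using S T by auto
  ultimately show ?thesis
    using finite_dim_independent[OF V, of "S \<union> T"] S(5) card_Un_disjoint[OF S(1) T(1)] by simp
qed

lemma diag_basis_negative:
  assumes h: "hermitian h" and B: "diag_basis h V B"
  shows "negative_on h (span {b\<in>B. h b b = -1})"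
  unfolding negative_on_def
proof (intro ballI impI)
  fix x assume x: "x \<in> span {b\<in>B. h b b = -1}" "x \<noteq> 0"
  have fin: "finite {b\<in>B. h b b = -1}" using B by (auto simp: diag_basis_def)
  obtain f where f: "x = (\<Sum>b\<in>{b\<in>B. h b b = -1}. f b \<odot> b)"
    using span_finite_sum[OF fin x(1)] .
  obtain b where b: "b \<in> {b\<in>B. h b b = -1}" "f b \<noteq> 0"
    using x(2) f by (metis (no_types, lifting) scale_zero_left sum.neutral)
  have "h x x = (\<Sum>b\<in>{b\<in>B. h b b = -1}. of_real ((cmod (f b))\<^sup>2) * h b b)"
    unfolding f using B by (intro hermitian_sum_diag[OF h fin]) (auto simp: diag_basis_def)
  also have "\<dots> = of_real (- (\<Sum>b\<in>{b\<in>B. h b b = -1}. (cmod (f b))\<^sup>2))"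
    by (simp add: sum_negf)
  finally have "Re (h x x) = - (\<Sum>b\<in>{b\<in>B. h b b = -1}. (cmod (f b))\<^sup>2)" by simp
  moreover have "(\<Sum>b\<in>{b\<in>B. h b b = -1}. (cmod (f b))\<^sup>2) > 0"
    by (rule sum_pos2[OF fin b(1)]) (use b in auto)
  ultimately show "Re (h x x) < 0" by simp
qed

lemma diag_basis_nonneg:
  assumes h: "hermitian h" and B: "diag_basis h V B" and x: "x \<in> span {b\<in>B. h b b \<in> {0, 1}}"
  shows "0 \<le> Re (h x x)"
proof -
  have fin: "finite {b\<in>B. h b b \<in> {0, 1}}" using B by (auto simp: diag_basis_def)
  obtain f where f: "x = (\<Sum>b\<in>{b\<in>B. h b b \<in> {0, 1}}. f b \<odot> b)"
    using span_finite_sum[OF fin x] .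
  have "h x x = (\<Sum>b\<in>{b\<in>B. h b b \<in> {0, 1}}. of_real ((cmod (f b))\<^sup>2) * h b b)"
    unfolding f using B by (intro hermitian_sum_diag[OF h fin]) (auto simp: diag_basis_def)
  then have "Re (h x x) = (\<Sum>b\<in>{b\<in>B. h b b \<in> {0, 1}}. (cmod (f b))\<^sup>2 * Re (h b b))"
    by simp
  also have "\<dots> \<ge> 0" by (intro sum_nonneg) auto
  finally show ?thesis .
qed

text \<open>By orthogonality, pairing x with a basis vector b isolates the coefficient of x at b
  times \<open>h b b\<close>; for x in the radical only coefficients at null basis vectors
  survive.\<close>

lemma diag_basis_radical:
  assumes h: "hermitian h" and B: "diag_basis h V B"
  shows "span {b\<in>B. h b b = 0} = radical h V"
proof
  have sV: "subspace V" using B by (auto simp: diag_basis_def)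
  have BV: "B \<subseteq> V" "finite B" using diag_basisD[OF B] by blast+
  have "b \<in> radical h V" if b: "b \<in> B" "h b b = 0" for b
  proof -
    have "h b y = 0" if "y \<in> V" for y
    proof -
      have "y \<in> span B" using B that by (auto simp: diag_basis_def)
      then obtain f where f: "y = (\<Sum>c\<in>B. f c \<odot> c)"
        using span_finite_sum[OF BV(2)] by metis
      have "h b c = 0" if "c \<in> B" for c using that b B by (cases "b = c") (auto simp: diag_basis_def)
      then show ?thesis unfolding f using h by (simp add: hermitian_sum_right hermitian_simps)
    qed
    then show ?thesis using b BV by (auto simp: radical_def)
  qed
  then show "span {b\<in>B. h b b = 0} \<subseteq> radical h V"
    using subspace_radical[OF h sV] by (intro span_minimal) auto
  show "radical h V \<subseteq> span {b\<in>B. h b b = 0}"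
  proof
    fix x assume x: "x \<in> radical h V"
    then have "x \<in> span B" using B by (auto simp: diag_basis_def radical_def)
    then obtain f where f: "x = (\<Sum>c\<in>B. f c \<odot> c)"
      using span_finite_sum[OF BV(2)] by metis
    have fz: "f b = 0" if b: "b \<in> B" "h b b \<noteq> 0" for b
    proof -
      have "0 = h x b" using x b BV by (auto simp: radical_def)
      also have "\<dots> = (\<Sum>c\<in>B. f c * h c b)"
        unfolding f using h by (simp add: hermitian_sum_left hermitian_simps)
      also have "\<dots> = (\<Sum>c\<in>B. if c = b then f b * h b b else 0)"
        using B b by (intro sum.cong) (auto simp: diag_basis_def)
      also have "\<dots> = f b * h b b" using b BV by simp
      finally show ?thesis using b by simp
    qed
    have "x = (\<Sum>c\<in>{b\<in>B. h b b = 0}. f c \<odot> c)"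
      unfolding f using BV fz by (intro sum.mono_neutral_right) auto
    then show "x \<in> span {b\<in>B. h b b = 0}"
      using span_sum[of "{b\<in>B. h b b = 0}" "\<lambda>c. f c \<odot> c" "{b\<in>B. h b b = 0}"] span_scale span_base by simp
  qed
qed

lemma diag_basis_uminus: "diag_basis h V B \<Longrightarrow> diag_basis (\<lambda>x y. - h x y) V B"
  by (auto simp: diag_basis_def)

text \<open>The vectors of square -1 span a negative subspace of this size; the remaining ones span
  a nonnegative subspace of complementary dimension, which forbids a larger one.\<close>

lemma neg_index_diag_basis:
  assumes h: "hermitian h" and V: "finite_dim V" and B: "diag_basis h V B"
  shows "neg_index h V = card {b\<in>B. h b b = -1}"
proof (rule antisym)
  have B': "finite B" "independent B" "B \<subseteq> V" "span B = V"
    using diag_basisD[OF B] by blast+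
  have ind: "independent {b\<in>B. P b}" for P by (rule independent_mono[OF B'(2)]) blast
  show "card {b\<in>B. h b b = -1} \<le> neg_index h V"
    using B' by (intro neg_index_ge[OF V ind] diag_basis_negative[OF h B]) auto
  have "neg_index h V + card {b\<in>B. h b b \<in> {0,1}} \<le> dim V"
    using B' diag_basis_nonneg[OF h B] by (intro neg_index_le[OF V _ ind]) auto
  moreover have "dim V = card B" using B' dim_span_eq_card_independent by blast
  moreover have "card B = card {b\<in>B. h b b = -1} + card {b\<in>B. h b b \<in> {0,1}}"
  proof -
    have "B = {b\<in>B. h b b = -1} \<union> {b\<in>B. h b b \<in> {0,1}}" using B by (auto simp: diag_basis_def)
    moreover have "{b\<in>B. h b b = -1} \<inter> {b\<in>B. h b b \<in> {0,1}} = {}" by auto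
    ultimately show ?thesis using B'(1) by (metis (lifting) card_Un_disjoint finite_Un)
  qed
  ultimately show "neg_index h V \<le> card {b\<in>B. h b b = -1}" by linarith
qed

lemma pos_index_diag_basis:
  assumes h: "hermitian h" and V: "finite_dim V" and B: "diag_basis h V B"
  shows "neg_index (\<lambda>x y. - h x y) V = card {b\<in>B. h b b = 1}"
  using neg_index_diag_basis[OF hermitian_uminus[OF h] V diag_basis_uminus[OF B]] by simp

lemma dim_radical_diag_basis:
  assumes h: "hermitian h" and B: "diag_basis h V B"
  shows "dim (radical h V) = card {b\<in>B. h b b = 0}"
proof -
  have "independent {b\<in>B. h b b = 0}"
    by (rule independent_mono[OF diag_basisD(2)[OF B]]) auto
  then show ?thesis using dim_span_eq_card_independent diag_basis_radical[OF h B] by metis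
qed

lemma sylvester_inertia:
  assumes h: "hermitian h" and V: "finite_dim V"
  shows "neg_index h V + neg_index (\<lambda>x y. - h x y) V + dim (radical h V) = dim V"
proof -
  obtain B where B: "diag_basis h V B" using diag_basis_exists[OF h V] by blast
  have B': "finite B" "independent B" "span B = V" using B by (auto simp: diag_basis_def)
  have "B = {b\<in>B. h b b = -1} \<union> {b\<in>B. h b b = 1} \<union> {b\<in>B. h b b = 0}"
    using diag_basisD(6)[OF B] by blast
  then have "card B = card ({b\<in>B. h b b = -1} \<union> {b\<in>B. h b b = 1} \<union> {b\<in>B. h b b = 0})"
    by (rule arg_cong)
  also have "\<dots> = card {b\<in>B. h b b = -1} + card {b\<in>B. h b b = 1} + card {b\<in>B. h b b = 0}"
    using B'(1) by (subst card_Un_disjoint, auto)+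
  finally show ?thesis
    using neg_index_diag_basis[OF h V B] pos_index_diag_basis[OF h V B] dim_radical_diag_basis[OF h B]
      B' dim_span_eq_card_independent by metis
qed

text \<open>Lowering a form keeps its negative vectors negative, and null vectors that turn negative
  are gained in addition: for x = m + z with m negative and z in the radical,
  \<open>h x x = h m m\<close>. This is the source of the jump at an eigenvalue.\<close>

lemma neg_index_mono_radical:
  assumes h: "hermitian h" and V: "finite_dim V"
    and le: "\<And>x. x \<in> V \<Longrightarrow> Re (k x x) \<le> Re (h x x)"
    and neg: "negative_on k (radical h V)"
  shows "neg_index h V + dim (radical h V) \<le> neg_index k V"
proof -
  obtain B where B: "diag_basis h V B" using diag_basis_exists[OF h V] by blast
  have B': "finite B" "independent B" "span B = V" "B \<subseteq> V"
    using diag_basisD[OF B] by blast+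
  let ?M = "{b\<in>B. h b b = -1}" and ?Z = "{b\<in>B. h b b = 0}"
  have ind: "independent (?M \<union> ?Z)" by (rule independent_mono[OF B'(2)]) auto
  have "negative_on k (span (?M \<union> ?Z))"
    unfolding negative_on_def
  proof (intro ballI impI)
    fix x assume x: "x \<in> span (?M \<union> ?Z)" "x \<noteq> 0"
    then obtain m z where mz: "m \<in> span ?M" "z \<in> span ?Z" "x = m + z"
      unfolding span_Un by blast
    have zr: "z \<in> radical h V" using mz diag_basis_radical[OF h B] by blast
    have mV: "m \<in> V" using mz(1) span_mono[of ?M B] B' by auto
    have xV: "x \<in> V" using mz(3) mV zr finite_dim_subspace[OF V] by (auto simp: radical_def subspace_add)
    have z0: "h z y = 0" "h y z = 0" if "y \<in> V" for y
      using zr that hermitian_cnj[OF h, of y z] by (auto simp: radical_def)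
    have "h x x = h m m" using mz(3) z0 mV zr h by (simp add: hermitian_simps radical_def)
    show "Re (k x x) < 0"
    proof (cases "m = 0")
      case True
      then show ?thesis using x mz zr neg by (simp add: negative_on_def)
    next
      case False
      then have "Re (h m m) < 0" using diag_basis_negative[OF h B] mz(1) by (simp add: negative_on_def)
      then show ?thesis using le[OF xV] \<open>h x x = h m m\<close> by simp
    qed
  qed
  then have "card (?M \<union> ?Z) \<le> neg_index k V"
    using B' by (intro neg_index_ge[OF V ind]) auto
  moreover have "card (?M \<union> ?Z) = card ?M + card ?Z"
    using B'(1) by (intro card_Un_disjoint) auto
  ultimately show ?thesis
    using neg_index_diag_basis[OF h V B] dim_radical_diag_basis[OF h B] by simp
qed

lemma neg_index_ge_1:
  assumes h: "hermitian h" and V: "finite_dim V" and x: "x \<in> V" "Re (h x x) < 0"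
  shows "1 \<le> neg_index h V"
proof -
  have "x \<noteq> 0" using x hermitian_zero_left[OF h] by auto
  then have "independent {x}" by simp
  moreover have "negative_on h (span {x})"
    using x h by (auto simp: negative_on_def span_singleton hermitian_simps complex_norm_square[symmetric]
        mult.assoc[symmetric] mult_less_0_iff)
  ultimately show ?thesis using neg_index_ge[OF V, of "{x}" h] x by simp
qed

lemma neg_index_less_dim:
  assumes h: "hermitian h" and V: "finite_dim V" and x: "x \<in> V" "x \<noteq> 0" "0 \<le> Re (h x x)"
  shows "neg_index h V < dim V"
proof -
  have "0 \<le> Re (h y y)" if "y \<in> span {x}" for y
    using that x h by (auto simp: span_singleton hermitian_simps complex_norm_square[symmetric]
        mult.assoc[symmetric])
  then show ?thesis using neg_index_le[OF V, of "{x}" h] x by simp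
qed

lemma neg_index_eq_0:
  assumes V: "finite_dim V" and nonneg: "\<And>x. x \<in> V \<Longrightarrow> 0 \<le> Re (h x x)"
  shows "neg_index h V = 0"
proof -
  obtain B where B: "finite B" "independent B" "span B = V" "card B = dim V"
    using finite_dim_subset_basis[OF V finite_dim_subspace[OF V] order_refl] .
  have "B \<subseteq> V" using B(3) span_superset[of B] by simp
  then show ?thesis using neg_index_le[OF V B(1,2), of h] nonneg B by simp
qed

lemma neg_index_eq_dim:
  assumes V: "finite_dim V" and neg: "negative_on h V"
  shows "neg_index h V = dim V"
proof (rule antisym)
  obtain B where B: "finite B" "independent B" "span B = V" "card B = dim V"
    using finite_dim_subset_basis[OF V finite_dim_subspace[OF V] order_refl] .
  have "B \<subseteq> V" using B(3) span_superset[of B] by simp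
  then show "dim V \<le> neg_index h V" using neg_index_ge[OF V B(2), of h] neg B by simp
  obtain S where "finite S" "independent S" "S \<subseteq> V" "card S = neg_index h V"
    using neg_index_attained[OF V] by metis
  then show "neg_index h V \<le> dim V" using finite_dim_independent[OF V] by metis
qed

section \<open>Semicontinuity of the index\<close>

text \<open>With n vectors and entrywise error below 1 / (n + 1), Cauchy-Schwarz bounds the
  perturbation by n / (n + 1) times the sum of the squared moduli of the coefficients, which is less
  than the main term. Independence is not assumed: a vanishing nontrivial combination would have
  negative square.\<close>

lemma Gram_near_minus_identity:
  assumes h: "hermitian h" and V: "finite_dim V" and I: "finite I" and vV: "\<And>i. i \<in> I \<Longrightarrow> v i \<in> V"
    and G: "\<And>i j. i \<in> I \<Longrightarrow> j \<in> I \<Longrightarrow>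
      cmod (h (v i) (v j) - (if i = j then -1 else 0)) < 1 / (real (card I) + 1)"
  shows "card I \<le> neg_index h V"
proof -
  define \<delta> where "\<delta> = 1 / (real (card I) + 1)"
  have neg: "Re (h (\<Sum>i\<in>I. c i \<odot> v i) (\<Sum>i\<in>I. c i \<odot> v i)) < 0" if c: "\<exists>i\<in>I. c i \<noteq> 0" for c
  proof -
    define S where "S = (\<Sum>i\<in>I. (cmod (c i))\<^sup>2)"
    obtain k where k: "k \<in> I" "c k \<noteq> 0" using c by blast
    have S0: "S > 0" unfolding S_def by (rule sum_pos2[OF I k(1)]) (use k in auto)
    define e where "e i j = h (v i) (v j) - (if i = j then -1 else 0)" for i j
    have "h (\<Sum>i\<in>I. c i \<odot> v i) (\<Sum>i\<in>I. c i \<odot> v i) = (\<Sum>i\<in>I. \<Sum>j\<in>I. c i * cnj (c j) * h (v i) (v j))"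
      using h by (simp add: hermitian_sum_left hermitian_sum_right hermitian_simps sum_distrib_left mult.assoc)
    also have "\<dots> = (\<Sum>i\<in>I. \<Sum>j\<in>I. (if i = j then - (c i * cnj (c j)) else 0) + c i * cnj (c j) * e i j)"
      by (intro sum.cong refl) (auto simp: e_def algebra_simps)
    also have "\<dots> = - of_real S + (\<Sum>i\<in>I. \<Sum>j\<in>I. c i * cnj (c j) * e i j)"
      using I by (simp add: sum.distrib S_def complex_norm_square sum_negf sum_subtractf flip: of_real_power)
    finally have eq: "Re (h (\<Sum>i\<in>I. c i \<odot> v i) (\<Sum>i\<in>I. c i \<odot> v i)) =
        - S + Re (\<Sum>i\<in>I. \<Sum>j\<in>I. c i * cnj (c j) * e i j)" by simp
    have "Re (\<Sum>i\<in>I. \<Sum>j\<in>I. c i * cnj (c j) * e i j) \<le> cmod (\<Sum>i\<in>I. \<Sum>j\<in>I. c i * cnj (c j) * e i j)"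
      by (rule complex_Re_le_cmod)
    also have "\<dots> \<le> (\<Sum>i\<in>I. \<Sum>j\<in>I. cmod (c i) * cmod (c j) * \<delta>)"
    proof (intro sum_norm_le)
      fix i j assume ij: "i \<in> I" "j \<in> I"
      have "cmod (e i j) \<le> \<delta>" using G[OF ij] by (simp add: e_def \<delta>_def)
      then show "cmod (c i * cnj (c j) * e i j) \<le> cmod (c i) * cmod (c j) * \<delta>"
        by (simp add: norm_mult mult_left_mono)
    qed
    also have "\<dots> = \<delta> * (\<Sum>i\<in>I. cmod (c i))\<^sup>2"
      by (simp add: power2_eq_square sum_product sum_distrib_left sum_distrib_right mult_ac)
    also have "\<dots> \<le> \<delta> * (real (card I) * S)"
      using sum_squared_le_sum_of_squares[of "\<lambda>i. cmod (c i)" I]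
      by (intro mult_left_mono) (auto simp: \<delta>_def S_def mult.commute)
    also have "\<dots> = (real (card I) * \<delta>) * S" by simp
    also have "\<dots> < 1 * S"
      using S0 by (intro mult_strict_right_mono) (auto simp: \<delta>_def field_simps)
    finally show ?thesis using eq by simp
  qed
  have zero: "\<forall>i\<in>I. c i = 0" if "(\<Sum>i\<in>I. c i \<odot> v i) = 0" for c
    using neg[of c] that hermitian_zero_left[OF h] by fastforce
  have inj: "inj_on v I"
  proof (rule inj_onI, rule ccontr)
    fix i j assume ij: "i \<in> I" "j \<in> I" "v i = v j" "i \<noteq> j"
    define c :: "_ \<Rightarrow> complex" where "c = (\<lambda>k. if k = i then 1 else if k = j then -1 else 0)"
    have "(\<Sum>k\<in>I. c k \<odot> v k) = (\<Sum>k\<in>{i,j}. c k \<odot> v k)"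
      using I ij by (intro sum.mono_neutral_right) (auto simp: c_def)
    also have "\<dots> = 0" using ij by (simp add: c_def)
    finally show False using zero ij(1) by (fastforce simp: c_def)
  qed
  have "independent (v ` I)"
  proof (rule independent_if_scalars_zero)
    fix f x assume f: "(\<Sum>x\<in>v ` I. f x \<odot> x) = 0" and x: "x \<in> v ` I"
    have "(\<Sum>i\<in>I. f (v i) \<odot> v i) = 0" using f by (simp add: sum.reindex[OF inj])
    from zero[OF this] show "f x = 0" using x by blast
  qed (use I in auto)
  moreover have "negative_on h (span (v ` I))"
    unfolding negative_on_def
  proof (intro ballI impI)
    fix x assume x: "x \<in> span (v ` I)" "x \<noteq> 0"
    obtain f where "x = (\<Sum>y\<in>v ` I. f y \<odot> y)" using span_finite_sum[OF _ x(1)] I by blast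
    then have f: "x = (\<Sum>i\<in>I. f (v i) \<odot> v i)" by (simp add: sum.reindex[OF inj])
    have "\<exists>i\<in>I. f (v i) \<noteq> 0"
    proof (rule ccontr)
      assume "\<not> ?thesis"
      then have "x = 0" unfolding f by (intro sum.neutral) auto
      then show False using x(2) by simp
    qed
    then show "Re (h x x) < 0" unfolding f by (rule neg)
  qed
  ultimately have "card (v ` I) \<le> neg_index h V" using vV by (intro neg_index_ge[OF V]) auto
  then show ?thesis by (simp add: card_image[OF inj])
qed

text \<open>The test vectors may depend on the parameter. This freedom matters below, where suitable
  vectors have no limit although their Gram matrix has one.\<close>

lemma eventually_neg_index_ge_Gram:
  assumes h: "\<And>s. hermitian (h s)" and V: "finite_dim V" and I: "finite I"
    and vV: "\<And>s i. i \<in> I \<Longrightarrow> v s i \<in> V"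
    and G: "\<And>i j. i \<in> I \<Longrightarrow> j \<in> I \<Longrightarrow> ((\<lambda>s. h s (v s i) (v s j)) \<longlongrightarrow> (if i = j then -1 else 0)) F"
  shows "eventually (\<lambda>s. card I \<le> neg_index (h s) V) F"
proof -
  have "eventually (\<lambda>s. \<forall>i\<in>I. \<forall>j\<in>I.
      cmod (h s (v s i) (v s j) - (if i = j then -1 else 0)) < 1 / (real (card I) + 1)) F"
    using G[THEN tendstoD, of _ _ "1 / (real (card I) + 1)"] I
    by (intro eventually_ball_finite ballI) (auto simp: dist_norm)
  then show ?thesis
    by (rule eventually_mono) (use Gram_near_minus_identity[OF h V I] vV in blast)
qed

text \<open>Negative directions of the limit form persist nearby; null ones may acquire either sign,
  so only an inequality holds.\<close>

lemma eventually_neg_index_ge: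
  assumes h: "\<And>s. hermitian (h s)" "hermitian k" and V: "finite_dim V"
    and lim: "\<And>x y. x \<in> V \<Longrightarrow> y \<in> V \<Longrightarrow> ((\<lambda>s. h s x y) \<longlongrightarrow> k x y) F"
  shows "eventually (\<lambda>s. neg_index k V \<le> neg_index (h s) V) F"
proof -
  obtain B where B: "diag_basis k V B" using diag_basis_exists[OF h(2) V] by blast
  have B': "finite B" "B \<subseteq> V"
    using diag_basisD[OF B] by blast+
  have "eventually (\<lambda>s. card {b\<in>B. k b b = -1} \<le> neg_index (h s) V) F"
  proof (rule eventually_neg_index_ge_Gram[where v = "\<lambda>s i. i"])
    fix i j assume ij: "i \<in> {b\<in>B. k b b = -1}" "j \<in> {b\<in>B. k b b = -1}"
    then have "k i j = (if i = j then -1 else 0)" using B by (auto simp: diag_basis_def)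
    moreover have "i \<in> V" "j \<in> V" using ij B' by auto
    ultimately show "((\<lambda>s. h s i j) \<longlongrightarrow> (if i = j then -1 else 0)) F"
      using lim[of i j] by simp
  qed (use h V B' in auto)
  then show ?thesis using neg_index_diag_basis[OF h(2) V B] by simp
qed

end


section \<open>Counting the eigenvalues of a Hermitian pencil\<close>

text \<open>\<open>U\<close> is the kernel of \<open>W\<close> in \<open>V\<close>. The positive
  form \<open>e\<close> and the map \<open>E\<close> certify that \<open>g\<close> pairs
  \<open>U\<close> nondegenerately with \<open>V\<close>. Without this a vector of \<open>U\<close>
  orthogonal to \<open>V\<close> under \<open>g\<close> would be null for every parameter, and the
  spectrum would be the whole real line.\<close>

locale definite_pencil = complex_space scale
  for scale :: "complex \<Rightarrow> 'v::ab_group_add \<Rightarrow> 'v" (infixr "\<odot>" 75) +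
  fixes V U :: "'v set" and g W e :: "'v \<Rightarrow> 'v \<Rightarrow> complex" and E :: "'v \<Rightarrow> 'v"
  assumes V: "finite_dim V" and U: "subspace U" "U \<subseteq> V"
    and g: "hermitian g" and W: "hermitian W" and e: "hermitian e"
    and W_nonneg: "x \<in> V \<Longrightarrow> 0 \<le> Re (W x x)"
    and W_null: "x \<in> V \<Longrightarrow> W x x = 0 \<Longrightarrow> x \<in> U"
    and W_radical: "x \<in> U \<Longrightarrow> y \<in> V \<Longrightarrow> W x y = 0"
    and e_pos: "x \<in> U \<Longrightarrow> x \<noteq> 0 \<Longrightarrow> 0 < Re (e x x)"
    and E_in: "x \<in> U \<Longrightarrow> E x \<in> V"
    and E_pairing: "x \<in> U \<Longrightarrow> y \<in> U \<Longrightarrow> g x (E y) = e x y"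
begin

definition H :: "real \<Rightarrow> 'v \<Rightarrow> 'v \<Rightarrow> complex" where
  "H t x y = g x y - of_real t * W x y"

definition nullity :: "real \<Rightarrow> nat" where
  "nullity t = dim (radical (H t) V)"

definition spectrum :: "real set" where
  "spectrum = {t. radical (H t) V \<noteq> {0}}"

abbreviation pos_U :: nat where "pos_U \<equiv> neg_index (\<lambda>x y. - g x y) U"
abbreviation neg_U :: nat where "neg_U \<equiv> neg_index g U"

lemma finite_dim_U: "finite_dim U"
  using finite_dim_subset[OF V U] .

lemma hermitian_H: "hermitian (H t)"
  using hermitian_combine[OF g W, of 1 "-t"] by (simp add: H_def[abs_def])

lemma W_radical': "y \<in> U \<Longrightarrow> x \<in> V \<Longrightarrow> W x y = 0"
  using W_radical hermitian_cnj[OF W] by (metis complex_cnj_zero)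

text \<open>\<open>W\<close> vanishes on \<open>U\<close>, so pairing x with \<open>E x\<close>
  leaves \<open>e x x = 0\<close>.\<close>

lemma radical_H_Int_U: "x \<in> radical (H t) V \<Longrightarrow> x \<in> U \<Longrightarrow> x = 0"
  using e_pos[of x] E_pairing[of x x] E_in[of x] W_radical[of x "E x"] by (force simp: radical_def H_def)

lemma W_pos_on_radical: "x \<in> radical (H t) V \<Longrightarrow> x \<noteq> 0 \<Longrightarrow> 0 < Re (W x x)"
  using radical_H_Int_U[of x t] W_null[of x] W_nonneg[of x] hermitian_real[OF W, of x]
  by (force simp: radical_def less_le)

lemma H_on_radical: "x \<in> radical (H t) V \<Longrightarrow> H s x x = of_real (t - s) * W x x"
  by (auto simp: radical_def H_def algebra_simps)

lemma inertia_H: "neg_index (H t) V + neg_index (\<lambda>x y. - H t x y) V + nullity t = dim V"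
  unfolding nullity_def by (rule sylvester_inertia[OF hermitian_H V])

lemma nullity_eq_0_iff: "nullity t = 0 \<longleftrightarrow> t \<notin> spectrum"
proof -
  have sub: "subspace (radical (H t) V)"
    using subspace_radical[OF hermitian_H finite_dim_subspace[OF V]] .
  obtain B where B: "finite B" "independent B" "span B = radical (H t) V" "card B = nullity t"
    unfolding nullity_def by (rule finite_dim_subset_basis[OF V sub]) (auto simp: radical_def)
  show ?thesis
  proof
    assume "nullity t = 0"
    then have "B = {}" using B by simp
    then show "t \<notin> spectrum" using B by (auto simp: spectrum_def)
  next
    assume "t \<notin> spectrum"
    then have "span B = {0}" using B by (simp add: spectrum_def)
    then have "B \<subseteq> {0}" using span_base by blast
    moreover have "0 \<notin> B" using B(2) dependent_zero by blast
    ultimately have "B = {}" by auto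
    then show "nullity t = 0" using B by simp
  qed
qed

section \<open>Jumps of the index at the spectrum\<close>

text \<open>\<open>H\<close> decreases with the parameter, and on the radical of \<open>H s\<close>
  the form \<open>H t\<close> equals (s - t) \<open>W\<close>, which is strictly negative
  there.\<close>

lemma neg_index_H_jump: "s < t \<Longrightarrow> neg_index (H s) V + nullity s \<le> neg_index (H t) V"
  unfolding nullity_def
proof (rule neg_index_mono_radical[OF hermitian_H V])
  assume "s < t"
  then show "Re (H t x x) \<le> Re (H s x x)" if "x \<in> V" for x
    using W_nonneg[OF that] mult_right_mono[of s t "Re (W x x)"] by (simp add: H_def)
  show "negative_on (H t) (radical (H s) V)"
    using \<open>s < t\<close> W_pos_on_radical[of _ s]
    by (auto simp: negative_on_def H_on_radical mult_less_0_iff)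
qed

lemma radical_uminus: "radical (\<lambda>x y. - h x y) V = radical h V"
  by (simp add: radical_def)

lemma pos_index_H_jump:
  "s < t \<Longrightarrow> neg_index (\<lambda>x y. - H t x y) V + nullity t \<le> neg_index (\<lambda>x y. - H s x y) V"
  unfolding nullity_def radical_uminus[of "H t", symmetric]
proof (rule neg_index_mono_radical[OF hermitian_uminus[OF hermitian_H] V])
  assume "s < t"
  then show "Re (- H s x x) \<le> Re (- H t x x)" if "x \<in> V" for x
    using W_nonneg[OF that] mult_right_mono[of s t "Re (W x x)"] by (simp add: H_def)
  show "negative_on (\<lambda>x y. - H s x y) (radical (\<lambda>x y. - H t x y) V)"
    using \<open>s < t\<close> W_pos_on_radical[of _ t]
    by (auto simp: negative_on_def H_on_radical radical_uminus)
qed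

lemma tendsto_H: "((\<lambda>s. H s x y) \<longlongrightarrow> H t x y) (at t)"
  unfolding H_def by (intro tendsto_intros)

text \<open>Neither index drops near t. In addition the negative index gains at least
  \<open>nullity t\<close> on the right, the positive one on the left. The three inertia numbers sum
  to \<open>dim V\<close>, so nothing more can be gained.\<close>

lemma eventually_inertia_H:
  "eventually (\<lambda>s. neg_index (H s) V = neg_index (H t) V + (if t < s then nullity t else 0)) (at t)"
proof -
  have "eventually (\<lambda>s. neg_index (H t) V \<le> neg_index (H s) V) (at t)"
    by (rule eventually_neg_index_ge[OF hermitian_H hermitian_H V tendsto_H])
  moreover have "eventually (\<lambda>s. neg_index (\<lambda>x y. - H t x y) V \<le> neg_index (\<lambda>x y. - H s x y) V) (at t)"
    by (rule eventually_neg_index_ge[OF hermitian_uminus[OF hermitian_H] hermitian_uminus[OF hermitian_H] V])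
      (intro tendsto_minus tendsto_H)
  moreover have "eventually (\<lambda>s. s \<noteq> t) (at t)"
    by (simp add: eventually_at_filter)
  ultimately show ?thesis
  proof eventually_elim
    case (elim s)
    show ?case
    proof (cases "t < s")
      case True
      then show ?thesis using elim neg_index_H_jump[OF True] inertia_H[of s] inertia_H[of t] by simp
    next
      case False
      then have "s < t" using elim by simp
      then show ?thesis using elim pos_index_H_jump[of s t] inertia_H[of s] inertia_H[of t] by simp
    qed
  qed
qed

text \<open>Each spectral point below x adds at least one negative square to \<open>H x\<close>, and
  there are at most \<open>dim V\<close> of them.\<close>

lemma finite_spectrum: "finite spectrum"
proof -
  have "\<And>x. A \<subseteq> spectrum \<Longrightarrow> \<forall>a\<in>A. a < x \<Longrightarrow> card A \<le> neg_index (H x) V" if "finite A" for A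
    using that
  proof (induction A rule: finite_linorder_max_induct)
    case empty
    then show ?case by simp
  next
    case (insert b A)
    have "neg_index (H b) V + nullity b \<le> neg_index (H x) V"
      using neg_index_H_jump insert.prems by simp
    moreover have "card A \<le> neg_index (H b) V" using insert by simp
    moreover have "nullity b \<noteq> 0" using insert.prems nullity_eq_0_iff by simp
    moreover have "b \<notin> A" using insert by auto
    ultimately show ?case using insert.hyps(1) by simp
  qed
  moreover have "\<exists>x. \<forall>a\<in>A. a < x" if "finite A" for A :: "real set"
    using that by (intro exI[of _ "Max A + 1"]) (auto simp: less_add_one intro: le_less_trans[OF Max_ge])
  ultimately have "card A \<le> dim V" if "A \<subseteq> spectrum" "finite A" for A
    using that inertia_H by (metis le_add1 le_trans)
  then show ?thesis
    using finite_if_finite_subsets_card_bdd[of spectrum "dim V"] by simp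
qed

text \<open>Index and counting sum jump by the same amount at the same points, both being continuous
  from the left, so their difference is locally constant on the connected real line. Integers avoid
  truncated subtraction.\<close>

lemma neg_index_H_diff_const:
  "int (neg_index (H s) V) - int (\<Sum>x\<in>{x\<in>spectrum. x < s}. nullity x) =
   int (neg_index (H t) V) - int (\<Sum>x\<in>{x\<in>spectrum. x < t}. nullity x)"
proof -
  define f where "f s = int (neg_index (H s) V) - int (\<Sum>x\<in>{x\<in>spectrum. x < s}. nullity x)" for s
  have "f s = f t"
  proof (rule connected_local_const[of UNIV s t f])
    show "\<forall>t\<in>UNIV. eventually (\<lambda>s. f t = f s) (at t)"
    proof
      fix t
      have "eventually (\<lambda>s. x < s \<longleftrightarrow> x < t) (at t)" if "x \<in> spectrum - {t}" for x
      proof (cases "x < t")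
        case True
        then have "eventually (\<lambda>s. x < s) (at t)" using order_tendstoD(1)[OF tendsto_ident_at] by blast
        then show ?thesis by eventually_elim (use True in auto)
      next
        case False
        then have "eventually (\<lambda>s. s < x) (at t)"
          using order_tendstoD(2)[OF tendsto_ident_at, of t x] that by auto
        then show ?thesis by eventually_elim (use False in auto)
      qed
      then have "eventually (\<lambda>s. \<forall>x\<in>spectrum - {t}. x < s \<longleftrightarrow> x < t) (at t)"
        using finite_spectrum by (intro eventually_ball_finite) auto
      moreover have "eventually (\<lambda>s. s \<noteq> t) (at t)"
        by (simp add: eventually_at_filter)
      ultimately show "eventually (\<lambda>s. f t = f s) (at t)"
        using eventually_inertia_H[of t]
      proof eventually_elim
        case (elim s)
        show ?case
        proof (cases "t \<in> spectrum \<and> t < s")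
          case True
          have "{x\<in>spectrum. x < s} = insert t {x\<in>spectrum. x < t}" using elim True by auto
          then show ?thesis using elim True finite_spectrum by (simp add: f_def)
        next
          case False
          have "{x\<in>spectrum. x < s} = {x\<in>spectrum. x < t}" using elim False by auto
          moreover have "t < s \<Longrightarrow> nullity t = 0" using False nullity_eq_0_iff by blast
          ultimately show ?thesis using elim by (simp add: f_def)
        qed
      qed
    qed
  qed auto
  then show ?thesis by (simp add: f_def)
qed

text \<open>A null vector \<open>c\<close> of \<open>g\<close> on \<open>U\<close> contributes the vectors \<open>c / s - (s / 2) E c\<close>: the pairing
  of \<open>c\<close> with \<open>E c\<close> makes them negative as \<open>s\<close> tends to \<open>0\<close>.\<close>

lemma neg_index_H_ge: "dim U - pos_U \<le> neg_index (H t) V"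
proof -
  obtain B where B: "diag_basis g U B" using diag_basis_exists[OF g finite_dim_U] by blast
  note B' = diag_basisD[OF B]
  define M where "M = {b\<in>B. g b b = -1}"
  define N where "N = radical g U"
  have N: "finite_dim N"
    unfolding N_def
    by (rule finite_dim_subset[OF finite_dim_U subspace_radical[OF g U(1)]]) (auto simp: radical_def)
  \<comment> \<open>Positivity of \<open>e\<close> on \<open>U\<close> leaves only the value 1 on
    this basis, so \<open>C\<close> is an \<open>e\<close>-orthonormal basis of the null space of
    \<open>g\<close> on \<open>U\<close>.\<close>
  obtain C where C: "diag_basis e N C" using diag_basis_exists[OF e N] by blast
  note C' = diag_basisD[OF C]
  have CU: "c \<in> U" "g c x = 0" "g x c = 0" if "c \<in> C" "x \<in> U" for c x
    using that C'(4) hermitian_cnj[OF g, of x c] by (auto simp: N_def radical_def)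
  have C0: "0 \<notin> C" using C'(2) dependent_zero by blast
  have Ce: "e c c = 1" if "c \<in> C" for c
    using that e_pos[of c] CU(1)[OF that, of 0] C'(6)[OF that] C0 subspace_0[OF U(1)]
    by fastforce
  have MU: "b \<in> U" if "b \<in> M" for b using that B'(4) by (auto simp: M_def)
  have fin: "finite M" "finite C" using B' C' by (auto simp: M_def)
  have disj: "M \<inter> C = {}" using MU CU(3) by (force simp: M_def)
  define v where "v s i = (if i \<in> M then i else of_real (1 / s) \<odot> i - of_real (s / 2) \<odot> E i)" for s :: real and i
  have EV: "E c \<in> V" if "c \<in> C" for c using that CU(1)[OF that] E_in U(1) subspace_0 by blast
  have UV: "x \<in> V" if "x \<in> U" for x using that U by blast
  \<comment> \<open>The form is fixed and only the test vectors move. As the inequality does not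
    mention s, holding eventually means holding.\<close>
  have "eventually (\<lambda>s::real. card (M \<union> C) \<le> neg_index (H t) V) (at_right 0)"
  proof (rule eventually_neg_index_ge_Gram[where v = v and h = "\<lambda>_. H t"])
    fix s i assume "i \<in> M \<union> C"
    then show "v s i \<in> V"
      using MU CU(1) EV UV finite_dim_subspace[OF V] U(1)
      by (auto simp: v_def intro!: subspace_diff subspace_scale dest: subspace_0)
  next
    fix i j assume ij: "i \<in> M \<union> C" "j \<in> M \<union> C"
    have HU: "H t x y = g x y" "H t y x = g y x" if "x \<in> U" "y \<in> V" for x y
      using that W_radical W_radical' by (auto simp: H_def)
    have s0: "eventually (\<lambda>s::real. s \<noteq> 0) (at_right 0)" by (simp add: eventually_at_filter)
    have mc: "((\<lambda>s. H t b (v s c)) \<longlongrightarrow> 0) (at_right 0)" if b: "b \<in> M" and c: "c \<in> C" for b c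
    proof -
      have "H t b (v s c) = - of_real (s / 2) * g b (E c)" for s
      proof -
        have "c \<notin> M" using c disj by auto
        then have "H t b (v s c) = of_real (1 / s) * H t b c - of_real (s / 2) * H t b (E c)"
          by (simp add: v_def hermitian_simps[OF hermitian_H])
        then show ?thesis
          using CU(1)[OF c MU[OF b]] CU(3)[OF c MU[OF b]] MU[OF b] EV[OF c] UV by (simp only: HU) simp
      qed
      moreover have "((\<lambda>s. - of_real (s / 2) * g b (E c)) \<longlongrightarrow> - of_real (0 / 2) * g b (E c)) (at_right 0)"
        by (intro tendsto_intros) simp
      ultimately show ?thesis by simp
    qed
    consider "i \<in> M" "j \<in> M" | "i \<in> M" "j \<in> C" | "i \<in> C" "j \<in> M" | "i \<in> C" "j \<in> C" using ij by auto
    then show "((\<lambda>s. H t (v s i) (v s j)) \<longlongrightarrow> (if i = j then -1 else 0)) (at_right 0)"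
    proof cases
      case 1
      have "g i j = (if i = j then -1 else 0)" using 1 B'(5)[of i j] by (auto simp: M_def)
      then show ?thesis using 1 HU[of i j] MU UV by (simp add: v_def)
    next
      case 2
      then show ?thesis using mc[OF 2] disj by (auto simp: v_def)
    next
      case 3
      have "((\<lambda>s. cnj (H t j (v s i))) \<longlongrightarrow> cnj 0) (at_right 0)"
        using mc[OF 3(2,1)] by (intro tendsto_intros)
      then have "((\<lambda>s. H t (v s i) j) \<longlongrightarrow> 0) (at_right 0)"
        using hermitian_cnj[OF hermitian_H, of t "v _ i" j] by simp
      then show ?thesis using 3 disj by (auto simp: v_def)
    next
      case 4
      have iU: "i \<in> U" "j \<in> U" using CU(1) 4 U(1) subspace_0 by blast+
      have gij: "g i j = 0" using CU(2) 4 iU by blast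
      have EE: "g i (E j) = e i j" "g (E i) j = e i j"
        using E_pairing iU hermitian_cnj[OF g, of "E i" j] hermitian_cnj[OF e, of i j] by auto
      have eij: "e i j = (if i = j then 1 else 0)" using Ce C'(5) 4 by auto
      have nM: "i \<notin> M" "j \<notin> M" using disj 4 by auto
      \<comment> \<open>The 1 / s^2 term vanishes because i and j are null; the two cross terms
        contribute (1 / s) (s / 2) \<open>e i j\<close> each, which explains the factor 1/2.\<close>
      have "H t (v s i) (v s j) = - (if i = j then 1 else 0) + of_real (s\<^sup>2 / 4) * H t (E i) (E j)"
        if "s \<noteq> 0" for s
        using that iU EV[OF 4(1)] EV[OF 4(2)] nM UV
        by (simp add: v_def hermitian_simps[OF hermitian_H] HU gij EE eij power2_eq_square algebra_simps)
      then have ev: "eventually (\<lambda>s. - (if i = j then 1 else 0) + of_real (s\<^sup>2 / 4) * H t (E i) (E j)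
          = H t (v s i) (v s j)) (at_right 0)"
        using s0 by (auto elim!: eventually_mono)
      have "((\<lambda>s. - (if i = j then 1 else 0) + of_real (s\<^sup>2 / 4) * H t (E i) (E j)) \<longlongrightarrow>
          - (if i = j then 1 else 0) + of_real (0\<^sup>2 / 4) * H t (E i) (E j)) (at_right 0)"
        by (intro tendsto_intros) simp
      from Lim_transform_eventually[OF this ev] show ?thesis by (auto split: if_splits)
    qed
  qed (use hermitian_H V fin in auto)
  then have "card (M \<union> C) \<le> neg_index (H t) V"
    by (simp add: eventually_const_iff)
  moreover have "card (M \<union> C) = card M + card C" using fin disj by (rule card_Un_disjoint)
  moreover have "card M = neg_U" using neg_index_diag_basis[OF g finite_dim_U B] by (simp add: M_def)
  moreover have "card C = dim (radical g U)"
    using C'(2,3) dim_span_eq_card_independent N_def by metis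
  ultimately show ?thesis using sylvester_inertia[OF g finite_dim_U] by linarith
qed

text \<open>The factor \<open>1 / sqrt t\<close> on the positive vectors of \<open>W\<close> normalises \<open>t W\<close> and makes \<open>g\<close>
  negligible there.\<close>

lemma eventually_neg_index_ge_at_top:
  "eventually (\<lambda>t. dim V - dim U + neg_U \<le> neg_index (H t) V) at_top"
proof -
  obtain B where B: "diag_basis W V B" using diag_basis_exists[OF W V] by blast
  note B' = diag_basisD[OF B]
  have WU: "radical W V = U"
    using W_null W_radical U by (fastforce simp: radical_def)
  define P where "P = {b\<in>B. W b b = 1}"
  \<comment> \<open>As \<open>W\<close> is nonnegative with radical \<open>U\<close>, a diagonal
    basis has exactly \<open>dim V - dim U\<close> vectors of square 1.\<close>
  have no_neg: "{b\<in>B. W b b = -1} = {}" using W_nonneg B'(4) by force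
  have cardP: "dim V - dim U = card P"
    using sylvester_inertia[OF W V] neg_index_diag_basis[OF W V B] pos_index_diag_basis[OF W V B]
    by (simp add: P_def no_neg WU)
  obtain A where A: "diag_basis g U A" using diag_basis_exists[OF g finite_dim_U] by blast
  note A' = diag_basisD[OF A]
  define M where "M = {b\<in>A. g b b = -1}"
  have cardM: "neg_U = card M" using neg_index_diag_basis[OF g finite_dim_U A] by (simp add: M_def)
  have M: "b \<in> U" if "b \<in> M" for b using that A'(4) by (auto simp: M_def)
  have P: "b \<in> V" if "b \<in> P" for b using that B'(4) by (auto simp: P_def)
  have UV: "x \<in> V" if "x \<in> U" for x using that U by blast
  have disj: "P \<inter> M = {}" using M P W_radical by (force simp: P_def)
  have fin: "finite P" "finite M" using A' B' by (auto simp: P_def M_def)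
  define v where "v t i = (if i \<in> M then i else of_real (1 / sqrt t) \<odot> i)" for t :: real and i
  have r: "((\<lambda>t. complex_of_real (1 / sqrt t)) \<longlongrightarrow> of_real 0) at_top"
    by (intro tendsto_of_real tendsto_divide_0[OF tendsto_const] filterlim_at_top_imp_at_infinity sqrt_at_top)
  have "eventually (\<lambda>t. card (P \<union> M) \<le> neg_index (H t) V) at_top"
  proof (rule eventually_neg_index_ge_Gram[where v = v])
    fix s i assume "i \<in> P \<union> M"
    then show "v s i \<in> V"
      using M P UV finite_dim_subspace[OF V] by (auto simp: v_def intro!: subspace_scale)
  next
    fix i j assume ij: "i \<in> P \<union> M" "j \<in> P \<union> M"
    have pm: "((\<lambda>t. H t b (v t c)) \<longlongrightarrow> 0) at_top" if b: "b \<in> M" and c: "c \<in> P" for b c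
    proof -
      have "H t b (v t c) = of_real (1 / sqrt t) * g b c" for t
        using b c disj M[OF b] P[OF c] W_radical[of b c]
        by (auto simp: v_def hermitian_simps[OF g] hermitian_simps[OF W] H_def)
      moreover have "((\<lambda>t. of_real (1 / sqrt t) * g b c) \<longlongrightarrow> of_real 0 * g b c) at_top"
        by (intro tendsto_intros r)
      ultimately show ?thesis by simp
    qed
    consider "i \<in> M" "j \<in> M" | "i \<in> M" "j \<in> P" | "i \<in> P" "j \<in> M" | "i \<in> P" "j \<in> P" using ij by auto
    then show "((\<lambda>t. H t (v t i) (v t j)) \<longlongrightarrow> (if i = j then -1 else 0)) at_top"
    proof cases
      case 1
      have "g i j = (if i = j then -1 else 0)" using 1 A'(5)[of i j] by (auto simp: M_def)
      then show ?thesis using 1 W_radical[of i j] M UV by (simp add: v_def H_def)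
    next
      case 2
      then show ?thesis using pm[OF 2] disj by (auto simp: v_def)
    next
      case 3
      have "((\<lambda>t. cnj (H t j (v t i))) \<longlongrightarrow> cnj 0) at_top"
        using pm[OF 3(2,1)] by (intro tendsto_intros)
      then have "((\<lambda>t. H t (v t i) j) \<longlongrightarrow> 0) at_top"
        using hermitian_cnj[OF hermitian_H, of _ "v _ i" j] by simp
      then show ?thesis using 3 disj by (auto simp: v_def)
    next
      case 4
      have Wij: "W i j = (if i = j then 1 else 0)" using 4 B'(5)[of i j] by (auto simp: P_def)
      have nM: "i \<notin> M" "j \<notin> M" using disj 4 by auto
      have "H t (v t i) (v t j) = of_real (1 / sqrt t) * of_real (1 / sqrt t) * g i j - (if i = j then 1 else 0)"
        if "t > 0" for t
      proof -
        have "complex_of_real (1 / sqrt t) * of_real (1 / sqrt t) * of_real t = 1"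
          using that real_sqrt_mult_self[of t] by (simp flip: of_real_mult)
        then show ?thesis using nM Wij
          by (simp add: v_def H_def hermitian_simps[OF g] hermitian_simps[OF W] algebra_simps)
      qed
      then have ev: "eventually (\<lambda>t. of_real (1 / sqrt t) * of_real (1 / sqrt t) * g i j - (if i = j then 1 else 0)
          = H t (v t i) (v t j)) at_top"
        by (intro eventually_mono[OF eventually_gt_at_top[of 0]]) simp
      have "((\<lambda>t. of_real (1 / sqrt t) * of_real (1 / sqrt t) * g i j - (if i = j then 1 else 0)) \<longlongrightarrow>
          of_real 0 * of_real 0 * g i j - (if i = j then 1 else 0)) at_top"
        by (intro tendsto_intros r)
      from Lim_transform_eventually[OF this ev] show ?thesis by (auto split: if_splits)
    qed
  qed (use hermitian_H V fin in auto)
  then show ?thesis using cardP cardM card_Un_disjoint[OF fin disj] by simp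
qed

section \<open>Reversal of the parameter and the global count\<close>

text \<open>Negating \<open>g\<close> turns \<open>H t\<close> into the negative of
  \<open>H (- t)\<close>. This swaps the two indices and the two ends of the real line, so each
  bound yields its counterpart.\<close>

lemma mirror_pencil: "definite_pencil (\<odot>) V U (\<lambda>x y. - g x y) W e (\<lambda>x. - E x)"
proof unfold_locales
qed (use V U hermitian_uminus[OF g] W e W_nonneg W_null W_radical e_pos E_in E_pairing
      subspace_neg[OF finite_dim_subspace[OF V]] hermitian_minus_right[OF g] in auto)

interpretation mirror: definite_pencil "(\<odot>)" V U "\<lambda>x y. - g x y" W e "\<lambda>x. - E x"
  by (rule mirror_pencil)

lemma mirror_H: "mirror.H t = (\<lambda>x y. - H (- t) x y)"
  by (simp add: fun_eq_iff H_def mirror.H_def)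

lemma pos_index_H_ge: "dim U - neg_U \<le> neg_index (\<lambda>x y. - H t x y) V"
  using mirror.neg_index_H_ge[of "-t"] by (simp add: mirror_H)

lemma eventually_pos_index_ge_at_bot:
  "eventually (\<lambda>t. dim V - dim U + pos_U \<le> neg_index (\<lambda>x y. - H t x y) V) at_bot"
  using mirror.eventually_neg_index_ge_at_top
  unfolding at_bot_mirror eventually_filtermap by (simp add: mirror_H)

lemma dim_U_le: "dim U \<le> dim V"
  using finite_dim_subset_basis[OF V U] finite_dim_independent[OF V] span_superset U(2)
  by (metis subset_trans)

text \<open>Far to the left, the lower bounds for the negative and the positive index sum to
  \<open>dim V\<close>, so both are equalities. This fixes the constant of
  \<open>neg_index_H_diff_const\<close>.\<close>

theorem neg_index_H_count:
  "neg_index (H t) V = dim U - pos_U + (\<Sum>x\<in>{x\<in>spectrum. x < t}. nullity x)"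
proof -
  have "eventually (\<lambda>s. \<forall>x\<in>spectrum. s \<le> x) at_bot"
    using finite_spectrum by (intro eventually_ball_finite ballI eventually_le_at_bot)
  then have "eventually (\<lambda>s. (\<forall>x\<in>spectrum. s \<le> x) \<and>
      dim V - dim U + pos_U \<le> neg_index (\<lambda>x y. - H s x y) V) at_bot"
    using eventually_pos_index_ge_at_bot by (rule eventually_conj)
  then obtain s where s: "\<forall>x\<in>spectrum. s \<le> x" "dim V - dim U + pos_U \<le> neg_index (\<lambda>x y. - H s x y) V"
    using eventually_happens'[OF trivial_limit_at_bot_linorder] by blast
  have "(\<Sum>x\<in>{x\<in>spectrum. x < s}. nullity x) = 0"
    by (intro sum.neutral) (use s(1) in force)
  moreover have "neg_index (H s) V = dim U - pos_U"
    using s(2) neg_index_H_ge[of s] inertia_H[of s] dim_U_le by linarith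
  ultimately show ?thesis using neg_index_H_diff_const[of t s] by linarith
qed

text \<open>The total multiplicity is the rise of the index along the whole real line, from
  \<open>dim U - pos_U\<close> to \<open>dim V - dim U + neg_U\<close>; the additive form avoids
  truncated subtraction.\<close>

theorem sum_nullity: "(\<Sum>x\<in>spectrum. nullity x) + 2 * dim U = dim V + pos_U + neg_U"
proof -
  have "eventually (\<lambda>s. \<forall>x\<in>spectrum. x < s) at_top"
    using finite_spectrum by (intro eventually_ball_finite ballI eventually_gt_at_top)
  then have "eventually (\<lambda>s. (\<forall>x\<in>spectrum. x < s) \<and>
      dim V - dim U + neg_U \<le> neg_index (H s) V) at_top"
    using eventually_neg_index_ge_at_top by (rule eventually_conj)
  then obtain s where s: "\<forall>x\<in>spectrum. x < s" "dim V - dim U + neg_U \<le> neg_index (H s) V"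
    using eventually_happens'[OF trivial_limit_at_top_linorder] by blast
  have "{x\<in>spectrum. x < s} = spectrum" using s(1) by blast
  moreover have "neg_index (H s) V = dim V - dim U + neg_U"
    using s(2) pos_index_H_ge[of s] inertia_H[of s] dim_U_le
      sylvester_inertia[OF g finite_dim_U] by linarith
  ultimately show ?thesis using neg_index_H_count[of s] dim_U_le
      sylvester_inertia[OF g finite_dim_U] by simp
qed

end


section \<open>The pencil of a problem\<close>

text \<open>The value at (u, v) of the Hermitian form with diagonal entries \<alpha>, b and
  off-diagonal entry z, that is, of K; its determinant is \<alpha> b - |z|^2.\<close>

definition hquad :: "real \<Rightarrow> real \<Rightarrow> complex \<Rightarrow> complex \<Rightarrow> complex \<Rightarrow> real" where
  "hquad \<alpha> b z u v = \<alpha> * (cmod u)\<^sup>2 + b * (cmod v)\<^sup>2 + 2 * Re (z * u * cnj v)"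

lemma hquad_uminus: "hquad (- \<alpha>) (- b) (- z) u v = - hquad \<alpha> b z u v"
  by (simp add: hquad_def)

lemma hquad_complete_square:
  "\<alpha> * hquad \<alpha> b z u v = (cmod (of_real \<alpha> * u + cnj z * v))\<^sup>2 + (\<alpha> * b - (cmod z)\<^sup>2) * (cmod v)\<^sup>2"
  unfolding hquad_def cmod_power2 by (simp add: algebra_simps power2_eq_square)

lemma hquad_pos:
  assumes "\<alpha> \<ge> 0" "\<alpha> * b - (cmod z)\<^sup>2 > 0" "u \<noteq> 0 \<or> v \<noteq> 0"
  shows "hquad \<alpha> b z u v > 0"
proof -
  have "\<alpha> \<noteq> 0" using assms(2) by (auto simp: not_less)
  then have \<alpha>: "\<alpha> > 0" using assms(1) by simp
  have "(cmod (of_real \<alpha> * u + cnj z * v))\<^sup>2 + (\<alpha> * b - (cmod z)\<^sup>2) * (cmod v)\<^sup>2 > 0"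
  proof (cases "v = 0")
    case True
    then show ?thesis using \<alpha> assms(3) by simp
  next
    case False
    then show ?thesis using assms(2) by (intro add_nonneg_pos) auto
  qed
  then show ?thesis using \<alpha> hquad_complete_square[of \<alpha> b z u v] zero_less_mult_pos by metis
qed

lemma hquad_nonneg:
  assumes "\<alpha> \<ge> 0" "b \<ge> 0" "\<alpha> * b - (cmod z)\<^sup>2 \<ge> 0"
  shows "hquad \<alpha> b z u v \<ge> 0"
proof (cases "\<alpha> = 0")
  case True
  then show ?thesis using assms by (simp add: hquad_def)
next
  case False
  then have "\<alpha> > 0" using assms(1) by simp
  moreover have "(cmod (of_real \<alpha> * u + cnj z * v))\<^sup>2 + (\<alpha> * b - (cmod z)\<^sup>2) * (cmod v)\<^sup>2 \<ge> 0"
    using assms by simp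
  ultimately show ?thesis using hquad_complete_square[of \<alpha> b z u v]
    by (metis not_le mult_pos_neg)
qed

lemma hquad_null:
  assumes "\<alpha> * b - (cmod z)\<^sup>2 = 0"
  shows "\<exists>u v. (u \<noteq> 0 \<or> v \<noteq> 0) \<and> hquad \<alpha> b z u v = 0"
proof (cases "\<alpha> = 0")
  case True
  then have "hquad \<alpha> b z 1 0 = 0" by (simp add: hquad_def)
  then show ?thesis by (metis one_neq_zero)
next
  case False
  \<comment> \<open>This vector annihilates the completed square and leaves only the determinant
    term.\<close>
  have "\<alpha> * hquad \<alpha> b z (cnj z) (- of_real \<alpha>) = 0"
    unfolding hquad_complete_square using assms by simp
  then show ?thesis using False
    by (intro exI[of _ "cnj z"] exI[of _ "- of_real \<alpha>"]) simp
qed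

lemma hquad_indefinite_pos:
  assumes d: "\<alpha> * b - (cmod z)\<^sup>2 < 0"
  shows "\<exists>u v. hquad \<alpha> b z u v > 0"
proof -
  consider "\<alpha> > 0" | "b > 0" | "\<alpha> < 0" | "\<alpha> = 0" "z \<noteq> 0" using d by force
  then show ?thesis
  proof cases
    case 1
    then have "hquad \<alpha> b z 1 0 > 0" by (simp add: hquad_def)
    then show ?thesis by blast
  next
    case 2
    then have "hquad \<alpha> b z 0 1 > 0" by (simp add: hquad_def)
    then show ?thesis by blast
  next
    case 3
    have "\<alpha> * hquad \<alpha> b z (cnj z) (- of_real \<alpha>) < 0"
      unfolding hquad_complete_square using 3 d by (simp add: mult_less_0_iff)
    then show ?thesis using 3 by (metis less_asym mult_less_0_iff)
  next
    case 4
    \<comment> \<open>Solves b + 2 s |z|^2 = 1, so that the form takes the value 1.\<close>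
    define s where "s = (1 - b) / (2 * (cmod z)\<^sup>2)"
    have "hquad \<alpha> b z (of_real s * cnj z) 1 = b + 2 * s * (cmod z)\<^sup>2"
      using 4 unfolding hquad_def cmod_power2 by (simp add: power2_eq_square algebra_simps)
    also have "\<dots> = 1" using 4 by (simp add: s_def field_simps)
    finally show ?thesis by (metis zero_less_one)
  qed
qed


interpretation seq: complex_space cscale
  by (simp add: complex_space_def vector_space_cscale)

section \<open>Tuples, chart coordinates and the forms of a problem\<close>

definition tuples :: "nat \<Rightarrow> (nat \<Rightarrow> complex) set" where
  "tuples N = {x. \<forall>n. n \<notin> {..N + 1} \<longrightarrow> x n = 0}"

definition end_tuples :: "nat \<Rightarrow> (nat \<Rightarrow> complex) set" where
  "end_tuples N = {x. \<forall>n. n \<notin> {0, N + 1} \<longrightarrow> x n = 0}"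

lemma supported_dim:
  assumes I: "finite I"
  shows "seq.finite_dim {x. \<forall>n. n \<notin> I \<longrightarrow> x n = 0}" "seq.dim {x. \<forall>n. n \<notin> I \<longrightarrow> x n = 0} = card I"
proof -
  define u :: "nat \<Rightarrow> nat \<Rightarrow> complex" where "u i = (\<lambda>n. if n = i then 1 else 0)" for i
  have inj: "inj_on u I"
    by (rule inj_onI) (metis u_def zero_neq_one)
  have s: "(\<Sum>i\<in>I. cscale (f i) (u i)) n = (if n \<in> I then f n else 0)" for f n
  proof -
    have "(\<Sum>i\<in>I. cscale (f i) (u i)) n = (\<Sum>i\<in>I. cscale (f i) (u i) n)"
      using I by (induction I rule: finite_induct) auto
    also have "\<dots> = (\<Sum>i\<in>I. if i = n then f n else 0)"
      by (intro sum.cong) (auto simp: u_def cscale_def)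
    finally show ?thesis using I by simp
  qed
  have sub: "seq.subspace {x. \<forall>n. n \<notin> I \<longrightarrow> x n = 0}"
    by (auto simp: seq.subspace_def cscale_def)
  have uI: "u ` I \<subseteq> {x. \<forall>n. n \<notin> I \<longrightarrow> x n = 0}" by (auto simp: u_def)
  have le: "{x. \<forall>n. n \<notin> I \<longrightarrow> x n = 0} \<subseteq> seq.span (u ` I)"
  proof
    fix x :: "nat \<Rightarrow> complex" assume "x \<in> {x. \<forall>n. n \<notin> I \<longrightarrow> x n = 0}"
    then have "x = (\<Sum>i\<in>I. cscale (x i) (u i))" using s[of x] by auto
    also have "\<dots> \<in> seq.span (u ` I)"
      by (intro seq.span_sum seq.span_scale seq.span_base) auto
    finally show "x \<in> seq.span (u ` I)" .
  qed
  have sp: "seq.span (u ` I) = {x. \<forall>n. n \<notin> I \<longrightarrow> x n = 0}"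
    by (rule seq.span_subspace[OF uI le sub])
  then show "seq.finite_dim {x. \<forall>n. n \<notin> I \<longrightarrow> x n = 0}"
    using I unfolding seq.finite_dim_def by (metis finite_imageI)
  have "seq.independent (u ` I)"
  proof (rule seq.independent_if_scalars_zero)
    fix f x assume f: "(\<Sum>x\<in>u ` I. cscale (f x) x) = 0" and x: "x \<in> u ` I"
    then obtain i where i: "i \<in> I" "x = u i" by blast
    have "(\<Sum>i\<in>I. cscale (f (u i)) (u i)) = 0" using f by (simp add: sum.reindex[OF inj])
    then show "f x = 0" using s[of "\<lambda>i. f (u i)" i] i by simp
  qed (use I in auto)
  then show "seq.dim {x. \<forall>n. n \<notin> I \<longrightarrow> x n = 0} = card I"
    using seq.basis_card_eq_dim[OF uI le] card_image[OF inj] by simp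
qed

lemma tuples_dim: "seq.finite_dim (tuples N)" "seq.dim (tuples N) = N + 2"
  using supported_dim[of "{..N + 1}"] by (simp_all add: tuples_def)

lemma end_tuples_dim: "seq.finite_dim (end_tuples N)" "seq.dim (end_tuples N) = 2"
  using supported_dim[of "{0, N + 1}"] by (simp_all add: end_tuples_def)

lemma end_tuples_subset: "end_tuples N \<subseteq> tuples N"
  by (auto simp: tuples_def end_tuples_def)

text \<open>The ratios of \<open>2 \<times> 2\<close> minors depend only on the class of a matrix; they recover the
  entries of the normalised representative.\<close>

definition minor :: "4 \<Rightarrow> 4 \<Rightarrow> complex^4^2 \<Rightarrow> complex" where
  "minor i j M = M $ 1 $ i * M $ 2 $ j - M $ 1 $ j * M $ 2 $ i"

definition minor_ratio :: "4 \<Rightarrow> 4 \<Rightarrow> (complex^4^2) set \<Rightarrow> complex" where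
  "minor_ratio i j C = (let M = (SOME M. M \<in> C) in minor i j M / minor 1 3 M)"

text \<open>On the normalised matrix the minor of columns 1 and 3 is -1, while those of columns 2 3,
  1 4 and 1 2 are -a, b and z; hence the signs.\<close>

definition a12 :: "(complex^4^2) set \<Rightarrow> real" where "a12 C = Re (minor_ratio 2 3 C)"
definition b22 :: "(complex^4^2) set \<Rightarrow> real" where "b22 C = - Re (minor_ratio 1 4 C)"
definition zc :: "(complex^4^2) set \<Rightarrow> complex" where "zc C = - minor_ratio 1 2 C"

definition chart_matrix :: "real \<Rightarrow> real \<Rightarrow> complex \<Rightarrow> complex^4^2" where
  "chart_matrix a b z = vector
     [vector [1, of_real a, 0, cnj z],
      vector [0, z, -1, of_real b]]"

lemma chart_class_eq: "chart_class a b z = gl_class (chart_matrix a b z)"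
  by (simp add: chart_class_def chart_matrix_def)

lemma vector_4 [simp]:
  "(vector [x, y, z, t] :: 'a::zero^4) $ 1 = x" "(vector [x, y, z, t] :: 'a^4) $ 2 = y"
  "(vector [x, y, z, t] :: 'a^4) $ 3 = z" "(vector [x, y, z, t] :: 'a^4) $ 4 = t"
  by (simp_all add: vector_def)

lemma minor_mult: "minor i j (T ** M) = det T * minor i j M"
  by (simp add: minor_def matrix_matrix_mult_def sum_2 det_2 algebra_simps)

lemma mem_gl_class: "M \<in> gl_class M"
proof -
  have "invertible (mat 1 :: complex^2^2)" unfolding invertible_def by (metis matrix_mul_lid)
  then show ?thesis unfolding gl_class_def by (metis (mono_tags, lifting) matrix_mul_lid mem_Collect_eq)
qed

text \<open>The chosen representative is some \<open>T ** M\<close>, and \<open>det T\<close>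
  cancels in the ratio.\<close>

lemma minor_ratio_gl_class: "minor_ratio i j (gl_class M) = minor i j M / minor 1 3 M"
proof -
  have "(SOME X. X \<in> gl_class M) \<in> gl_class M" using mem_gl_class by (rule someI)
  then obtain T where T: "invertible T" "(SOME X. X \<in> gl_class M) = T ** M"
    by (auto simp: gl_class_def)
  have "det T \<noteq> 0" using T(1) invertible_det_nz by blast
  then show ?thesis by (simp add: minor_ratio_def Let_def T(2) minor_mult)
qed

lemma chart_entries [simp]:
  "a12 (chart_class a b z) = a" "b22 (chart_class a b z) = b" "zc (chart_class a b z) = z"
  by (simp_all add: a12_def b22_def zc_def chart_class_eq minor_ratio_gl_class chart_matrix_def minor_def)

definition recip :: "problem \<Rightarrow> nat \<Rightarrow> real" where "recip p = fst (fst p)"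
definition pot :: "problem \<Rightarrow> nat \<Rightarrow> real" where "pot p = fst (snd (fst p))"
definition weight :: "problem \<Rightarrow> nat \<Rightarrow> real" where "weight p = snd (snd (fst p))"
text \<open>The shift by 1/f_0 comes from eliminating y_0 in favour of y_1: the first boundary row
  starts with y_0 + a_12 f_0 \<Delta>y_0 = y_1 + (a_12 - 1/f_0) f_0 \<Delta>y_0.\<close>

definition alpha :: "problem \<Rightarrow> real" where "alpha p = a12 (snd p) - recip p 0"
definition beta :: "problem \<Rightarrow> real" where "beta p = b22 (snd p)"
definition zeta :: "problem \<Rightarrow> complex" where "zeta p = zc (snd p)"

lemmas entry_defs = recip_def pot_def weight_def alpha_def beta_def zeta_def

text \<open>A tuple \<open>x\<close> stands for \<open>(f\<^sub>0\<Delta>y\<^sub>0, y\<^sub>1, \<dots>, y\<^sub>N, f\<^sub>N\<Delta>y\<^sub>N)\<close>. In these unknowns the equation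
  together with the boundary condition is the Hermitian pencil \<open>energy - \<lambda> mass\<close>.\<close>

definition energy :: "nat \<Rightarrow> problem \<Rightarrow> (nat \<Rightarrow> complex) \<Rightarrow> (nat \<Rightarrow> complex) \<Rightarrow> complex" where
  "energy N p x y =
     (\<Sum>n\<in>{1..<N}. of_real (1 / recip p n) * ((x (n + 1) - x n) * cnj (y (n + 1) - y n))) +
     (\<Sum>n\<in>{1..N}. of_real (pot p n) * (x n * cnj (y n))) +
     (x 0 * cnj (y 1) + x 1 * cnj (y 0)) - (x (N + 1) * cnj (y N) + x N * cnj (y (N + 1))) +
     (of_real (alpha p) * (x 0 * cnj (y 0)) + of_real (beta p) * (x (N + 1) * cnj (y (N + 1))) +
      cnj (zeta p) * (x (N + 1) * cnj (y 0)) + zeta p * (x 0 * cnj (y (N + 1))))"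

definition mass :: "nat \<Rightarrow> problem \<Rightarrow> (nat \<Rightarrow> complex) \<Rightarrow> (nat \<Rightarrow> complex) \<Rightarrow> complex" where
  "mass N p x y = (\<Sum>n\<in>{1..N}. of_real (weight p n) * (x n * cnj (y n)))"

definition end_form :: "nat \<Rightarrow> (nat \<Rightarrow> complex) \<Rightarrow> (nat \<Rightarrow> complex) \<Rightarrow> complex" where
  "end_form N x y = x 0 * cnj (y 0) + x (N + 1) * cnj (y (N + 1))"

text \<open>\<open>energy\<close> couples component 0 to component 1 with sign + and component N + 1
  to component N with sign -. Placing the end values there turns this coupling into
  \<open>end_form\<close>. The positions 1 and N are distinct only for N at least 2.\<close>

definition end_dual :: "nat \<Rightarrow> (nat \<Rightarrow> complex) \<Rightarrow> nat \<Rightarrow> complex" where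
  "end_dual N y = (\<lambda>n. if n = 1 then y 0 else if n = N then - y (N + 1) else 0)"

lemma hermitian_energy: "seq.hermitian (energy N p)"
proof (rule seq.hermitianI)
  show "energy N p (x + y) z = energy N p x z + energy N p y z" for x y z
    by (simp add: energy_def algebra_simps sum.distrib sum_subtractf)
  show "energy N p (cscale c x) y = c * energy N p x y" for c x y
    by (simp add: energy_def cscale_def algebra_simps sum_distrib_left)
  show "energy N p y x = cnj (energy N p x y)" for x y
    by (simp add: energy_def cnj_sum mult_ac add_ac)
qed

lemma hermitian_mass: "seq.hermitian (mass N p)"
proof (rule seq.hermitianI)
  show "mass N p (x + y) z = mass N p x z + mass N p y z" for x y z
    by (simp add: mass_def algebra_simps sum.distrib)
  show "mass N p (cscale c x) y = c * mass N p x y" for c x y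
    by (simp add: mass_def cscale_def algebra_simps sum_distrib_left)
  show "mass N p y x = cnj (mass N p x y)" for x y
    by (simp add: mass_def cnj_sum mult_ac)
qed

lemma hermitian_end_form: "seq.hermitian (end_form N)"
  by (rule seq.hermitianI) (simp_all add: end_form_def cscale_def algebra_simps)

lemma energy_end_tuples:
  assumes "x \<in> end_tuples N" "N \<ge> 1"
  shows "Re (energy N p x x) = hquad (alpha p) (beta p) (zeta p) (x 0) (x (N + 1))"
proof -
  have z: "x n = 0" if "n \<in> {1..N}" for n using assms that by (auto simp: end_tuples_def)
  have "energy N p x x = of_real (alpha p) * (x 0 * cnj (x 0)) + of_real (beta p) * (x (N + 1) * cnj (x (N + 1))) +
      cnj (zeta p) * (x (N + 1) * cnj (x 0)) + zeta p * (x 0 * cnj (x (N + 1)))"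
    using z assms(2) by (simp add: energy_def)
  then show ?thesis
    by (simp add: hquad_def complex_mult_cnj cmod_power2 algebra_simps)
qed

lemma mass_self: "mass N p x x = of_real (\<Sum>n\<in>{1..N}. weight p n * (cmod (x n))\<^sup>2)"
  by (simp add: mass_def complex_norm_square del: of_real_power)

lemma Omega_pos:
  assumes "p \<in> chart N"
  shows "n \<in> {..N} \<Longrightarrow> recip p n \<noteq> 0" "n \<in> {1..N} \<Longrightarrow> weight p n > 0"
  using assms by (auto simp: chart_def region_def Omega_def entry_defs)

lemma problem_pencil:
  assumes p: "p \<in> chart N" and N: "N \<ge> 2"
  shows "definite_pencil cscale (tuples N) (end_tuples N) (energy N p) (mass N p) (end_form N) (end_dual N)"
proof unfold_locales
  show "seq.finite_dim (tuples N)" by (rule tuples_dim)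
  show "seq.subspace (end_tuples N)" using end_tuples_dim(1) by (rule seq.finite_dim_subspace)
  show "end_tuples N \<subseteq> tuples N" by (rule end_tuples_subset)
  show "seq.hermitian (energy N p)" "seq.hermitian (mass N p)" "seq.hermitian (end_form N)"
    by (rule hermitian_energy hermitian_mass hermitian_end_form)+
  note w = Omega_pos(2)[OF p]
  have w0: "weight p n * (cmod (x n))\<^sup>2 \<ge> 0" if "n \<in> {1..N}" for n and x :: "nat \<Rightarrow> complex"
    using w[OF that] by simp
  show "0 \<le> Re (mass N p x x)" for x
    unfolding mass_self Re_complex_of_real by (intro sum_nonneg w0)
  show "x \<in> end_tuples N" if "x \<in> tuples N" "mass N p x x = 0" for x
  proof -
    have "(\<Sum>n\<in>{1..N}. weight p n * (cmod (x n))\<^sup>2) = 0"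
      using that(2) unfolding mass_self of_real_eq_0_iff .
    then have "\<forall>n\<in>{1..N}. weight p n * (cmod (x n))\<^sup>2 = 0"
      using w0[of _ x] by (subst (asm) sum_nonneg_eq_0_iff) auto
    then have z: "\<forall>n\<in>{1..N}. x n = 0" using w by fastforce
    have "x n = 0" if "n \<noteq> 0" "n \<noteq> N + 1" for n
    proof (cases "n \<le> N")
      case True
      then show ?thesis using z that by simp
    next
      case False
      then show ?thesis using \<open>x \<in> tuples N\<close> that by (simp add: tuples_def)
    qed
    then show ?thesis by (simp add: end_tuples_def)
  qed
  show "mass N p x y = 0" if "x \<in> end_tuples N" "y \<in> tuples N" for x y
    using that by (auto simp: mass_def end_tuples_def intro!: sum.neutral)
  show "0 < Re (end_form N x x)" if "x \<in> end_tuples N" "x \<noteq> 0" for x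
  proof -
    have "x 0 \<noteq> 0 \<or> x (N + 1) \<noteq> 0"
    proof (rule ccontr)
      assume "\<not> ?thesis"
      then have "x n = 0" for n
        using that(1) by (cases "n = 0 \<or> n = N + 1") (auto simp: end_tuples_def)
      then show False using that(2) by auto
    qed
    then have "0 < (cmod (x 0))\<^sup>2 + (cmod (x (N + 1)))\<^sup>2"
      by (metis add_nonneg_pos add_pos_nonneg zero_le_power2 zero_less_norm_iff zero_less_power)
    also have "\<dots> = Re (end_form N x x)"
      unfolding end_form_def cmod_power2 by (simp add: power2_eq_square)
    finally show ?thesis .
  qed
  show "end_dual N x \<in> tuples N" for x
    using N by (auto simp: tuples_def end_dual_def)
  show "energy N p x (end_dual N y) = end_form N x y" if "x \<in> end_tuples N" "y \<in> end_tuples N" for x y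
  proof -
    have z: "x n = 0" if "n \<in> {1..N}" for n using \<open>x \<in> end_tuples N\<close> that by (auto simp: end_tuples_def)
    show ?thesis using z N by (simp add: energy_def end_dual_def end_form_def)
  qed
qed


section \<open>Solutions as null vectors of the pencil\<close>

definition fdiff :: "problem \<Rightarrow> (nat \<Rightarrow> complex) \<Rightarrow> nat \<Rightarrow> complex" where
  "fdiff p y n = of_real (1 / recip p n) * (y (n + 1) - y n)"

definition shear :: "nat \<Rightarrow> problem \<Rightarrow> (nat \<Rightarrow> complex) \<Rightarrow> nat \<Rightarrow> complex" where
  "shear N p y = (\<lambda>n. if n = 0 then fdiff p y 0 else if n = N + 1 then fdiff p y N else y n)"

definition residual :: "problem \<Rightarrow> complex \<Rightarrow> (nat \<Rightarrow> complex) \<Rightarrow> nat \<Rightarrow> complex" where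
  "residual p \<mu> y n =
     - (fdiff p y n - fdiff p y (n - 1)) + of_real (pot p n) * y n - \<mu> * of_real (weight p n) * y n"

text \<open>\<open>bc_left\<close> and \<open>bc_right\<close> are the first and second row of the
  normalised boundary condition; through z each of them may involve both ends.\<close>

definition bc_left :: "nat \<Rightarrow> problem \<Rightarrow> (nat \<Rightarrow> complex) \<Rightarrow> complex" where
  "bc_left N p y = y 0 + of_real (a12 (snd p)) * fdiff p y 0 + cnj (zeta p) * fdiff p y N"

definition bc_right :: "nat \<Rightarrow> problem \<Rightarrow> (nat \<Rightarrow> complex) \<Rightarrow> complex" where
  "bc_right N p y = zeta p * fdiff p y 0 - y N + of_real (beta p) * fdiff p y N"

lemma summation_by_parts:
  fixes D c :: "nat \<Rightarrow> complex"
  assumes "N \<ge> 1"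
  shows "(\<Sum>n\<in>{1..N}. (D n - D (n - 1)) * c n) = D N * c N - D 0 * c 1 - (\<Sum>n\<in>{1..<N}. D n * (c (n + 1) - c n))"
  using assms
proof (induction N rule: nat_induct_at_least)
  case base
  show ?case by (simp add: algebra_simps)
next
  case (Suc N)
  then show ?case by (simp add: sum.atLeastLessThan_Suc algebra_simps)
qed

text \<open>Discrete Green identity: after summation by parts the interior components of the test
  tuple see the difference equation, and its two end components see the two boundary rows.\<close>

lemma energy_shear:
  assumes N: "N \<ge> 1" and r: "recip p 0 \<noteq> 0"
  shows "energy N p (shear N p y) x - \<mu> * mass N p (shear N p y) x =
    (\<Sum>n\<in>{1..N}. residual p \<mu> y n * cnj (x n)) + bc_left N p y * cnj (x 0) + bc_right N p y * cnj (x (N + 1))"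
proof -
  let ?D = "fdiff p y"
  have X: "shear N p y 0 = ?D 0" "shear N p y (N + 1) = ?D N" "\<And>n. n \<in> {1..N} \<Longrightarrow> shear N p y n = y n"
    by (auto simp: shear_def)
  \<comment> \<open>Substituting this for y_1 turns the coefficient \<open>alpha p\<close> of the
    energy back into the entry a_12 of the boundary row.\<close>
  have y1: "y 1 = y 0 + of_real (recip p 0) * ?D 0"
    using r by (simp add: fdiff_def)
  have e1: "(\<Sum>n\<in>{1..<N}. of_real (1 / recip p n) * ((shear N p y (n + 1) - shear N p y n) * cnj (x (n + 1) - x n)))
      = (\<Sum>n\<in>{1..<N}. ?D n * (cnj (x (n + 1)) - cnj (x n)))"
    using X(3) by (intro sum.cong refl) (simp add: fdiff_def mult.assoc)
  have e2: "(\<Sum>n\<in>{1..N}. of_real (pot p n) * (shear N p y n * cnj (x n)))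
      = (\<Sum>n\<in>{1..N}. of_real (pot p n) * (y n * cnj (x n)))"
    using X(3) by (intro sum.cong refl) auto
  have e3: "mass N p (shear N p y) x = (\<Sum>n\<in>{1..N}. of_real (weight p n) * (y n * cnj (x n)))"
    unfolding mass_def using X(3) by (intro sum.cong refl) auto
  have "(\<Sum>n\<in>{1..N}. residual p \<mu> y n * cnj (x n)) =
      - (\<Sum>n\<in>{1..N}. (?D n - ?D (n - 1)) * cnj (x n)) +
      (\<Sum>n\<in>{1..N}. of_real (pot p n) * (y n * cnj (x n))) -
      \<mu> * (\<Sum>n\<in>{1..N}. of_real (weight p n) * (y n * cnj (x n)))"
    unfolding residual_def sum_distrib_left sum_negf[symmetric] sum.distrib[symmetric] sum_subtractf[symmetric]
    by (intro sum.cong refl) (simp add: algebra_simps)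
  also have "(\<Sum>n\<in>{1..N}. (?D n - ?D (n - 1)) * cnj (x n)) =
      ?D N * cnj (x N) - ?D 0 * cnj (x 1) - (\<Sum>n\<in>{1..<N}. ?D n * (cnj (x (n + 1)) - cnj (x n)))"
    using summation_by_parts[OF N, of ?D "\<lambda>n. cnj (x n)"] .
  finally have res: "(\<Sum>n\<in>{1..N}. residual p \<mu> y n * cnj (x n)) =
      (\<Sum>n\<in>{1..<N}. ?D n * (cnj (x (n + 1)) - cnj (x n))) + ?D 0 * cnj (x 1) - ?D N * cnj (x N) +
      (\<Sum>n\<in>{1..N}. of_real (pot p n) * (y n * cnj (x n))) - \<mu> * mass N p (shear N p y) x"
    unfolding e3 by simp
  have "shear N p y 1 = y 1" "shear N p y N = y N" using X(3) N by auto
  then have "energy N p (shear N p y) x =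
      (\<Sum>n\<in>{1..<N}. ?D n * (cnj (x (n + 1)) - cnj (x n))) +
      (\<Sum>n\<in>{1..N}. of_real (pot p n) * (y n * cnj (x n))) +
      (?D 0 * cnj (x 1) + y 1 * cnj (x 0)) - (?D N * cnj (x N) + y N * cnj (x (N + 1))) +
      (of_real (alpha p) * (?D 0 * cnj (x 0)) + of_real (beta p) * (?D N * cnj (x (N + 1))) +
       cnj (zeta p) * (?D N * cnj (x 0)) + zeta p * (?D 0 * cnj (x (N + 1))))"
    unfolding energy_def e1 e2 X(1,2) by simp
  then show ?thesis
    unfolding res bc_left_def bc_right_def alpha_def y1
    by (simp add: algebra_simps)
qed

lemma left_half_mult: "left_half (T ** M) = T ** left_half M"
  and right_half_mult: "right_half (T ** M) = T ** right_half M"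
  by (simp_all add: left_half_def right_half_def vec_eq_iff forall_2 matrix_matrix_mult_def sum_2)

text \<open>Another representative \<open>T ** M\<close> merely multiplies the boundary vector by T,
  so the normalised one decides.\<close>

lemma chart_boundary_condition:
  "(\<forall>M\<in>chart_class a b z. left_half M *v vector [y0, d0] + right_half M *v vector [yN, dN] = 0) \<longleftrightarrow>
     y0 + of_real a * d0 + cnj z * dN = 0 \<and> z * d0 - yN + of_real b * dN = 0"
proof -
  define c :: "complex^2" where "c = left_half (chart_matrix a b z) *v vector [y0, d0] + right_half (chart_matrix a b z) *v vector [yN, dN]"
  have "(\<forall>M\<in>chart_class a b z. left_half M *v vector [y0, d0] + right_half M *v vector [yN, dN] = 0) \<longleftrightarrow> c = 0"
  proof
    assume "c = 0"
    then show "\<forall>M\<in>chart_class a b z. left_half M *v vector [y0, d0] + right_half M *v vector [yN, dN] = 0"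
      by (auto simp: chart_class_eq gl_class_def left_half_mult right_half_mult c_def
          simp flip: matrix_vector_mul_assoc matrix_vector_right_distrib)
  qed (use mem_gl_class in \<open>auto simp: c_def chart_class_eq\<close>)
  also have "\<dots> \<longleftrightarrow> c $ 1 = 0 \<and> c $ 2 = 0" by (simp add: vec_eq_iff forall_2)
  also have "c $ 1 = y0 + of_real a * d0 + cnj z * dN"
    by (simp add: c_def left_half_def right_half_def chart_matrix_def matrix_vector_mult_def sum_2)
  also have "c $ 2 = z * d0 - yN + of_real b * dN"
    by (simp add: c_def left_half_def right_half_def chart_matrix_def matrix_vector_mult_def sum_2)
  finally show ?thesis .
qed

lemma chartE:
  assumes "p \<in> chart N"
  obtains r q w a b z where "p = ((r, q, w), chart_class a b z)" "(r, q, w) \<in> Omega N"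
  using assms by (auto simp: chart_def region_def)

lemma solutions_iff_residual:
  assumes "p \<in> chart N"
  shows "y \<in> solutions N p \<mu> \<longleftrightarrow>
    y \<in> tuples N \<and> (\<forall>n\<in>{1..N}. residual p \<mu> y n = 0) \<and> bc_left N p y = 0 \<and> bc_right N p y = 0"
proof -
  obtain r q w a b z where p: "p = ((r, q, w), chart_class a b z)" using chartE[OF assms] .
  have D: "of_real (1 / r n) * (y (n + 1) - y n) = fdiff p y n" for n
    by (simp add: p fdiff_def entry_defs)
  have res: "residual p \<mu> y n = 0 \<longleftrightarrow> - (fdiff p y n - fdiff p y (n - 1)) + of_real (q n) * y n = \<mu> * of_real (w n) * y n" for n
    by (auto simp: p residual_def entry_defs)
  have bc: "bc_left N p y = 0 \<and> bc_right N p y = 0 \<longleftrightarrow> y 0 + of_real a * fdiff p y 0 + cnj z * fdiff p y N = 0 \<and>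
      z * fdiff p y 0 - y N + of_real b * fdiff p y N = 0"
    by (simp add: p bc_left_def bc_right_def entry_defs)
  show ?thesis
    unfolding res bc unfolding p solutions.simps mem_Collect_eq Let_def D[unfolded p] chart_boundary_condition
    by (auto simp: tuples_def)
qed

lemma shear_in_tuples: "y \<in> tuples N \<Longrightarrow> shear N p y \<in> tuples N"
  by (auto simp: tuples_def shear_def)

lemma solutions_iff:
  assumes p: "p \<in> chart N" and N: "N \<ge> 2"
  shows "y \<in> solutions N p \<mu> \<longleftrightarrow>
    y \<in> tuples N \<and> (\<forall>x\<in>tuples N. energy N p (shear N p y) x = \<mu> * mass N p (shear N p y) x)"
proof -
  have r: "recip p 0 \<noteq> 0" using Omega_pos(1)[OF p] by simp
  have N1: "N \<ge> 1" using N by simp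
  note es = energy_shear[OF N1 r, of y _ \<mu>]
  show ?thesis
  proof (intro iffI conjI ballI)
    assume "y \<in> solutions N p \<mu>"
    note y = this[unfolded solutions_iff_residual[OF p]]
    then show "y \<in> tuples N" by simp
    show "energy N p (shear N p y) x = \<mu> * mass N p (shear N p y) x" if "x \<in> tuples N" for x
      using es[of x] y by simp
  next
    assume a: "y \<in> tuples N \<and> (\<forall>x\<in>tuples N. energy N p (shear N p y) x = \<mu> * mass N p (shear N p y) x)"
    \<comment> \<open>Testing with unit tuples separates the N equations and the two boundary
      rows.\<close>
    define u :: "nat \<Rightarrow> nat \<Rightarrow> complex" where "u i = (\<lambda>n. if n = i then 1 else 0)" for i
    have u: "(\<Sum>n\<in>{1..N}. residual p \<mu> y n * cnj (u i n)) + bc_left N p y * cnj (u i 0) + bc_right N p y * cnj (u i (N + 1)) = 0"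
      if "i \<le> N + 1" for i
    proof -
      have "u i \<in> tuples N" using that by (auto simp: u_def tuples_def)
      then show ?thesis using es[of "u i"] a by simp
    qed
    have s: "(\<Sum>n\<in>{1..N}. residual p \<mu> y n * cnj (u i n)) = (if i \<in> {1..N} then residual p \<mu> y i else 0)" for i
    proof -
      have "(\<Sum>n\<in>{1..N}. residual p \<mu> y n * cnj (u i n)) = (\<Sum>n\<in>{1..N}. if n = i then residual p \<mu> y i else 0)"
        by (intro sum.cong) (auto simp: u_def)
      then show ?thesis by simp
    qed
    have "residual p \<mu> y i = 0" if "i \<in> {1..N}" for i
      using u[of i] s[of i] that by (auto simp: u_def)
    moreover have "bc_left N p y = 0" using u[of 0] s[of 0] by (simp add: u_def)
    moreover have "bc_right N p y = 0" using u[of "N + 1"] s[of "N + 1"] by (simp add: u_def)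
    ultimately show "y \<in> solutions N p \<mu>" using a unfolding solutions_iff_residual[OF p] by simp
  qed
qed

lemma (in vector_space_pair) dim_injective_image:
  assumes f: "Vector_Spaces.linear s1 s2 f" and inj: "inj_on f (vs1.span S)"
  shows "vs2.dim (f ` S) = vs1.dim S"
proof -
  interpret f: Vector_Spaces.linear s1 s2 f by fact
  obtain B where B: "B \<subseteq> S" "vs1.independent B" "S \<subseteq> vs1.span B" "card B = vs1.dim S"
    using vs1.basis_exists by blast
  have injB: "inj_on f (vs1.span B)" using inj B(1) vs1.span_mono inj_on_subset by metis
  have "f ` B \<subseteq> f ` S" using B(1) by blast
  moreover have "f ` S \<subseteq> vs2.span (f ` B)" using B(3) by (auto simp: f.span_image)
  moreover have "vs2.independent (f ` B)" using B(2) injB by (rule f.independent_injective_image)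
  ultimately have "card (f ` B) = vs2.dim (f ` S)" by (rule vs2.basis_card_eq_dim)
  moreover have "card (f ` B) = card B"
    using injB vs1.span_superset inj_on_subset card_image by metis
  ultimately show ?thesis using B(4) by simp
qed

interpretation seq_pair: vector_space_pair cscale cscale
  by (simp add: vector_space_pair_def vector_space_cscale)

lemma linear_shear: "Vector_Spaces.linear cscale cscale (shear N p)"
  unfolding Vector_Spaces.linear_iff using vector_space_cscale
  by (auto simp: shear_def fdiff_def cscale_def fun_eq_iff algebra_simps add_divide_distrib diff_divide_distrib)

section \<open>The spectrum of a problem\<close>

context
  fixes N :: nat and p :: problem
  assumes p: "p \<in> chart N" and N: "N \<ge> 2"
begin

interpretation P: definite_pencil cscale "tuples N" "end_tuples N" "energy N p" "mass N p" "end_form N" "end_dual N"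
  by (rule problem_pencil[OF p N])

lemma inj_shear: "inj_on (shear N p) (tuples N)"
proof (rule inj_onI)
  fix x y assume xy: "x \<in> tuples N" "y \<in> tuples N" "shear N p x = shear N p y"
  have r: "recip p 0 \<noteq> 0" "recip p N \<noteq> 0" using Omega_pos(1)[OF p] by auto
  have mid: "x n = y n" if "n \<in> {1..N}" for n
    using fun_cong[OF xy(3), of n] that by (auto simp: shear_def)
  have "fdiff p x 0 = fdiff p y 0" using fun_cong[OF xy(3), of 0] by (simp add: shear_def)
  then have 0: "x 0 = y 0" using r mid[of 1] N by (simp add: fdiff_def)
  have "fdiff p x N = fdiff p y N" using fun_cong[OF xy(3), of "N + 1"] by (simp add: shear_def)
  then have "x (N + 1) = y (N + 1)" using r mid[of N] N by (simp add: fdiff_def)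
  moreover have "x n = y n" if "n > N + 1" for n using xy(1,2) that by (simp add: tuples_def)
  ultimately show "x = y" using 0 mid
    by (metis (no_types, lifting) One_nat_def Suc_eq_plus1 atLeastAtMost_iff ext le_SucE not_less not_less_eq_eq zero_less_iff_neq_zero Suc_leI)
qed

lemma surj_shear: "shear N p ` tuples N = tuples N"
proof
  show "shear N p ` tuples N \<subseteq> tuples N" using shear_in_tuples by blast
  show "tuples N \<subseteq> shear N p ` tuples N"
  proof
    fix x assume x: "x \<in> tuples N"
    have r: "recip p 0 \<noteq> 0" "recip p N \<noteq> 0" using Omega_pos(1)[OF p] by auto
    define y where "y = (\<lambda>n. if n = 0 then x 1 - of_real (recip p 0) * x 0
       else if n = N + 1 then x N + of_real (recip p N) * x (N + 1) else x n)"
    have "shear N p y = x" using r N by (auto simp: fun_eq_iff shear_def fdiff_def y_def)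
    moreover have "y \<in> tuples N" using x by (auto simp: y_def tuples_def)
    ultimately show "x \<in> shear N p ` tuples N" by blast
  qed
qed

lemma shear_solutions: "shear N p ` solutions N p (of_real t) = seq.radical (P.H t) (tuples N)"
proof -
  have "solutions N p (of_real t) = {y \<in> tuples N. shear N p y \<in> seq.radical (P.H t) (tuples N)}"
    using shear_in_tuples[of _ N p] by (auto simp: solutions_iff[OF p N] seq.radical_def P.H_def)
  then show ?thesis using surj_shear by (auto simp: seq.radical_def)
qed

text \<open>The quotient of energy and mass settles the case of nonzero mass. If the mass vanishes,
  the tuple is concentrated at the ends, and pairing it with its \<open>end_dual\<close> forces it
  to be 0.\<close>

lemma eigenvalue_real:
  assumes "\<mu> \<in> eigenvalues N p"
  shows "\<mu> \<in> \<real>"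
proof (rule ccontr)
  assume nr: "\<mu> \<notin> \<real>"
  obtain y where y: "y \<in> solutions N p \<mu>" "y \<noteq> 0" using assms by (auto simp: eigenvalues_def)
  have yt: "y \<in> tuples N" and eq: "\<And>x. x \<in> tuples N \<Longrightarrow> energy N p (shear N p y) x = \<mu> * mass N p (shear N p y) x"
    using y(1) by (auto simp: solutions_iff[OF p N])
  let ?x = "shear N p y"
  have xt: "?x \<in> tuples N" using shear_in_tuples[OF yt] .
  have "mass N p ?x ?x = 0"
  proof (rule ccontr)
    assume nz: "mass N p ?x ?x \<noteq> 0"
    have "\<mu> = energy N p ?x ?x / mass N p ?x ?x" using eq[OF xt] nz by simp
    then show False using nr seq.hermitian_real[OF P.g, of ?x] seq.hermitian_real[OF P.W, of ?x]
      by (metis Reals_divide Reals_of_real)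
  qed
  then have xU: "?x \<in> end_tuples N" using P.W_null xt by blast
  have "end_form N ?x ?x = \<mu> * mass N p ?x (end_dual N ?x)"
    using eq[OF P.E_in[OF xU]] P.E_pairing[OF xU xU] by simp
  also have "\<dots> = 0" using P.W_radical[OF xU P.E_in[OF xU]] by simp
  finally have "?x = 0" using P.e_pos[OF xU] by auto
  moreover have "shear N p 0 = 0" by (auto simp: shear_def fdiff_def)
  moreover have "0 \<in> tuples N" by (simp add: tuples_def)
  ultimately have "y = 0" using inj_onD[OF inj_shear, of y 0] yt by simp
  then show False using y(2) by simp
qed

lemma mult_eq_nullity: "mult N p (of_real t) = P.nullity t"
proof -
  have "solutions N p (of_real t) \<subseteq> tuples N" by (auto simp: solutions_iff[OF p N])
  then have "seq.span (solutions N p (of_real t)) \<subseteq> tuples N"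
    using seq.span_minimal seq.finite_dim_subspace[OF tuples_dim(1)] by blast
  then have "inj_on (shear N p) (seq.span (solutions N p (of_real t)))"
    using inj_shear inj_on_subset by blast
  from seq_pair.dim_injective_image[OF linear_shear this]
  show ?thesis by (simp add: mult_def P.nullity_def shear_solutions)
qed

lemma eigenvalues_eq_spectrum: "eigenvalues N p = of_real ` P.spectrum"
proof -
  have "of_real t \<in> eigenvalues N p \<longleftrightarrow> t \<in> P.spectrum" for t
  proof -
    have sol: "solutions N p (of_real t) \<subseteq> tuples N" by (auto simp: solutions_iff[OF p N])
    have z: "shear N p 0 = 0" "0 \<in> tuples N" by (auto simp: shear_def fdiff_def tuples_def)
    have iff: "y = 0 \<longleftrightarrow> shear N p y = 0" if "y \<in> solutions N p (of_real t)" for y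
      using inj_onD[OF inj_shear, of y 0] z sol that by auto
    have "of_real t \<in> eigenvalues N p \<longleftrightarrow> (\<exists>x\<in>shear N p ` solutions N p (of_real t). x \<noteq> 0)"
      using iff by (auto simp: eigenvalues_def)
    also have "\<dots> \<longleftrightarrow> t \<in> P.spectrum"
      unfolding shear_solutions P.spectrum_def
      using seq.subspace_0[OF seq.subspace_radical[OF P.hermitian_H seq.finite_dim_subspace[OF P.V]]] by blast
    finally show ?thesis .
  qed
  then show ?thesis using eigenvalue_real by (auto simp: Reals_def) (metis Reals_cases eigenvalue_real rev_image_eqI)
qed

lemma finite_eigenvalues: "finite (eigenvalues N p)"
  using P.finite_spectrum by (simp add: eigenvalues_eq_spectrum)

lemma real_eigenvalues: "{x. of_real x \<in> eigenvalues N p} = P.spectrum"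
  by (auto simp: eigenvalues_eq_spectrum)

lemma num_eigenvalues_eq:
  "num_eigenvalues N p + 2 = N + seq.neg_index (\<lambda>x y. - energy N p x y) (end_tuples N) +
     seq.neg_index (energy N p) (end_tuples N)"
proof -
  have "num_eigenvalues N p = (\<Sum>x\<in>P.spectrum. P.nullity x)"
    unfolding num_eigenvalues_def eigenvalues_eq_spectrum
    by (subst sum.reindex) (auto simp: inj_on_def mult_eq_nullity)
  then show ?thesis using P.sum_nullity tuples_dim(2)[of N] end_tuples_dim(2)[of N] by simp
qed

lemma neg_index_eq_count:
  "seq.neg_index (\<lambda>x y. energy N p x y - of_real t * mass N p x y) (tuples N) +
     seq.neg_index (\<lambda>x y. - energy N p x y) (end_tuples N) =
   2 + (\<Sum>x\<in>{x. of_real x \<in> eigenvalues N p \<and> x < t}. mult N p (of_real x))"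
proof -
  have "P.H t = (\<lambda>x y. energy N p x y - of_real t * mass N p x y)"
    by (simp add: P.H_def fun_eq_iff)
  moreover have "{x. of_real x \<in> eigenvalues N p \<and> x < t} = {x \<in> P.spectrum. x < t}"
    using real_eigenvalues by blast
  moreover have "P.pos_U \<le> 2"
    using seq.sylvester_inertia[OF P.g P.finite_dim_U] end_tuples_dim(2)[of N] by linarith
  ultimately show ?thesis
    using P.neg_index_H_count[of t] end_tuples_dim(2)[of N] by (simp add: mult_eq_nullity)
qed

lemma nondegenerate_off_spectrum:
  assumes "of_real t \<notin> eigenvalues N p"
  shows "seq.dim (seq.radical (\<lambda>x y. energy N p x y - of_real t * mass N p x y) (tuples N)) = 0"
proof -
  have "P.H t = (\<lambda>x y. energy N p x y - of_real t * mass N p x y)"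
    by (simp add: P.H_def fun_eq_iff)
  then show ?thesis using P.nullity_eq_0_iff[of t] assms real_eigenvalues by (auto simp: P.nullity_def)
qed

end


section \<open>Inertia of the end form and the list of eigenvalues\<close>

text \<open>\<open>pos_ends\<close> and \<open>neg_ends\<close> are the numbers \<pi> and \<nu> of
  squares of K.\<close>

definition pos_ends :: "nat \<Rightarrow> problem \<Rightarrow> nat" where
  "pos_ends N p = seq.neg_index (\<lambda>x y. - energy N p x y) (end_tuples N)"

definition neg_ends :: "nat \<Rightarrow> problem \<Rightarrow> nat" where
  "neg_ends N p = seq.neg_index (energy N p) (end_tuples N)"

definition disc :: "problem \<Rightarrow> real" where
  "disc p = alpha p * beta p - (cmod (zeta p))\<^sup>2"

lemma mem_region_iff:
  "p \<in> region N Q \<longleftrightarrow> p \<in> chart N \<and> Q (alpha p) (beta p) (disc p)"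
proof
  assume "p \<in> region N Q"
  then show "p \<in> chart N \<and> Q (alpha p) (beta p) (disc p)"
    by (auto simp: region_def chart_def entry_defs disc_def) blast
next
  assume a: "p \<in> chart N \<and> Q (alpha p) (beta p) (disc p)"
  then obtain r q w a b z where "p = ((r, q, w), chart_class a b z)" "(r, q, w) \<in> Omega N"
    using chartE by metis
  then show "p \<in> region N Q" using a by (auto simp: region_def entry_defs disc_def)
qed

lemma gl_class_mult:
  assumes "invertible T"
  shows "gl_class (T ** M) = gl_class M"
proof -
  obtain S where S: "S ** T = mat 1" "T ** S = mat 1" using assms by (auto simp: invertible_def)
  have "X ** M = (X ** S) ** (T ** M)" for X
    using S by (metis matrix_mul_assoc matrix_mul_rid)
  moreover have "invertible S" using S invertible_def by blast
  ultimately show ?thesis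
    unfolding gl_class_def using assms invertible_mult by (auto simp: matrix_mul_assoc)
qed

lemma P5_class:
  "gl_class (vector [vector [1, of_real a, 0, 0], vector [0, 0, 1, 0]]) = chart_class a 0 0"
proof -
  \<comment> \<open>The two matrices differ only by the sign of the second row.\<close>
  define T :: "complex^2^2" where "T = vector [vector [1, 0], vector [0, -1]]"
  have "det T \<noteq> 0" by (simp add: T_def det_2)
  then have "invertible T" by (simp add: invertible_det_nz)
  moreover have "T ** chart_matrix a 0 0 = vector [vector [1, of_real a, 0, 0], vector [0, 0, 1, 0]]"
    unfolding vec_eq_iff forall_2 forall_4
    by (simp add: T_def chart_matrix_def matrix_matrix_mult_def sum_2)
  ultimately show ?thesis unfolding chart_class_eq by (metis gl_class_mult)
qed

lemma mem_P5_iff: "p \<in> P5 N \<longleftrightarrow> p \<in> chart N \<and> alpha p = 0 \<and> beta p = 0 \<and> zeta p = 0"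
proof
  assume "p \<in> P5 N"
  then obtain r q w where "p = ((r, q, w), chart_class (r 0) 0 0)" "(r, q, w) \<in> Omega N"
    by (auto simp: P5_def P5_class)
  then show "p \<in> chart N \<and> alpha p = 0 \<and> beta p = 0 \<and> zeta p = 0"
    by (auto simp: chart_def region_def entry_defs)
next
  assume a: "p \<in> chart N \<and> alpha p = 0 \<and> beta p = 0 \<and> zeta p = 0"
  then obtain r q w a b z where "p = ((r, q, w), chart_class a b z)" "(r, q, w) \<in> Omega N"
    using chartE by metis
  then show "p \<in> P5 N" using a by (auto simp: P5_def P5_class entry_defs)
qed

lemmas region_defs = P13_def P13_minus_def P13r_def P13l_def P13r_plus_def P13l_plus_def

lemma end_tuple_of:
  obtains x where "x \<in> end_tuples N" "x 0 = u" "x (N + 1) = v"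
proof -
  have "(\<lambda>n. if n = 0 then u else if n = N + 1 then v else 0) \<in> end_tuples N"
    by (auto simp: end_tuples_def)
  then show ?thesis using that[of "\<lambda>n. if n = 0 then u else if n = N + 1 then v else 0"] by simp
qed

lemma end_tuple_nonzero: "x \<in> end_tuples N \<Longrightarrow> x \<noteq> 0 \<Longrightarrow> x 0 \<noteq> 0 \<or> x (N + 1) \<noteq> 0"
  by (rule ccontr) (auto simp: end_tuples_def fun_eq_iff, metis gr0I)

section \<open>Signature of the end form on each region\<close>

context
  fixes N :: nat and p :: problem
  assumes N: "N \<ge> 1"
begin

lemma ends_inertia: "pos_ends N p + neg_ends N p \<le> 2"
  using seq.sylvester_inertia[OF hermitian_energy[of N p] end_tuples_dim(1)[of N]] end_tuples_dim(2)[of N]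
  by (simp add: pos_ends_def neg_ends_def)

lemma pos_ends_ge_1:
  assumes "hquad (alpha p) (beta p) (zeta p) u v > 0"
  shows "1 \<le> pos_ends N p"
proof -
  obtain x where x: "x \<in> end_tuples N" "x 0 = u" "x (N + 1) = v" using end_tuple_of .
  then show ?thesis
    unfolding pos_ends_def using assms energy_end_tuples[OF x(1) N, of p]
    by (intro seq.neg_index_ge_1[OF seq.hermitian_uminus[OF hermitian_energy] end_tuples_dim(1)]) auto
qed

lemma neg_ends_ge_1:
  assumes "hquad (alpha p) (beta p) (zeta p) u v < 0"
  shows "1 \<le> neg_ends N p"
proof -
  obtain x where x: "x \<in> end_tuples N" "x 0 = u" "x (N + 1) = v" using end_tuple_of .
  then show ?thesis
    unfolding neg_ends_def using assms energy_end_tuples[OF x(1) N, of p]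
    by (intro seq.neg_index_ge_1[OF hermitian_energy end_tuples_dim(1)]) auto
qed

lemma ends_less_2:
  assumes "hquad (alpha p) (beta p) (zeta p) u v = 0" "u \<noteq> 0 \<or> v \<noteq> 0"
  shows "pos_ends N p < 2" "neg_ends N p < 2"
proof -
  obtain x where x: "x \<in> end_tuples N" "x 0 = u" "x (N + 1) = v" using end_tuple_of .
  have "x \<noteq> 0" using assms(2) x by auto
  then show "pos_ends N p < 2" "neg_ends N p < 2"
    unfolding pos_ends_def neg_ends_def end_tuples_dim(2)[of N, symmetric]
    using assms x energy_end_tuples[OF x(1) N, of p]
    by (auto intro!: seq.neg_index_less_dim[OF _ end_tuples_dim(1) x(1)] seq.hermitian_uminus hermitian_energy)
qed

lemma neg_ends_eq_0:
  assumes "\<And>u v. hquad (alpha p) (beta p) (zeta p) u v \<ge> 0"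
  shows "neg_ends N p = 0"
  unfolding neg_ends_def using assms
  by (intro seq.neg_index_eq_0[OF end_tuples_dim(1)]) (simp add: energy_end_tuples[OF _ N])

lemma pos_ends_eq_0:
  assumes "\<And>u v. hquad (alpha p) (beta p) (zeta p) u v \<le> 0"
  shows "pos_ends N p = 0"
  unfolding pos_ends_def using assms
  by (intro seq.neg_index_eq_0[OF end_tuples_dim(1)]) (simp add: energy_end_tuples[OF _ N])

lemma ends_positive_definite:
  assumes "disc p > 0" "alpha p \<ge> 0"
  shows "pos_ends N p = 2" "neg_ends N p = 0"
proof -
  have pos: "hquad (alpha p) (beta p) (zeta p) u v > 0" if "u \<noteq> 0 \<or> v \<noteq> 0" for u v
    using hquad_pos assms that by (simp add: disc_def)
  then have "seq.negative_on (\<lambda>x y. - energy N p x y) (end_tuples N)"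
    using end_tuple_nonzero by (simp add: seq.negative_on_def energy_end_tuples[OF _ N])
  then show "pos_ends N p = 2"
    unfolding pos_ends_def using seq.neg_index_eq_dim[OF end_tuples_dim(1)] end_tuples_dim(2) by simp
  then show "neg_ends N p = 0" using ends_inertia by simp
qed

lemma ends_negative_definite:
  assumes "disc p > 0" "alpha p \<le> 0"
  shows "pos_ends N p = 0" "neg_ends N p = 2"
proof -
  have neg: "hquad (alpha p) (beta p) (zeta p) u v < 0" if "u \<noteq> 0 \<or> v \<noteq> 0" for u v
    using hquad_pos[of "- alpha p" "- beta p" "- zeta p" u v] assms that
    by (simp add: disc_def hquad_uminus)
  then have "seq.negative_on (energy N p) (end_tuples N)"
    using end_tuple_nonzero by (simp add: seq.negative_on_def energy_end_tuples[OF _ N])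
  then show "neg_ends N p = 2"
    unfolding neg_ends_def using seq.neg_index_eq_dim[OF end_tuples_dim(1)] end_tuples_dim(2) by simp
  then show "pos_ends N p = 0" using ends_inertia by simp
qed

lemma ends_indefinite:
  assumes "disc p < 0"
  shows "pos_ends N p = 1" "neg_ends N p = 1"
proof -
  have "\<exists>u v. hquad (alpha p) (beta p) (zeta p) u v > 0"
    using hquad_indefinite_pos assms by (simp add: disc_def)
  then have "1 \<le> pos_ends N p" using pos_ends_ge_1 by blast
  moreover have "\<exists>u v. hquad (- alpha p) (- beta p) (- zeta p) u v > 0"
    using hquad_indefinite_pos assms by (simp add: disc_def)
  then have "1 \<le> neg_ends N p" using neg_ends_ge_1 by (auto simp: hquad_uminus)
  ultimately show "pos_ends N p = 1" "neg_ends N p = 1" using ends_inertia by auto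
qed

text \<open>A nonzero vector with value 0 excludes two positive squares; a positive diagonal entry
  supplies one.\<close>

lemma ends_positive_rank_1:
  assumes "disc p = 0" "alpha p \<ge> 0" "beta p \<ge> 0" "alpha p \<noteq> 0 \<or> beta p \<noteq> 0"
  shows "pos_ends N p = 1" "neg_ends N p = 0"
proof -
  show "neg_ends N p = 0"
    using hquad_nonneg assms by (intro neg_ends_eq_0) (simp add: disc_def)
  have "pos_ends N p < 2" using hquad_null ends_less_2(1) assms(1) by (metis disc_def)
  moreover have "hquad (alpha p) (beta p) (zeta p) 1 0 > 0 \<or> hquad (alpha p) (beta p) (zeta p) 0 1 > 0"
    using assms by (auto simp: hquad_def)
  then have "1 \<le> pos_ends N p" using pos_ends_ge_1 by blast
  ultimately show "pos_ends N p = 1" by simp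
qed

lemma ends_negative_rank_1:
  assumes "disc p = 0" "alpha p \<le> 0" "beta p \<le> 0" "alpha p \<noteq> 0 \<or> beta p \<noteq> 0"
  shows "pos_ends N p = 0" "neg_ends N p = 1"
proof -
  have "hquad (alpha p) (beta p) (zeta p) u v \<le> 0" for u v
    using hquad_nonneg[of "- alpha p" "- beta p" "- zeta p" u v] assms by (simp add: disc_def hquad_uminus)
  then show "pos_ends N p = 0" by (rule pos_ends_eq_0)
  have "neg_ends N p < 2" using hquad_null ends_less_2(2) assms(1) by (metis disc_def)
  moreover have "hquad (alpha p) (beta p) (zeta p) 1 0 < 0 \<or> hquad (alpha p) (beta p) (zeta p) 0 1 < 0"
    using assms by (auto simp: hquad_def)
  then have "1 \<le> neg_ends N p" using neg_ends_ge_1 by blast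
  ultimately show "neg_ends N p = 1" by simp
qed

lemma ends_zero:
  assumes "alpha p = 0" "beta p = 0" "zeta p = 0"
  shows "pos_ends N p = 0" "neg_ends N p = 0"
  using assms by (auto intro!: pos_ends_eq_0 neg_ends_eq_0 simp: hquad_def)

end

text \<open>Removing \<open>P5\<close> from the zero set of d therefore means exactly that \<alpha>
  and b do not both vanish, so that K has rank one.\<close>

lemma alpha_beta_nonzero: "disc p = 0 \<Longrightarrow> alpha p = 0 \<Longrightarrow> beta p = 0 \<Longrightarrow> zeta p = 0"
  by (simp add: disc_def)

lemma region_subset_chart:
  "P5 N \<subseteq> chart N" "P13 N \<subseteq> chart N" "P13_minus N \<subseteq> chart N" "P13r N \<subseteq> chart N"
  "P13l N \<subseteq> chart N" "P13r_plus N \<subseteq> chart N" "P13l_plus N \<subseteq> chart N"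
  by (auto simp: region_defs mem_region_iff mem_P5_iff)

lemma region_ends:
  assumes "N \<ge> 2"
  shows "p \<in> P5 N \<Longrightarrow> pos_ends N p = 0 \<and> neg_ends N p = 0"
    and "p \<in> P13_minus N \<Longrightarrow> pos_ends N p = 1 \<and> neg_ends N p = 1"
    and "p \<in> P13r N \<Longrightarrow> pos_ends N p = 1 \<and> neg_ends N p = 0"
    and "p \<in> P13l N \<Longrightarrow> pos_ends N p = 0 \<and> neg_ends N p = 1"
    and "p \<in> P13r_plus N \<Longrightarrow> pos_ends N p = 2 \<and> neg_ends N p = 0"
    and "p \<in> P13l_plus N \<Longrightarrow> pos_ends N p = 0 \<and> neg_ends N p = 2"
proof -
  have N: "N \<ge> 1" using assms by simp
  show "p \<in> P5 N \<Longrightarrow> pos_ends N p = 0 \<and> neg_ends N p = 0"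
    using ends_zero[OF N, of p] by (simp add: mem_P5_iff)
  show "p \<in> P13_minus N \<Longrightarrow> pos_ends N p = 1 \<and> neg_ends N p = 1"
    using ends_indefinite[OF N, of p] by (simp add: region_defs mem_region_iff)
  show "p \<in> P13r N \<Longrightarrow> pos_ends N p = 1 \<and> neg_ends N p = 0"
    using ends_positive_rank_1[OF N, of p] alpha_beta_nonzero[of p]
    by (auto simp: region_defs mem_region_iff mem_P5_iff)
  show "p \<in> P13l N \<Longrightarrow> pos_ends N p = 0 \<and> neg_ends N p = 1"
    using ends_negative_rank_1[OF N, of p] alpha_beta_nonzero[of p]
    by (auto simp: region_defs mem_region_iff mem_P5_iff)
  show "p \<in> P13r_plus N \<Longrightarrow> pos_ends N p = 2 \<and> neg_ends N p = 0"
    using ends_positive_definite[OF N, of p] by (simp add: region_defs mem_region_iff)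
  show "p \<in> P13l_plus N \<Longrightarrow> pos_ends N p = 0 \<and> neg_ends N p = 2"
    using ends_negative_definite[OF N, of p] by (simp add: region_defs mem_region_iff)
qed

lemma disc_zero_signs:
  assumes "disc p = 0"
  shows "(alpha p \<ge> 0 \<and> beta p \<ge> 0) \<or> (alpha p \<le> 0 \<and> beta p \<le> 0)"
proof -
  have "alpha p * beta p \<ge> 0" using assms by (simp add: disc_def)
  then show ?thesis by (auto simp: zero_le_mult_iff)
qed

lemma disc_pos_signs:
  assumes "disc p > 0"
  shows "(alpha p \<ge> 0 \<and> beta p \<ge> 0) \<or> (alpha p \<le> 0 \<and> beta p \<le> 0)"
proof -
  have "alpha p * beta p \<ge> 0" using assms zero_le_power2[of "cmod (zeta p)"] unfolding disc_def by linarith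
  then show ?thesis by (auto simp: zero_le_mult_iff)
qed

lemma P13_cases: "P13 N = P13r N \<union> P13l N \<union> P5 N"
proof (rule set_eqI)
  fix p
  have "p \<in> P5 N \<Longrightarrow> disc p = 0" by (simp add: mem_P5_iff disc_def)
  then show "p \<in> P13 N \<longleftrightarrow> p \<in> P13r N \<union> P13l N \<union> P5 N"
    using disc_zero_signs[of p] by (auto simp: region_defs mem_region_iff mem_P5_iff)
qed

lemma chart_minus_P13_cases: "chart N - P13 N = P13_minus N \<union> P13r_plus N \<union> P13l_plus N"
proof (rule set_eqI)
  fix p
  have "disc p < 0 \<or> disc p = 0 \<or> disc p > 0" by linarith
  then show "p \<in> chart N - P13 N \<longleftrightarrow> p \<in> P13_minus N \<union> P13r_plus N \<union> P13l_plus N"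
    using disc_pos_signs[of p] by (auto simp: region_defs mem_region_iff)
qed

section \<open>The list of eigenvalues and its counting function\<close>

lemma sorted_concat_replicate:
  "sorted xs \<Longrightarrow> sorted (concat (map (\<lambda>x. replicate (m x) x) xs))"
  by (induction xs) (auto simp: sorted_append)

lemma length_filter_concat_replicate:
  "length (filter P (concat (map (\<lambda>x. replicate (m x) x) xs))) = (\<Sum>x\<leftarrow>xs. if P x then m x else 0)"
  by (induction xs) auto

text \<open>In a sorted list the entries below x form an initial segment. This translates statements
  about the n-th eigenvalue into statements about counts.\<close>

lemma sorted_nth_less_iff:
  fixes xs :: "'a::linorder list"
  assumes "sorted xs" "n < length xs"
  shows "xs ! n < x \<longleftrightarrow> n < length (filter (\<lambda>y. y < x) xs)"
proof
  assume a: "xs ! n < x"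
  have "{..n} \<subseteq> {i. i < length xs \<and> xs ! i < x}"
    using assms a sorted_nth_mono by (auto intro: le_less_trans)
  then have "card {..n} \<le> card {i. i < length xs \<and> xs ! i < x}" by (intro card_mono) auto
  then show "n < length (filter (\<lambda>y. y < x) xs)" by (simp add: length_filter_conv_card)
next
  assume a: "n < length (filter (\<lambda>y. y < x) xs)"
  show "xs ! n < x"
  proof (rule ccontr)
    assume "\<not> xs ! n < x"
    have "i < n" if "i < length xs" "xs ! i < x" for i
    proof (rule ccontr)
      assume "\<not> i < n"
      then have "xs ! n \<le> xs ! i" using sorted_nth_mono[OF assms(1)] that by simp
      then show False using that \<open>\<not> xs ! n < x\<close> by simp
    qed
    then have "{i. i < length xs \<and> xs ! i < x} \<subseteq> {..<n}" by auto
    then have "card {i. i < length xs \<and> xs ! i < x} \<le> card {..<n}" by (intro card_mono) auto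
    then show False using a by (simp add: length_filter_conv_card)
  qed
qed

definition count_below :: "nat \<Rightarrow> problem \<Rightarrow> real \<Rightarrow> nat" where
  "count_below N p t = (\<Sum>x\<in>{x. of_real x \<in> eigenvalues N p \<and> x < t}. mult N p (of_real x))"

context
  fixes N :: nat and p :: problem
  assumes p: "p \<in> chart N" and N: "N \<ge> 2"
begin

lemma has_exactly_eigenvalues_num:
  "has_exactly_eigenvalues N p (num_eigenvalues N p)"
  using finite_eigenvalues[OF p N] eigenvalue_real[OF p N] by (auto simp: has_exactly_eigenvalues_def)

lemma num_eigenvalues_ends: "num_eigenvalues N p + 2 = N + pos_ends N p + neg_ends N p"
  using num_eigenvalues_eq[OF p N] by (simp add: pos_ends_def neg_ends_def)

lemma finite_real_eigenvalues: "finite {x. complex_of_real x \<in> eigenvalues N p}"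
  using finite_vimageI[OF finite_eigenvalues[OF p N] inj_of_real] by (simp add: vimage_def)

lemma sorted_eigenvalue_list: "sorted (eigenvalue_list N p)"
  unfolding eigenvalue_list_def by (intro sorted_concat_replicate) simp

lemma length_filter_eigenvalue_list:
  "length (filter P (eigenvalue_list N p)) = (\<Sum>x\<in>{x. of_real x \<in> eigenvalues N p \<and> P x}. mult N p (of_real x))"
proof -
  let ?A = "{x. complex_of_real x \<in> eigenvalues N p}"
  have "length (filter P (eigenvalue_list N p)) =
      (\<Sum>x\<leftarrow>sorted_list_of_set ?A. if P x then mult N p (of_real x) else 0)"
    unfolding eigenvalue_list_def by (rule length_filter_concat_replicate)
  also have "\<dots> = (\<Sum>x\<in>?A. if P x then mult N p (of_real x) else 0)"
    using finite_real_eigenvalues by (subst sum_list_distinct_conv_sum_set) auto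
  also have "\<dots> = (\<Sum>x\<in>{x\<in>?A. P x}. mult N p (of_real x))"
    using finite_real_eigenvalues by (rule sum.inter_filter[symmetric])
  finally show ?thesis by simp
qed

lemma length_eigenvalue_list: "length (eigenvalue_list N p) = num_eigenvalues N p"
proof -
  have "eigenvalues N p = of_real ` {x. complex_of_real x \<in> eigenvalues N p}"
    using eigenvalue_real[OF p N] by (auto elim!: Reals_cases)
  then have "num_eigenvalues N p = (\<Sum>x\<in>{x. complex_of_real x \<in> eigenvalues N p}. mult N p (of_real x))"
    unfolding num_eigenvalues_def by (metis (no_types, lifting) inj_of_real inj_on_subset subset_UNIV sum.reindex_cong)
  then show ?thesis using length_filter_eigenvalue_list[of "\<lambda>_. True"] by simp
qed

lemma lam_less_iff:
  assumes "n < num_eigenvalues N p"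
  shows "lam N n p < t \<longleftrightarrow> n < count_below N p t"
  using sorted_nth_less_iff[OF sorted_eigenvalue_list, of n t] assms length_eigenvalue_list
  by (simp add: lam_def count_below_def length_filter_eigenvalue_list)

lemma count_below_le: "count_below N p t \<le> num_eigenvalues N p"
  using length_filter_eigenvalue_list[of "\<lambda>x. x < t"] length_filter_le[of "\<lambda>x. x < t" "eigenvalue_list N p"]
    length_eigenvalue_list by (simp add: count_below_def)

lemma neg_index_eq_count_below:
  "seq.neg_index (\<lambda>x y. energy N p x y - of_real t * mass N p x y) (tuples N) + pos_ends N p =
   2 + count_below N p t"
  using neg_index_eq_count[OF p N, of t] by (simp add: pos_ends_def count_below_def)

text \<open>Supplies thresholds for counting that avoid the finite spectrum.\<close>

lemma exists_noneigenvalue: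
  assumes "a < (b::real)"
  shows "\<exists>t. a < t \<and> t < b \<and> complex_of_real t \<notin> eigenvalues N p"
proof (rule ccontr)
  assume "\<not> ?thesis"
  then have "{a<..<b} \<subseteq> {x. complex_of_real x \<in> eigenvalues N p}" by auto
  then have "finite {a<..<b}" using finite_real_eigenvalues finite_subset by blast
  then show False using assms infinite_Ioo by blast
qed

end


section \<open>Convergence in the space of problems\<close>

lemma rank_chart_matrix: "chart_matrix a b z \<in> rank2_matrices"
proof -
  let ?r = "vector [1, of_real a, 0, cnj z] :: complex^4" and ?s = "vector [0, z, -1, of_real b] :: complex^4"
  have s0: "?s \<noteq> 0" by (simp add: vec_eq_iff forall_4)
  have rs: "?r \<notin> vec.span {?s}"
    by (auto simp: vec.span_singleton vec_eq_iff forall_4)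
  then have "?r \<noteq> ?s" using vec.span_base[of ?s "{?s}"] by auto
  have "rows (chart_matrix a b z) = (\<lambda>i. row i (chart_matrix a b z)) ` UNIV"
    by (auto simp: rows_def)
  also have "\<dots> = {?r, ?s}"
    by (simp add: UNIV_2 row_def chart_matrix_def)
  finally have "rows (chart_matrix a b z) = {?r, ?s}" .
  moreover have "vec.independent {?r, ?s}"
    using rs s0 by (simp add: vec.independent_insert)
  then have "vec.dim {?r, ?s} = 2"
    using \<open>?r \<noteq> ?s\<close> by (simp add: vec.dim_eq_card_independent)
  ultimately show ?thesis by (simp add: rank2_matrices_def row_rank_def_gen)
qed

lemma chart_class_in_BC: "chart_class a b z \<in> BC"
proof -
  have "left_half (chart_matrix a b z) ** J ** adjoint_matrix (left_half (chart_matrix a b z)) =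
      right_half (chart_matrix a b z) ** J ** adjoint_matrix (right_half (chart_matrix a b z))"
    by (simp add: vec_eq_iff forall_2 left_half_def right_half_def chart_matrix_def J_def adjoint_matrix_def
        matrix_matrix_mult_def sum_2)
  then show ?thesis unfolding BC_def chart_class_eq using rank_chart_matrix by blast
qed

lemma topspace_Omega: "topspace (Omega_top N) = Omega N"
  by (auto simp: Omega_top_def Omega_def PiE_def)

lemma topspace_BC: "topspace BC_top = BC"
  by (auto simp: BC_top_def topspace_quotient_topology BC_def)

lemma chart_subset_topspace: "chart N \<subseteq> topspace (problem_top N)"
  by (auto simp: problem_top_def topspace_Omega topspace_BC chart_def region_def chart_class_in_BC)

lemma continuous_map_entries:
  shows "n \<in> {0..N} \<Longrightarrow> continuous_map (problem_top N) euclideanreal (\<lambda>p. recip p n)"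
    and "n \<in> {1..N} \<Longrightarrow> continuous_map (problem_top N) euclideanreal (\<lambda>p. pot p n)"
    and "n \<in> {1..N} \<Longrightarrow> continuous_map (problem_top N) euclideanreal (\<lambda>p. weight p n)"
proof -
  have proj: "continuous_map (product_topology (\<lambda>_. euclideanreal) I) euclideanreal (\<lambda>x. x n)" if "n \<in> I" for n and I :: "nat set"
    using continuous_map_product_projection[OF that] .
  note fst_comp = continuous_map_compose[OF continuous_map_fst, unfolded o_def]
    and snd_comp = continuous_map_compose[OF continuous_map_snd, unfolded o_def]
  show "continuous_map (problem_top N) euclideanreal (\<lambda>p. recip p n)" if "n \<in> {0..N}"
    unfolding recip_def problem_top_def Omega_top_def
    by (intro fst_comp continuous_map_from_subtopology proj that)
  show "continuous_map (problem_top N) euclideanreal (\<lambda>p. pot p n)" if "n \<in> {1..N}"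
    unfolding pot_def problem_top_def Omega_top_def
    by (intro fst_comp continuous_map_from_subtopology snd_comp[where g = "\<lambda>s. fst s n"] proj that)
  show "continuous_map (problem_top N) euclideanreal (\<lambda>p. weight p n)" if "n \<in> {1..N}"
    unfolding weight_def problem_top_def Omega_top_def
    by (intro fst_comp continuous_map_from_subtopology snd_comp[where g = "\<lambda>s. snd s n"]
        snd_comp[where g = "\<lambda>s. s n"] proj that)
qed

lemma tendsto_approach:
  assumes "continuous_map (problem_top N) euclideanreal f" "p \<in> chart N"
  shows "(f \<longlongrightarrow> f p) (approach N S p)"
  using limit_within_subset[OF limitin_continuous_map[OF assms(1)], of p "f p" S]
    chart_subset_topspace assms(2) by auto

lemma gl_classD: "gl_class M = gl_class M' \<Longrightarrow> \<exists>T. invertible T \<and> M = T ** M'"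
  using mem_gl_class[of M] by (auto simp: gl_class_def)

text \<open>The ratio makes sense only where the minor of columns 1 and 3 is nonzero, so continuity
  is proved at points of the chart, straight from the quotient topology. The matrices whose ratio is
  close to the given one form an open set \<open>G\<close> that is invariant under invertible left
  factors; being saturated, it has an open image among the classes.\<close>

lemma tendsto_minor_ratio:
  assumes p: "p \<in> chart N"
  shows "((\<lambda>x. minor_ratio i j (snd x)) \<longlongrightarrow> minor_ratio i j (snd p)) (approach N S p)"
proof (rule tendstoI)
  fix \<epsilon> :: real assume \<epsilon>: "\<epsilon> > 0"
  obtain r q w a b z where pe: "p = ((r, q, w), chart_class a b z)" using chartE[OF p] .
  let ?M = "chart_matrix a b z"
  define f where "f M = minor i j M / minor 1 3 M" for M
  define G where "G = {M. minor 1 3 M \<noteq> 0 \<and> dist (f M) (f ?M) < \<epsilon>}"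
  have cont: "continuous_on A (minor k l)" for A k l
    unfolding minor_def by (intro continuous_intros)
  have "open {M. minor 1 3 M \<noteq> 0}"
    by (intro open_Collect_neq cont continuous_intros)
  moreover have "continuous_on {M. minor 1 3 M \<noteq> 0} f"
    unfolding f_def by (intro continuous_on_divide cont) auto
  ultimately have "open ({M. minor 1 3 M \<noteq> 0} \<inter> f -` ball (f ?M) \<epsilon>)"
    by (intro continuous_open_preimage) auto
  also have "{M. minor 1 3 M \<noteq> 0} \<inter> f -` ball (f ?M) \<epsilon> = G"
    by (auto simp: G_def dist_commute)
  finally have G: "open G" .
  have invariant: "T ** M \<in> G \<longleftrightarrow> M \<in> G" if "invertible T" for T M
    using that invertible_det_nz[of T] by (auto simp: G_def f_def minor_mult)
  define U where "U = gl_class ` (rank2_matrices \<inter> G)"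
  have "{M \<in> rank2_matrices. gl_class M \<in> U} = rank2_matrices \<inter> G"
  proof (intro equalityI subsetI)
    fix M assume M: "M \<in> {M \<in> rank2_matrices. gl_class M \<in> U}"
    then obtain M' where M': "M' \<in> G" "gl_class M = gl_class M'" by (auto simp: U_def)
    obtain T where "invertible T" "M = T ** M'" using gl_classD[OF M'(2)] by blast
    then show "M \<in> rank2_matrices \<inter> G" using M M'(1) invariant by simp
  qed (auto simp: U_def)
  then have "openin (quotient_topology (top_of_set rank2_matrices) gl_class) U"
    using G by (auto simp: openin_quotient_topology U_def openin_open_Int)
  then have "openin BC_top (U \<inter> BC)"
    unfolding BC_top_def by (metis openin_subtopology)
  then have op: "openin (problem_top N) {x \<in> topspace (problem_top N). snd x \<in> U \<inter> BC}"
    unfolding problem_top_def by (rule openin_continuous_map_preimage[OF continuous_map_snd])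
  have "?M \<in> G" using \<epsilon> by (simp add: G_def minor_def chart_matrix_def)
  then have "p \<in> {x \<in> topspace (problem_top N). snd x \<in> U \<inter> BC}"
    using p chart_subset_topspace rank_chart_matrix chart_class_in_BC
    by (auto simp: pe U_def chart_class_eq)
  moreover have "dist (minor_ratio i j (snd x)) (minor_ratio i j (snd p)) < \<epsilon>" if "snd x \<in> U" for x
    using that by (auto simp: U_def G_def f_def minor_ratio_gl_class pe chart_class_eq)
  ultimately show "eventually (\<lambda>x. dist (minor_ratio i j (snd x)) (minor_ratio i j (snd p)) < \<epsilon>) (approach N S p)"
    unfolding eventually_atin_within using op by blast
qed

lemma tendsto_boundary_entries:
  assumes p: "p \<in> chart N"
  shows "(alpha \<longlongrightarrow> alpha p) (approach N S p)" "(beta \<longlongrightarrow> beta p) (approach N S p)"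
    "(zeta \<longlongrightarrow> zeta p) (approach N S p)"
  unfolding alpha_def[abs_def] beta_def[abs_def] zeta_def[abs_def] a12_def b22_def zc_def
  by (intro tendsto_intros tendsto_minor_ratio[OF p] tendsto_approach[OF continuous_map_entries(1) p]; simp)+

lemma tendsto_energy:
  assumes p: "p \<in> chart N"
  shows "((\<lambda>p. energy N p x y) \<longlongrightarrow> energy N p x y) (approach N S p)"
  unfolding energy_def
  by (intro tendsto_intros tendsto_boundary_entries[OF p]
      tendsto_approach[OF continuous_map_entries(1) p] tendsto_approach[OF continuous_map_entries(2) p])
    (use Omega_pos(1)[OF p] in auto)

lemma tendsto_mass:
  assumes p: "p \<in> chart N"
  shows "((\<lambda>p. mass N p x y) \<longlongrightarrow> mass N p x y) (approach N S p)"
  unfolding mass_def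
  by (intro tendsto_intros tendsto_approach[OF continuous_map_entries(3) p]) auto

lemma eventually_approach: "(\<And>p. p \<in> S \<Longrightarrow> P p) \<Longrightarrow> eventually P (approach N S p\<^sub>0)"
  unfolding eventually_atin_within using openin_topspace by blast

section \<open>Limits of the eigenvalues\<close>

context
  fixes N :: nat and p\<^sub>0 :: problem and S :: "problem set"
  assumes N: "N \<ge> 2" and p0: "p\<^sub>0 \<in> chart N" and S: "S \<subseteq> chart N"
begin

lemma eventually_ends_ge:
  "eventually (\<lambda>p. pos_ends N p\<^sub>0 \<le> pos_ends N p \<and> neg_ends N p\<^sub>0 \<le> neg_ends N p) (approach N S p\<^sub>0)"
  unfolding pos_ends_def neg_ends_def
  by (intro eventually_conj seq.eventually_neg_index_ge seq.hermitian_uminus hermitian_energy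
      end_tuples_dim tendsto_minus tendsto_energy p0)

text \<open>Off the spectrum of \<open>p\<^sub>0\<close> the form is nondegenerate, so its two
  indices already fill the whole dimension. As neither can drop nearby, both stay fixed, and
  \<open>neg_index_eq_count_below\<close> converts this into counts.\<close>

lemma eventually_count_below:
  assumes t: "complex_of_real t \<notin> eigenvalues N p\<^sub>0"
  shows "eventually (\<lambda>p. count_below N p t + pos_ends N p\<^sub>0 = count_below N p\<^sub>0 t + pos_ends N p) (approach N S p\<^sub>0)"
proof -
  define h where "h p x y = energy N p x y - of_real t * mass N p x y" for p x y
  have h: "seq.hermitian (h p)" for p
    using seq.hermitian_combine[OF hermitian_energy[of N p] hermitian_mass[of N p], of 1 "-t"]
    by (simp add: h_def[abs_def])
  have lim: "((\<lambda>p. h p x y) \<longlongrightarrow> h p\<^sub>0 x y) (approach N S p\<^sub>0)" for x y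
    unfolding h_def by (intro tendsto_intros tendsto_energy tendsto_mass p0)
  have "eventually (\<lambda>p. seq.neg_index (h p\<^sub>0) (tuples N) \<le> seq.neg_index (h p) (tuples N)) (approach N S p\<^sub>0)"
    by (intro seq.eventually_neg_index_ge h tuples_dim lim)
  moreover have "eventually (\<lambda>p. seq.neg_index (\<lambda>x y. - h p\<^sub>0 x y) (tuples N) \<le>
      seq.neg_index (\<lambda>x y. - h p x y) (tuples N)) (approach N S p\<^sub>0)"
    by (intro seq.eventually_neg_index_ge seq.hermitian_uminus h tuples_dim tendsto_minus lim)
  moreover have "eventually (\<lambda>p. p \<in> S) (approach N S p\<^sub>0)" by (rule eventually_approach)
  ultimately show ?thesis
  proof eventually_elim
    case (elim p)
    then have pc: "p \<in> chart N" using S by blast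
    have "seq.dim (seq.radical (h p\<^sub>0) (tuples N)) = 0"
      using nondegenerate_off_spectrum[OF p0 N t] by (simp add: h_def[abs_def])
    then have "seq.neg_index (h p) (tuples N) = seq.neg_index (h p\<^sub>0) (tuples N)"
      using elim seq.sylvester_inertia[OF h tuples_dim(1), of p N] seq.sylvester_inertia[OF h tuples_dim(1), of p\<^sub>0 N]
      by simp
    then show ?case
      using neg_index_eq_count_below[OF pc N, of t] neg_index_eq_count_below[OF p0 N, of t]
      by (simp add: h_def[abs_def])
  qed
qed

text \<open>Squeezes the eigenvalue between thresholds off the spectrum of \<open>p\<^sub>0\<close>;
  the s additional eigenvalues below each threshold shift the index. The signature need only be
  constant eventually, since \<open>S\<close> may join regions of different signature.\<close>

lemma lam_tendsto:
  assumes j: "j < num_eigenvalues N p\<^sub>0"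
    and ev: "eventually (\<lambda>p. pos_ends N p = pos_ends N p\<^sub>0 + s) (approach N S p\<^sub>0)"
  shows "(lam N (j + s) \<longlongrightarrow> lam N j p\<^sub>0) (approach N S p\<^sub>0)"
proof -
  have in_chart: "eventually (\<lambda>p. p \<in> chart N) (approach N S p\<^sub>0)"
    using S by (intro eventually_approach) auto
  \<comment> \<open>The index j + s exists nearby: \<open>pos_ends\<close> grows by s,
    \<open>neg_ends\<close> does not drop, and their sum determines the number of
    eigenvalues.\<close>
  have num: "eventually (\<lambda>p. j + s < num_eigenvalues N p) (approach N S p\<^sub>0)"
    using eventually_ends_ge in_chart ev
  proof eventually_elim
    case (elim p)
    then show ?case using j num_eigenvalues_ends[OF _ N, of p] num_eigenvalues_ends[OF p0 N] by simp
  qed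
  show ?thesis
  proof (rule order_tendstoI)
    fix y assume "y < lam N j p\<^sub>0"
    then obtain t where t: "y < t" "t < lam N j p\<^sub>0" "complex_of_real t \<notin> eigenvalues N p\<^sub>0"
      using exists_noneigenvalue[OF p0 N] by blast
    have c: "\<not> j < count_below N p\<^sub>0 t" using lam_less_iff[OF p0 N j, of t] t(2) by simp
    show "eventually (\<lambda>p. y < lam N (j + s) p) (approach N S p\<^sub>0)"
      using eventually_count_below[OF t(3)] ev num in_chart
    proof eventually_elim
      case (elim p)
      then have "\<not> lam N (j + s) p < t" using c lam_less_iff[OF elim(4) N elim(3), of t] by simp
      then show ?case using t(1) by simp
    qed
  next
    fix y assume "lam N j p\<^sub>0 < y"
    then obtain t where t: "lam N j p\<^sub>0 < t" "t < y" "complex_of_real t \<notin> eigenvalues N p\<^sub>0"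
      using exists_noneigenvalue[OF p0 N] by blast
    have c: "j < count_below N p\<^sub>0 t" using lam_less_iff[OF p0 N j, of t] t(1) by simp
    show "eventually (\<lambda>p. lam N (j + s) p < y) (approach N S p\<^sub>0)"
      using eventually_count_below[OF t(3)] ev num in_chart
    proof eventually_elim
      case (elim p)
      then have "lam N (j + s) p < t" using c lam_less_iff[OF elim(4) N elim(3), of t] by simp
      then show ?case using t(2) by simp
    qed
  qed
qed

text \<open>Every threshold eventually has at least
  \<open>pos_ends N p - pos_ends N p\<^sub>0\<close> eigenvalues of p below it, which exceeds
  n.\<close>

lemma lam_at_bot:
  assumes pos: "\<And>p. p \<in> S \<Longrightarrow> pos_ends N p\<^sub>0 + n < pos_ends N p"
  shows "filterlim (lam N n) at_bot (approach N S p\<^sub>0)"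
  unfolding filterlim_at_bot
proof
  fix Z :: real
  obtain t where t: "t < Z" "complex_of_real t \<notin> eigenvalues N p\<^sub>0"
    using exists_noneigenvalue[OF p0 N, of "Z - 1" Z] by auto
  have "eventually (\<lambda>p. p \<in> S) (approach N S p\<^sub>0)" by (rule eventually_approach)
  then show "eventually (\<lambda>p. lam N n p \<le> Z) (approach N S p\<^sub>0)"
    using eventually_count_below[OF t(2)]
  proof eventually_elim
    case (elim p)
    then have pc: "p \<in> chart N" using S by blast
    have "n < count_below N p t" using elim pos[of p] by simp
    moreover have "n < num_eigenvalues N p" using calculation count_below_le[OF pc N, of t] by simp
    ultimately show ?case using lam_less_iff[OF pc N, of n t] t(1) by simp
  qed
qed

text \<open>Below a threshold there are eventually at most as many eigenvalues as
  \<open>p\<^sub>0\<close> has in total plus the gain in \<open>pos_ends\<close>, hence at most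
  n.\<close>

lemma lam_at_top:
  assumes num: "\<And>p. p \<in> S \<Longrightarrow> n < num_eigenvalues N p"
    and pos: "\<And>p. p \<in> S \<Longrightarrow> num_eigenvalues N p\<^sub>0 + pos_ends N p \<le> n + pos_ends N p\<^sub>0"
  shows "filterlim (lam N n) at_top (approach N S p\<^sub>0)"
  unfolding filterlim_at_top
proof
  fix Z :: real
  obtain t where t: "Z < t" "complex_of_real t \<notin> eigenvalues N p\<^sub>0"
    using exists_noneigenvalue[OF p0 N, of Z "Z + 1"] by auto
  have "eventually (\<lambda>p. p \<in> S) (approach N S p\<^sub>0)" by (rule eventually_approach)
  then show "eventually (\<lambda>p. Z \<le> lam N n p) (approach N S p\<^sub>0)"
    using eventually_count_below[OF t(2)]
  proof eventually_elim
    case (elim p)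
    then have pc: "p \<in> chart N" using S by blast
    have "\<not> n < count_below N p t" using elim pos[of p] count_below_le[OF p0 N, of t] by simp
    then have "\<not> lam N n p < t" using lam_less_iff[OF pc N num[OF elim(1)], of t] by simp
    then show ?case using t(1) by simp
  qed
qed

end

lemma lam_continuous_onI:
  assumes N: "N \<ge> 2" and S: "S \<subseteq> chart N" and num: "\<And>p. p \<in> S \<Longrightarrow> n < num_eigenvalues N p"
    and ev: "\<And>p\<^sub>0. p\<^sub>0 \<in> S \<Longrightarrow> eventually (\<lambda>p. pos_ends N p = pos_ends N p\<^sub>0) (approach N S p\<^sub>0)"
  shows "lam_continuous_on N n S"
proof -
  have "(lam N n \<longlongrightarrow> lam N n p\<^sub>0) (approach N S p\<^sub>0)" if "p\<^sub>0 \<in> S" for p\<^sub>0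
    using lam_tendsto[OF N _ S num[OF that], of 0] that ev[OF that] S by auto
  then show ?thesis
    unfolding lam_continuous_on_def continuous_map_atin
    using num by (auto simp: atin_subtopology_within)
qed

section \<open>Test paths in the chart and discontinuity\<close>

lemma continuous_map_chart_line:
  assumes "(r, q, w) \<in> Omega N"
  shows "continuous_map euclideanreal (problem_top N)
    (\<lambda>t. ((r, q, w), chart_class (a + t * a') (b + t * b') (z + of_real t * z')))"
proof -
  define m where "m t = chart_matrix (a + t * a') (b + t * b') (z + of_real t * z')" for t
  \<comment> \<open>\<open>chart_matrix\<close> is affine in its entries; the difference removes the
    constant entries 1 and -1.\<close>
  have "m t = chart_matrix a b z + t *\<^sub>R (chart_matrix a' b' z' - chart_matrix 0 0 0)" for t
    unfolding m_def chart_matrix_def vec_eq_iff forall_2 forall_4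
    by (simp add: scaleR_conv_of_real[where 'a = complex])
  then have "continuous_on UNIV m" by (simp add: continuous_intros)
  then have "continuous_map euclideanreal (top_of_set rank2_matrices) m"
    using rank_chart_matrix by (auto simp: continuous_map_in_subtopology m_def)
  then have "continuous_map euclideanreal (quotient_topology (top_of_set rank2_matrices) gl_class) (gl_class \<circ> m)"
    using quotient_imp_continuous_map[OF quotient_map_quotient_topology] by (rule continuous_map_compose)
  then have "continuous_map euclideanreal BC_top (gl_class \<circ> m)"
    unfolding BC_top_def using chart_class_in_BC
    by (intro continuous_map_into_subtopology) (auto simp: m_def chart_class_eq[symmetric])
  then have "continuous_map euclideanreal BC_top (\<lambda>t. chart_class (a + t * a') (b + t * b') (z + of_real t * z'))"
    by (simp add: o_def m_def chart_class_eq)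
  then show ?thesis
    unfolding problem_top_def using assms by (intro continuous_map_pairedI) (auto simp: topspace_Omega)
qed

text \<open>A limit along the trivial filter says nothing, so contradicting continuity requires
  points of \<open>S\<close> arbitrarily close to \<open>p\<^sub>0\<close>.\<close>

lemma approach_nontrivial:
  assumes \<omega>: "(r, q, w) \<in> Omega N" and p0: "p\<^sub>0 = ((r, q, w), chart_class a b z)" "p\<^sub>0 \<notin> S"
    and S: "\<And>t. t > 0 \<Longrightarrow> ((r, q, w), chart_class (a + t * a') (b + t * b') (z + of_real t * z')) \<in> S"
  shows "approach N S p\<^sub>0 \<noteq> bot"
proof
  define l where "l t = ((r, q, w), chart_class (a + t * a') (b + t * b') (z + of_real t * z'))" for t
  have l0: "l 0 = p\<^sub>0" by (simp add: l_def p0)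
  have cont: "continuous_map euclideanreal (problem_top N) l"
    unfolding l_def using continuous_map_chart_line[OF \<omega>] .
  assume "approach N S p\<^sub>0 = bot"
  then have "eventually (\<lambda>_. False) (approach N S p\<^sub>0)" by simp
  moreover have "p\<^sub>0 \<in> topspace (problem_top N)"
    using cont l0 by (metis continuous_map_image_subset_topspace image_subset_iff topspace_euclidean UNIV_I)
  ultimately obtain T where T: "openin (problem_top N) T" "p\<^sub>0 \<in> T" "\<forall>x\<in>T. x \<in> S \<and> x \<noteq> p\<^sub>0 \<longrightarrow> False"
    unfolding eventually_atin_within by blast
  have "open {t. l t \<in> T}" using openin_continuous_map_preimage[OF cont T(1)] by simp
  then obtain e where e: "e > 0" "ball 0 e \<subseteq> {t. l t \<in> T}"
    using T(2) l0 open_contains_ball[of "{t. l t \<in> T}"] by auto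
  have "l (e / 2) \<in> T" using e by (auto simp: subset_iff)
  moreover have "l (e / 2) \<in> S" using S[of "e / 2"] e(1) by (simp add: l_def)
  ultimately show False using T(3) p0(2) by metis
qed

text \<open>Every degenerate K gains exactly one positive square under arbitrarily small changes: on
  \<open>P13r\<close> by raising both diagonal entries, elsewhere by enlarging |z|. One eigenvalue
  is thus lost to -\<infinity>.\<close>

lemma P13_accumulation:
  assumes N: "N \<ge> 2" and p0: "p\<^sub>0 \<in> P13 N"
  obtains S where "S \<subseteq> chart N" "approach N S p\<^sub>0 \<noteq> bot" "\<And>p. p \<in> S \<Longrightarrow> pos_ends N p = pos_ends N p\<^sub>0 + 1"
proof -
  have p0c: "p\<^sub>0 \<in> chart N" using p0 region_subset_chart(2) by blast
  have d0: "disc p\<^sub>0 = 0" using p0 by (simp add: region_defs mem_region_iff)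
  obtain r q w a b z where p0e: "p\<^sub>0 = ((r, q, w), chart_class a b z)" and \<omega>: "(r, q, w) \<in> Omega N"
    using chartE[OF p0c] .
  let ?l = "\<lambda>a' b' z' t. ((r, q, w), chart_class (a + t * a') (b + t * b') (z + of_real t * z'))"
  have lc: "?l a' b' z' t \<in> chart N" for a' b' z' t
    using \<omega> by (auto simp: chart_def region_def)
  have le: "alpha (?l a' b' z' t) = alpha p\<^sub>0 + t * a'" "beta (?l a' b' z' t) = beta p\<^sub>0 + t * b'"
    "zeta (?l a' b' z' t) = zeta p\<^sub>0 + of_real t * z'" for a' b' z' t
    by (simp_all add: entry_defs p0e)
  show ?thesis
  proof (cases "p\<^sub>0 \<in> P13r N")
    case True
    then have s: "alpha p\<^sub>0 \<ge> 0" "beta p\<^sub>0 \<ge> 0" by (auto simp: region_defs mem_region_iff)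
    have "?l 1 1 0 t \<in> P13r_plus N" if "t > 0" for t
    proof -
      have "disc (?l 1 1 0 t) = disc p\<^sub>0 + t * (alpha p\<^sub>0 + beta p\<^sub>0) + t * t"
        unfolding disc_def le by (simp add: algebra_simps)
      also have "\<dots> > 0" using d0 s that by (simp add: add_nonneg_pos)
      finally show ?thesis using lc[of t 1 1 0] s that le(1,2)[of t 1 1 0]
        by (simp add: region_defs mem_region_iff)
    qed
    moreover have "p\<^sub>0 \<notin> P13r_plus N" using d0 by (simp add: region_defs mem_region_iff)
    ultimately have "approach N (P13r_plus N) p\<^sub>0 \<noteq> bot"
      using approach_nontrivial[OF \<omega> p0e] by blast
    then show ?thesis
      using that[of "P13r_plus N"] region_subset_chart(6) region_ends(3)[OF N True] region_ends(5)[OF N] by simp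
  next
    case False
    then have "p\<^sub>0 \<in> P13l N \<or> p\<^sub>0 \<in> P5 N" using p0 P13_cases by blast
    then have pos: "pos_ends N p\<^sub>0 = 0" using region_ends(1,4)[OF N] by blast
    \<comment> \<open>The sign makes |z + t c| grow with t, so that d becomes negative.\<close>
    define c :: complex where "c = (if Re z \<ge> 0 then 1 else -1)"
    have "?l 0 0 c t \<in> P13_minus N" if "t > 0" for t
    proof -
      have "(cmod (zeta p\<^sub>0 + of_real t * c))\<^sup>2 = (cmod (zeta p\<^sub>0))\<^sup>2 + 2 * t * \<bar>Re z\<bar> + t * t"
        unfolding cmod_power2 by (simp add: entry_defs p0e c_def power2_eq_square algebra_simps)
      then have "disc (?l 0 0 c t) = disc p\<^sub>0 - 2 * t * \<bar>Re z\<bar> - t * t"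
        unfolding disc_def le by simp
      also have "\<dots> < 0" using d0 that mult_nonneg_nonneg[of "2 * t" "\<bar>Re z\<bar>"] mult_pos_pos[of t t] by linarith
      finally show ?thesis using lc[of t 0 0 c] by (simp add: region_defs mem_region_iff)
    qed
    moreover have "p\<^sub>0 \<notin> P13_minus N" using d0 by (simp add: region_defs mem_region_iff)
    ultimately have "approach N (P13_minus N) p\<^sub>0 \<noteq> bot"
      using approach_nontrivial[OF \<omega> p0e] by blast
    then show ?thesis
      using that[of "P13_minus N"] region_subset_chart(3) pos region_ends(2)[OF N] by simp
  qed
qed

text \<open>Along the set of \<open>P13_accumulation\<close> the n-th eigenvalue tends to
  -\<infinity> if n = 0, and otherwise to the eigenvalue of index n - 1 at \<open>p\<^sub>0\<close>.
  Continuity would also give the one of index n, and \<open>simple\<close> excludes that the two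
  agree. Where the eigenvalue is undefined, continuity fails by definition.\<close>

lemma lam_discontinuous_on_P13:
  assumes N: "N \<ge> 2" and p0: "p\<^sub>0 \<in> P13 N"
    and simple: "\<not> (0 < n \<and> n < num_eigenvalues N p\<^sub>0 \<and> lam N (n - 1) p\<^sub>0 = lam N n p\<^sub>0)"
  shows "\<not> lam_continuous_at N n p\<^sub>0"
proof
  assume "lam_continuous_at N n p\<^sub>0"
  then have num: "n < num_eigenvalues N p\<^sub>0" and "topcontinuous_at (problem_top N) euclideanreal (lam N n) p\<^sub>0"
    by (auto simp: lam_continuous_at_def)
  then have lim: "(lam N n \<longlongrightarrow> lam N n p\<^sub>0) (approach N S p\<^sub>0)" for S
    using limit_within_subset[of euclideanreal "lam N n" "lam N n p\<^sub>0" "problem_top N" p\<^sub>0 UNIV S]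
    by (auto simp: topcontinuous_at_atin)
  have p0c: "p\<^sub>0 \<in> chart N" using p0 region_subset_chart(2) by blast
  obtain S where S: "S \<subseteq> chart N" "approach N S p\<^sub>0 \<noteq> bot" "\<And>p. p \<in> S \<Longrightarrow> pos_ends N p = pos_ends N p\<^sub>0 + 1"
    using P13_accumulation[OF N p0] by metis
  show False
  proof (cases "n = 0")
    case True
    have "filterlim (lam N n) at_bot (approach N S p\<^sub>0)"
      using S(3) True by (intro lam_at_bot[OF N p0c S(1)]) simp
    then show False
      using not_tendsto_and_filterlim_at_infinity[OF S(2) lim] filterlim_at_bot_imp_at_infinity by blast
  next
    case False
    have "(lam N (n - 1 + 1) \<longlongrightarrow> lam N (n - 1) p\<^sub>0) (approach N S p\<^sub>0)"
      using num S(3) by (intro lam_tendsto[OF N p0c S(1)] eventually_approach) auto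
    then have "lam N (n - 1) p\<^sub>0 = lam N n p\<^sub>0"
      using False tendsto_unique[OF S(2) _ lim] by simp
    then show False using simple num False by simp
  qed
qed

text \<open>Given \<open>region_ends\<close>, the limits are arithmetic. With s the gain in
  \<open>pos_ends\<close> over \<open>p\<^sub>0\<close>, an index n below s goes to -\<infinity>, an
  existing index from \<open>num_eigenvalues N p\<^sub>0 + s\<close> on goes to \<infinity>, and any
  other n converges to the eigenvalue of index n - s.\<close>

theorem theorem5p3:
  fixes N :: nat
  assumes "N \<ge> 2"
  shows
    "\<comment> \<open>numbers of eigenvalues\<close>
     ((\<forall>p\<in>P5 N. has_exactly_eigenvalues N p (N - 2)) \<and>
      (\<forall>p\<in>P13 N - P5 N. has_exactly_eigenvalues N p (N - 1)) \<and>
      (\<forall>p\<in>chart N - P13 N. has_exactly_eigenvalues N p N)) \<and>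
     \<comment> \<open>(i)\<close>
     (\<forall>n<N. lam_continuous_on N n (chart N - P13 N)) \<and>
     \<comment> \<open>(ii), discontinuity; \<open>\<lambda>\<^sub>n\<close> can be continuous at a double eigenvalue \<open>\<lambda>\<^bsub>n-1\<^esub> = \<lambda>\<^sub>n\<close>\<close>
     (\<forall>p\<^sub>0\<in>P13 N. \<forall>n<N.
        \<not> (0 < n \<and> n < num_eigenvalues N p\<^sub>0 \<and> lam N (n - 1) p\<^sub>0 = lam N n p\<^sub>0) \<longrightarrow>
        \<not> lam_continuous_at N n p\<^sub>0) \<and>
     \<comment> \<open>(ii), asymptotics near \<open>P13r\<close>\<close>
     (\<forall>p\<^sub>0\<in>P13r N.
        (\<forall>n\<le>N - 2. (lam N n \<longlongrightarrow> lam N n p\<^sub>0) (approach N (P13_minus N \<union> P13r N) p\<^sub>0)) \<and>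
        filterlim (lam N (N - 1)) at_top (approach N (P13_minus N) p\<^sub>0) \<and>
        filterlim (lam N 0) at_bot (approach N (P13r_plus N) p\<^sub>0) \<and>
        (\<forall>n. 1 \<le> n \<and> n \<le> N - 1 \<longrightarrow>
           (lam N n \<longlongrightarrow> lam N (n - 1) p\<^sub>0) (approach N (P13r_plus N) p\<^sub>0))) \<and>
     \<comment> \<open>(ii), asymptotics near \<open>P13l\<close>\<close>
     (\<forall>p\<^sub>0\<in>P13l N.
        filterlim (lam N 0) at_bot (approach N (P13_minus N) p\<^sub>0) \<and>
        (\<forall>n. 1 \<le> n \<and> n \<le> N - 1 \<longrightarrow>
           (lam N n \<longlongrightarrow> lam N (n - 1) p\<^sub>0) (approach N (P13_minus N) p\<^sub>0)) \<and>
        (\<forall>n\<le>N - 2. (lam N n \<longlongrightarrow> lam N n p\<^sub>0) (approach N (P13l_plus N \<union> P13l N) p\<^sub>0)) \<and>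
        filterlim (lam N (N - 1)) at_top (approach N (P13l_plus N) p\<^sub>0)) \<and>
     \<comment> \<open>(ii), asymptotics near \<open>P5\<close>; \<open>n + 3 \<le> N\<close> is \<open>n \<le> N - 3\<close> without truncation\<close>
     (\<forall>p\<^sub>0\<in>P5 N.
        filterlim (lam N 0) at_bot (approach N (P13r_plus N \<union> P13r N \<union> P13_minus N) p\<^sub>0) \<and>
        filterlim (lam N 1) at_bot (approach N (P13r_plus N) p\<^sub>0) \<and>
        (\<forall>n. n + 3 \<le> N \<longrightarrow>
           (lam N n \<longlongrightarrow> lam N n p\<^sub>0) (approach N (P13l_plus N \<union> P13l N \<union> P5 N) p\<^sub>0)) \<and>
        (\<forall>n. 1 \<le> n \<and> n \<le> N - 2 \<longrightarrow>
           (lam N n \<longlongrightarrow> lam N (n - 1) p\<^sub>0) (approach N (P13r N \<union> P13_minus N) p\<^sub>0)) \<and>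
        (\<forall>n. 2 \<le> n \<and> n \<le> N - 1 \<longrightarrow>
           (lam N n \<longlongrightarrow> lam N (n - 2) p\<^sub>0) (approach N (P13r_plus N) p\<^sub>0)) \<and>
        filterlim (lam N (N - 2)) at_top (approach N (P13l_plus N \<union> P13l N) p\<^sub>0) \<and>
        filterlim (lam N (N - 1)) at_top (approach N (P13l_plus N \<union> P13_minus N) p\<^sub>0)) \<and>
     \<comment> \<open>consequences\<close>
     ((\<forall>n. n + 3 \<le> N \<longrightarrow>
         lam_continuous_on N n (P13_minus N \<union> P13r N) \<and>
         lam_continuous_on N n (P13l_plus N \<union> P13l N \<union> P5 N)) \<and>
      lam_continuous_on N (N - 2) (P13_minus N \<union> P13r N) \<and>
      lam_continuous_on N (N - 2) (P13l_plus N \<union> P13l N))"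
proof (intro conjI ballI allI impI)
  note N = \<open>N \<ge> 2\<close>
  note ch = region_subset_chart[of N]
  note ends = region_ends[OF N]
  note top = lam_at_top[OF N] and bot = lam_at_bot[OF N]
  have lim: "(lam N n \<longlongrightarrow> lam N j p\<^sub>0) (approach N S p\<^sub>0)"
    if "p\<^sub>0 \<in> chart N" "S \<subseteq> chart N" "j < num_eigenvalues N p\<^sub>0" "j \<le> n"
      "\<And>p. p \<in> S \<Longrightarrow> pos_ends N p = pos_ends N p\<^sub>0 + (n - j)" for n j p\<^sub>0 S
    using lam_tendsto[OF N that(1-3), of "n - j"] eventually_approach[of S _ N p\<^sub>0] that(4,5) by simp
  have num: "num_eigenvalues N p + 2 = N + pos_ends N p + neg_ends N p" if "p \<in> chart N" for p
    using num_eigenvalues_ends[OF that N] .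
  have num_regions: "p \<in> P5 N \<Longrightarrow> num_eigenvalues N p = N - 2"
    "p \<in> P13_minus N \<Longrightarrow> num_eigenvalues N p = N"
    "p \<in> P13r N \<Longrightarrow> num_eigenvalues N p = N - 1"
    "p \<in> P13l N \<Longrightarrow> num_eigenvalues N p = N - 1"
    "p \<in> P13r_plus N \<Longrightarrow> num_eigenvalues N p = N"
    "p \<in> P13l_plus N \<Longrightarrow> num_eigenvalues N p = N" for p
    using num[of p] ends[of p] ch by auto
  have num_off: "num_eigenvalues N p = N" if "p \<in> chart N - P13 N" for p
    using that num_regions unfolding chart_minus_P13_cases by blast
  have const: "lam_continuous_on N n S"
    if "S \<subseteq> chart N" "\<And>p. p \<in> S \<Longrightarrow> n < num_eigenvalues N p" "\<And>p. p \<in> S \<Longrightarrow> pos_ends N p = k" for n S k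
    using that by (intro lam_continuous_onI[OF N] eventually_approach) auto
  {
    fix p assume p: "p \<in> P5 N"
    then show "has_exactly_eigenvalues N p (N - 2)"
      using has_exactly_eigenvalues_num[OF _ N, of p] num_regions(1) ch by auto
  next
    fix p assume p: "p \<in> P13 N - P5 N"
    then have "num_eigenvalues N p = N - 1" using P13_cases num_regions by blast
    then show "has_exactly_eigenvalues N p (N - 1)"
      using has_exactly_eigenvalues_num[OF _ N, of p] p ch by auto
  next
    fix p assume p: "p \<in> chart N - P13 N"
    then show "has_exactly_eigenvalues N p N"
      using has_exactly_eigenvalues_num[OF _ N, of p] num_off by auto
  next
    fix n assume n: "n < N"
    show "lam_continuous_on N n (chart N - P13 N)"
    proof (rule lam_continuous_onI[OF N])
      fix p\<^sub>0 assume p0: "p\<^sub>0 \<in> chart N - P13 N"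
      have "eventually (\<lambda>p. p \<in> chart N - P13 N) (approach N (chart N - P13 N) p\<^sub>0)"
        by (rule eventually_approach)
      moreover have "eventually (\<lambda>p. pos_ends N p\<^sub>0 \<le> pos_ends N p \<and> neg_ends N p\<^sub>0 \<le> neg_ends N p)
          (approach N (chart N - P13 N) p\<^sub>0)"
        using p0 by (intro eventually_ends_ge[OF N]) auto
      ultimately show "eventually (\<lambda>p. pos_ends N p = pos_ends N p\<^sub>0) (approach N (chart N - P13 N) p\<^sub>0)"
      proof eventually_elim
        case (elim p)
        \<comment> \<open>Off \<open>P13\<close> both signatures satisfy \<pi> + \<nu> = 2, so if
          neither number drops, neither can rise.\<close>
        then show ?case using num[of p] num[of p\<^sub>0] num_off[of p] num_off[of p\<^sub>0] p0 by auto
      qed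
    qed (use n num_off in auto)
  next
    fix p\<^sub>0 n
    assume "p\<^sub>0 \<in> P13 N"
      "\<not> (0 < n \<and> n < num_eigenvalues N p\<^sub>0 \<and> lam N (n - 1) p\<^sub>0 = lam N n p\<^sub>0)"
    then show "\<not> lam_continuous_at N n p\<^sub>0" by (rule lam_discontinuous_on_P13[OF N])
  next
    fix p\<^sub>0 n assume "p\<^sub>0 \<in> P13r N" "n \<le> N - 2"
    then show "(lam N n \<longlongrightarrow> lam N n p\<^sub>0) (approach N (P13_minus N \<union> P13r N) p\<^sub>0)"
      using ch ends num_regions N by (intro lim) auto
  next
    fix p\<^sub>0 assume "p\<^sub>0 \<in> P13r N"
    then show "filterlim (lam N (N - 1)) at_top (approach N (P13_minus N) p\<^sub>0)"
      using ch ends num_regions N by (intro top) auto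
  next
    fix p\<^sub>0 assume "p\<^sub>0 \<in> P13r N"
    then show "filterlim (lam N 0) at_bot (approach N (P13r_plus N) p\<^sub>0)"
      using ch ends by (intro bot) auto
  next
    fix p\<^sub>0 n assume "p\<^sub>0 \<in> P13r N" "1 \<le> n \<and> n \<le> N - 1"
    then show "(lam N n \<longlongrightarrow> lam N (n - 1) p\<^sub>0) (approach N (P13r_plus N) p\<^sub>0)"
      using ch ends num_regions N by (intro lim) auto
  next
    fix p\<^sub>0 assume "p\<^sub>0 \<in> P13l N"
    then show "filterlim (lam N 0) at_bot (approach N (P13_minus N) p\<^sub>0)"
      using ch ends by (intro bot) auto
  next
    fix p\<^sub>0 n assume "p\<^sub>0 \<in> P13l N" "1 \<le> n \<and> n \<le> N - 1"
    then show "(lam N n \<longlongrightarrow> lam N (n - 1) p\<^sub>0) (approach N (P13_minus N) p\<^sub>0)"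
      using ch ends num_regions N by (intro lim) auto
  next
    fix p\<^sub>0 n assume "p\<^sub>0 \<in> P13l N" "n \<le> N - 2"
    then show "(lam N n \<longlongrightarrow> lam N n p\<^sub>0) (approach N (P13l_plus N \<union> P13l N) p\<^sub>0)"
      using ch ends num_regions N by (intro lim) auto
  next
    fix p\<^sub>0 assume "p\<^sub>0 \<in> P13l N"
    then show "filterlim (lam N (N - 1)) at_top (approach N (P13l_plus N) p\<^sub>0)"
      using ch ends num_regions N by (intro top) auto
  next
    fix p\<^sub>0 assume "p\<^sub>0 \<in> P5 N"
    then show "filterlim (lam N 0) at_bot (approach N (P13r_plus N \<union> P13r N \<union> P13_minus N) p\<^sub>0)"
      using ch ends by (intro bot) auto
  next
    fix p\<^sub>0 assume "p\<^sub>0 \<in> P5 N"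
    then show "filterlim (lam N 1) at_bot (approach N (P13r_plus N) p\<^sub>0)"
      using ch ends by (intro bot) auto
  next
    fix p\<^sub>0 n assume "p\<^sub>0 \<in> P5 N" "n + 3 \<le> N"
    then show "(lam N n \<longlongrightarrow> lam N n p\<^sub>0) (approach N (P13l_plus N \<union> P13l N \<union> P5 N) p\<^sub>0)"
      using ch ends num_regions by (intro lim) auto
  next
    fix p\<^sub>0 n assume "p\<^sub>0 \<in> P5 N" "1 \<le> n \<and> n \<le> N - 2"
    then show "(lam N n \<longlongrightarrow> lam N (n - 1) p\<^sub>0) (approach N (P13r N \<union> P13_minus N) p\<^sub>0)"
      using ch ends num_regions by (intro lim) auto
  next
    fix p\<^sub>0 n assume "p\<^sub>0 \<in> P5 N" "2 \<le> n \<and> n \<le> N - 1"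
    then show "(lam N n \<longlongrightarrow> lam N (n - 2) p\<^sub>0) (approach N (P13r_plus N) p\<^sub>0)"
      using ch ends num_regions by (intro lim) auto
  next
    fix p\<^sub>0 assume "p\<^sub>0 \<in> P5 N"
    then show "filterlim (lam N (N - 2)) at_top (approach N (P13l_plus N \<union> P13l N) p\<^sub>0)"
      using ch ends num_regions N by (intro top) auto
  next
    fix p\<^sub>0 assume "p\<^sub>0 \<in> P5 N"
    then show "filterlim (lam N (N - 1)) at_top (approach N (P13l_plus N \<union> P13_minus N) p\<^sub>0)"
      using ch ends num_regions N by (intro top) auto
  next
    fix n assume "n + 3 \<le> N"
    then show "lam_continuous_on N n (P13_minus N \<union> P13r N)"
      using ch ends num_regions by (intro const[where k = 1]) auto
  next
    fix n assume "n + 3 \<le> N"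
    then show "lam_continuous_on N n (P13l_plus N \<union> P13l N \<union> P5 N)"
      using ch ends num_regions by (intro const[where k = 0]) auto
  next
    show "lam_continuous_on N (N - 2) (P13_minus N \<union> P13r N)"
      using ch ends num_regions N by (intro const[where k = 1]) auto
  next
    show "lam_continuous_on N (N - 2) (P13l_plus N \<union> P13l N)"
      using ch ends num_regions N by (intro const[where k = 0]) auto
  }
qed

end
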